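(* Let $0<\theta<1$ and let $\lambda_\theta$ be the lens map of parameter $\theta$. Then the composition operator $C_{\lambda_\theta}f=f\circ\lambda_\theta$ is not compact on $\mathcal D^2=\mathcal D^2_0$; but for all $\alpha>0$, $C_{\lambda_\theta}$ is compact on $\mathcal D^2_\alpha$, and moreover there are constants $b>b'>0$ depending only on $\theta$ and $\alpha$, and constants $c,C>0$ (possibly depending on $\theta$ and $\alpha$), such that for all $n\ge1$ the approximation numbers of $C_{\lambda_\theta}$ on $\mathcal D^2_\alpha$ satisfy $$c\,e^{-b\sqrt n}\le a_n(C_{\lambda_\theta})\le C\,e^{-b'\sqrt n}.$$ In particular, for $\alpha>0$, $C_{\lambda_\theta}$ is in all the Schatten classes $S_p(\mathcal D^2_\alpha)$, $p>0$.
   Context: $\mathbb D$ is the open unit disk of $\mathbb C$, $dA=dx\,dy/\pi$. The lens map of parameter $\theta\in(0,1)$ is $\lambda_\theta\colon\mathbb D\to\mathbb D$, $\lambda_\theta(z)=\frac{(1+z)^\theta-(1-z)^\theta}{(1+z)^\theta+(1-z)^\theta}$ (principal powers). For $\alpha>-1$, $\mathcal D^2_\alpha$ is the Hilbert space of analytic functions $f$ on $\mathbb D$ with $\|f\|^2_{\mathcal D^2_\alpha}=|f(0)|^2+(\alpha+1)\int_{\mathbb D}|f'(z)|^2(1-|z|^2)^\alpha\,dA(z)<\infty$. For a bounded operator $T$, $a_n(T)=\inf\{\|T-R\|:\operatorname{rank}R<n\}$; $S_p(H)$ is the set of compact operators $T$ on $H$ with $\sum_na_n(T)^p<\infty$.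 *)

theory Defs
  imports "HOL-Analysis.Analysis" "HOL-Library.Function_Algebras"
begin

global_interpretation cfun: vector_space "\<lambda>(c::complex) (f::complex \<Rightarrow> complex) z. c * f z"
  defines cfun_span = cfun.span and cfun_dim = cfun.dim
  by unfold_locales (auto simp: fun_eq_iff algebra_simps)

section \<open>Operators on a normed space of functions\<close>

text \<open>A normed space is a carrier \<open>H\<close>, closed under pointwise complex linear combinations, together
  with its norm \<open>N\<close>. Operators are functions whose values outside \<open>H\<close> are irrelevant.\<close>

type_synonym cfun = "complex \<Rightarrow> complex"

definition bounded_operator :: "cfun set \<Rightarrow> (cfun \<Rightarrow> real) \<Rightarrow> (cfun \<Rightarrow> cfun) \<Rightarrow> bool" where
  "bounded_operator H N T \<longleftrightarrow>
     (\<forall>f\<in>H. T f \<in> H) \<and>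
     (\<forall>f\<in>H. \<forall>g\<in>H. \<forall>a b. T (\<lambda>z. a * f z + b * g z) = (\<lambda>z. a * T f z + b * T g z)) \<and>
     (\<exists>K. \<forall>f\<in>H. N (T f) \<le> K * N f)"

definition operator_norm :: "cfun set \<Rightarrow> (cfun \<Rightarrow> real) \<Rightarrow> (cfun \<Rightarrow> cfun) \<Rightarrow> real" where
  "operator_norm H N T = (SUP f\<in>{f\<in>H. N f \<le> 1}. N (T f))"

definition norm_topology :: "cfun set \<Rightarrow> (cfun \<Rightarrow> real) \<Rightarrow> cfun topology" where
  "norm_topology H N = Metric_space.mtopology H (\<lambda>f g. N (\<lambda>z. f z - g z))"

definition compact_operator :: "cfun set \<Rightarrow> (cfun \<Rightarrow> real) \<Rightarrow> (cfun \<Rightarrow> cfun) \<Rightarrow> bool" where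
  "compact_operator H N T \<longleftrightarrow> bounded_operator H N T \<and>
     compactin (norm_topology H N) (norm_topology H N closure_of (T ` {f\<in>H. N f \<le> 1}))"

text \<open>The first conjunct is needed because \<open>dim\<close> is \<open>0\<close> on infinite-dimensional spaces.\<close>

definition rank_less :: "cfun set \<Rightarrow> (cfun \<Rightarrow> cfun) \<Rightarrow> nat \<Rightarrow> bool" where
  "rank_less H R n \<longleftrightarrow> (\<exists>B. finite B \<and> R ` H \<subseteq> cfun_span B) \<and> cfun_dim (R ` H) < n"

text \<open>Meaningful for \<open>n \<ge> 1\<close> only (the infimum is over the empty set when \<open>n = 0\<close>).\<close>

definition approx_number ::
    "cfun set \<Rightarrow> (cfun \<Rightarrow> real) \<Rightarrow> nat \<Rightarrow> (cfun \<Rightarrow> cfun) \<Rightarrow> real" where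
  "approx_number H N n T =
     (INF R\<in>{R. bounded_operator H N R \<and> rank_less H R n}. operator_norm H N (\<lambda>f z. T f z - R f z))"

definition schatten_class :: "cfun set \<Rightarrow> (cfun \<Rightarrow> real) \<Rightarrow> real \<Rightarrow> (cfun \<Rightarrow> cfun) set" where
  "schatten_class H N p =
     {T. compact_operator H N T \<and> summable (\<lambda>n. approx_number H N (Suc n) T powr p)}"

section \<open>Weighted Dirichlet spaces and lens maps\<close>

text \<open>A function on the disk is represented by its extension by \<open>0\<close>, so that equality of elements is
  equality on the disk.\<close>

definition dirichlet_space :: "real \<Rightarrow> cfun set" where
  "dirichlet_space \<alpha> = {f. f holomorphic_on ball 0 1 \<and> (\<forall>z. z \<notin> ball 0 1 \<longrightarrow> f z = 0) \<and>
     set_integrable lborel (ball 0 1)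
       (\<lambda>z. (cmod (deriv f z))\<^sup>2 * (1 - (cmod z)\<^sup>2) powr \<alpha>)}"

text \<open>The area measure is normalised, \<open>dA = dx dy / pi\<close>.\<close>

definition dirichlet_norm :: "real \<Rightarrow> cfun \<Rightarrow> real" where
  "dirichlet_norm \<alpha> f = sqrt ((cmod (f 0))\<^sup>2 + (\<alpha> + 1) *
     ((LINT z:ball 0 1|lborel. (cmod (deriv f z))\<^sup>2 * (1 - (cmod z)\<^sup>2) powr \<alpha>) / pi))"

definition lens_map :: "real \<Rightarrow> complex \<Rightarrow> complex" where
  "lens_map \<theta> z = ((1 + z) powr of_real \<theta> - (1 - z) powr of_real \<theta>) /
     ((1 + z) powr of_real \<theta> + (1 - z) powr of_real \<theta>)"

definition composition_operator :: "(complex \<Rightarrow> complex) \<Rightarrow> cfun \<Rightarrow> cfun" where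
  "composition_operator \<phi> f = (\<lambda>z. if z \<in> ball 0 1 then f (\<phi> z) else 0)"

end

theory Submission
  imports Defs "HOL-Complex_Analysis.Complex_Analysis"
begin

text \<open>
  The map \<open>u = log ((1 + z) / (1 - z))\<close> takes the disk onto the strip \<open>|Im u| < pi / 2\<close> and turns the lens
  map into the dilation \<open>u \<mapsto> \<theta> u\<close>. Conformal invariance gives the norm of \<open>F(u) = f(z)\<close> as the integral of
  \<open>|F'|\<^sup>2 w\<^sup>\<alpha>\<close> over the strip, where \<open>w(u) = 1 - |z|\<^sup>2\<close> decays like \<open>exp (- |Re u|)\<close>. By the mean value
  property \<open>|F'(\<theta> u)|\<^sup>2\<close> grows at most like \<open>exp (\<alpha> \<theta> |Re u|)\<close>, so the energy of the image of the unit ball is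
  dominated by \<open>exp (- \<alpha> (1 - \<theta>) |Re u|)\<close>, which is integrable for \<open>\<alpha> > 0\<close>; with Montel's theorem this is
  compactness. For \<open>\<alpha> = 0\<close> the energy is invariant under translations of the strip, and translates of
  one function refute compactness.

  For the upper estimate let \<open>F'\<close> vanish to order \<open>N\<close> at \<open>2 N + 1\<close> equally spaced real points: then
  \<open>F'(\<theta> u)\<close> is geometrically small in \<open>N\<close> on a part of the strip of length proportional to \<open>N\<close>, and
  the energy outside is small by the exponential domination. These are about \<open>2 N\<^sup>2\<close> linear
  conditions, and an almost orthogonal projection onto their common kernel gives the operator of
  finite rank. For the lower estimate, exponentials of period proportional to \<open>sqrt n\<close> span an
  \<open>n\<close>-dimensional space on which the operator is bounded below by \<open>exp (- b sqrt n)\<close>.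
\<close>

section \<open>Conformal change of variables in the plane\<close>

text \<open>The hypothesis \<open>\<theta> < 1\<close> acts twice. Dilation by
  \<open>\<theta>\<close> moves the strip into a narrower one at positive distance from the boundary
  lines, so mean value and Cauchy estimates have uniform constants there. It also lowers the growth
  rate of the squared derivative from \<open>\<alpha>\<close> to \<open>\<alpha> * \<theta>\<close>,
  below the decay rate \<open>\<alpha>\<close> of the weight. At \<open>\<alpha> = 0\<close> the
  second gain is lost.

  The exponent \<open>sqrt n\<close> is a count of degrees of freedom: accuracy
  \<open>exp (- c * N)\<close> requires control over a piece of the strip of length about
  \<open>N\<close>, with about \<open>N\<close> conditions per unit of length, hence a multiple of
  \<open>N^2\<close> conditions. The lower estimate balances the same two costs, with
  \<open>n\<close> frequencies up to \<open>sqrt n\<close> and a period proportional to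
  \<open>sqrt n\<close>.

  Completeness of the spaces is never established, so exact orthogonal projections are out of reach.
  The Hilbert space structure enters only through the quadratic dependence of the squared norm on
  real multiples, and projections of norm at most a prescribed \<open>K > 1\<close> replace the
  exact ones.\<close>

definition cvec :: "real^2 \<Rightarrow> complex" where
  "cvec v = Complex (v $ 1) (v $ 2)"

definition vecc :: "complex \<Rightarrow> real^2" where
  "vecc z = (\<chi> i. if i = 1 then Re z else Im z)"

lemma cvec_vecc [simp]: "cvec (vecc z) = z"
  by (simp add: cvec_def vecc_def complex_eq_iff)

lemma vecc_cvec [simp]: "vecc (cvec v) = v"
  by (simp add: cvec_def vecc_def vec_eq_iff forall_2)

lemma linear_cvec: "linear cvec"
  by (intro linearI) (auto simp: cvec_def complex_eq_iff)

lemma linear_vecc: "linear vecc"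
  by (intro linearI) (auto simp: vecc_def vec_eq_iff)

lemma bounded_linear_cvec: "bounded_linear cvec"
  using linear_cvec by (simp add: linear_conv_bounded_linear)

lemma bounded_linear_vecc: "bounded_linear vecc"
  using linear_vecc by (simp add: linear_conv_bounded_linear)

lemma cvec_measurable [measurable]: "cvec \<in> borel_measurable borel"
  by (intro borel_measurable_continuous_onI linear_continuous_on bounded_linear_cvec)

text \<open>Lebesgue measure is determined by its values on boxes, and the preimage of a box under
  \<open>cvec\<close> is the box with the same sides. Integrals over \<open>complex\<close> can thus
  be moved to \<open>real^2\<close>, where the change of variables with determinants is
  formulated.\<close>

lemma distr_cvec: "distr lborel borel cvec = lborel"
proof (rule lborel_eqI[symmetric])
  fix l u :: complex assume le: "\<And>b. b \<in> Basis \<Longrightarrow> l \<bullet> b \<le> u \<bullet> b"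
  have vim: "cvec -` box l u = box (vecc l) (vecc u)"
    by (auto simp: box_def cvec_def vecc_def Basis_complex_def inner_complex_def Basis_vec_def
        inner_axis' forall_2 inner_axis)
  have le2: "Re l \<le> Re u" "Im l \<le> Im u"
    using le[of 1] le[of \<i>] by (auto simp: Basis_complex_def inner_complex_def)
  have "emeasure (distr lborel borel cvec) (box l u) = emeasure lborel (box (vecc l) (vecc u))"
    by (simp add: emeasure_distr vim)
  also have "\<dots> = (\<Prod>b\<in>Basis. (vecc u - vecc l) \<bullet> b)"
    using le2 by (intro emeasure_lborel_box) (auto simp: Basis_vec_def inner_axis vecc_def)
  also have "(\<Prod>b\<in>Basis. (vecc u - vecc l) \<bullet> b) = (\<Prod>b\<in>Basis. (u - l) \<bullet> b)"
  proof -
    have B: "(Basis :: (real^2) set) = {axis 1 1, axis 2 1}"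
      by (auto simp: Basis_vec_def UNIV_2)
    have "axis 1 (1::real) \<noteq> (axis 2 1 :: real^2)"
      by (simp add: axis_eq_axis)
    then show ?thesis unfolding B
      by (simp add: Basis_complex_def inner_complex_def inner_axis vecc_def complex_eq_iff)
  qed
  finally show "emeasure (distr lborel borel cvec) (box l u) = (\<Prod>b\<in>Basis. (u - l) \<bullet> b)" .
qed simp

text \<open>The change of variables theorem consists of an equivalence of integrability and an
  equation of integrals. As a value in the extended half line the two become a single equation, free
  of integrability hypotheses.\<close>

lemma set_nn_integral_absolutely_integrable:
  fixes f :: "'a::euclidean_space \<Rightarrow> real"
  assumes B: "B \<in> sets borel" and m: "(\<lambda>x. indicator B x * f x) \<in> borel_measurable borel"
    and nn: "\<And>x. x \<in> B \<Longrightarrow> 0 \<le> f x"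
  shows "(\<integral>\<^sup>+x\<in>B. ennreal (f x) \<partial>lborel) =
    (if f absolutely_integrable_on B then ennreal (integral B f) else \<infinity>)"
proof -
  have eq: "(\<integral>\<^sup>+x\<in>B. ennreal (f x) \<partial>lborel) = (\<integral>\<^sup>+x. ennreal (indicator B x * f x) \<partial>lborel)"
    by (intro nn_integral_cong) (auto simp: indicator_def)
  have m': "(\<lambda>x. indicator B x * f x) \<in> borel_measurable lborel" using m by simp
  have nn': "0 \<le> indicator B x * f x" for x using nn by (auto simp: indicator_def)
  have iff: "f absolutely_integrable_on B \<longleftrightarrow> integrable lborel (\<lambda>x. indicator B x * f x)"
    unfolding set_integrable_def using m' by (simp add: integrable_completion)
  show ?thesis
  proof (cases "f absolutely_integrable_on B")
    case True
    then have i: "integrable lborel (\<lambda>x. indicator B x * f x)" using iff by simp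
    have "integral B f = (LINT x:B|lebesgue. f x)"
      using True by (simp add: set_lebesgue_integral_eq_integral)
    also have "\<dots> = (LINT x|lborel. indicator B x * f x)"
      unfolding set_lebesgue_integral_def using m' by (simp add: integral_completion)
    finally show ?thesis using True eq nn_integral_eq_integral[OF i] nn' by simp
  next
    case False
    then have "\<not> integrable lborel (\<lambda>x. indicator B x * f x)" using iff by simp
    then have "(\<integral>\<^sup>+x. ennreal (indicator B x * f x) \<partial>lborel) = \<infinity>"
      using integrableI_nonneg[OF m'] nn' by (metis (no_types, lifting) AE_I2 infinity_ennreal_def top.not_eq_extremum)
    then show ?thesis using False eq by simp
  qed
qed

lemma nn_integral_cvec:
  assumes "f \<in> borel_measurable borel"
  shows "(\<integral>\<^sup>+z. f z \<partial>lborel) = (\<integral>\<^sup>+v. f (cvec v) \<partial>lborel)"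
  using assms by (subst distr_cvec[symmetric]) (simp add: nn_integral_distr)

lemma indicator_continuous_measurable:
  fixes f :: "'a::euclidean_space \<Rightarrow> real"
  assumes "open A" "continuous_on A f"
  shows "(\<lambda>x. indicator A x * f x) \<in> borel_measurable borel"
  using borel_measurable_continuous_on_indicator[of A f] assms by simp

text \<open>By the Cauchy-Riemann equations, multiplication by \<open>deriv \<phi> z\<close> is a
  real linear map with determinant the square of its modulus. The extended-valued form transfers
  finiteness of an energy together with its value.\<close>

theorem conformal_change_of_variables:
  fixes \<phi> :: "complex \<Rightarrow> complex" and h :: "complex \<Rightarrow> real"
  assumes A: "open A" and hol: "\<phi> holomorphic_on A" and inj: "inj_on \<phi> A"
    and conth: "continuous_on (\<phi> ` A) h" and nn: "\<And>u. u \<in> \<phi> ` A \<Longrightarrow> 0 \<le> h u"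
  shows "(\<integral>\<^sup>+z\<in>A. ennreal (h (\<phi> z) * (cmod (deriv \<phi> z))\<^sup>2) \<partial>lborel) = (\<integral>\<^sup>+u\<in>\<phi> ` A. ennreal (h u) \<partial>lborel)"
proof -
  define g where "g v = vecc (\<phi> (cvec v))" for v
  define g' where "g' v w = vecc (deriv \<phi> (cvec v) * cvec w)" for v w
  define S where "S = cvec -` A"
  have opA: "open (\<phi> ` A)" using open_mapping_thm3[OF hol A inj] .
  have S: "open S" unfolding S_def
    by (intro open_vimage A linear_continuous_on bounded_linear_cvec)
  have gS: "g ` S = cvec -` (\<phi> ` A)"
  proof -
    have "cvec -` X = vecc ` X" for X
      by (auto intro: image_eqI[where x = "cvec _"])
    then show ?thesis by (simp add: S_def g_def image_image)
  qed
  have opgS: "open (g ` S)" unfolding gS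
    by (intro open_vimage opA linear_continuous_on bounded_linear_cvec)
  have contd: "continuous_on A (deriv \<phi>)"
    by (intro holomorphic_on_imp_continuous_on holomorphic_deriv hol A)
  have c1: "continuous_on A (\<lambda>z. h (\<phi> z) * (cmod (deriv \<phi> z))\<^sup>2)"
    by (intro continuous_intros contd continuous_on_compose2[OF conth holomorphic_on_imp_continuous_on[OF hol]]) auto
  have der: "(g has_derivative g' v) (at v within S)" if "v \<in> S" for v
  proof -
    have "(\<phi> has_field_derivative deriv \<phi> (cvec v)) (at (cvec v))"
      using that hol A by (simp add: S_def holomorphic_derivI)
    then have "(\<phi> has_derivative (\<lambda>w. deriv \<phi> (cvec v) * w)) (at (cvec v))"
      by (simp add: has_field_derivative_def)
    moreover have "(cvec has_derivative cvec) (at v)"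
      by (intro bounded_linear.has_derivative[OF bounded_linear_cvec] has_derivative_ident)
    ultimately have "((\<lambda>v. \<phi> (cvec v)) has_derivative (\<lambda>w. deriv \<phi> (cvec v) * cvec w)) (at v)"
      using has_derivative_compose by blast
    then have "(g has_derivative g' v) (at v)"
      unfolding g_def g'_def by (rule bounded_linear.has_derivative[OF bounded_linear_vecc])
    then show ?thesis using has_derivative_at_withinI by blast
  qed
  have injg: "inj_on g S"
  proof (rule inj_onI)
    fix v w assume *: "v \<in> S" "w \<in> S" "g v = g w"
    then have "\<phi> (cvec v) = \<phi> (cvec w)" by (metis g_def cvec_vecc)
    then have "cvec v = cvec w" using * inj by (auto simp: S_def dest: inj_onD)
    then show "v = w" by (metis vecc_cvec)
  qed
  have det: "\<bar>det (matrix (g' v))\<bar> = (cmod (deriv \<phi> (cvec v)))\<^sup>2" for v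
    by (simp add: det_2 matrix_def g'_def vecc_def cvec_def cmod_def axis_def power2_eq_square)
  \<comment> \<open>The change of variables theorem concerns vector-valued integrands, so the real
    function is wrapped as one with values in \<open>real^1\<close>.\<close>
  define k where "k v = (vec (h (cvec v)) :: real^1)" for v
  have kk: "f absolutely_integrable_on T \<longleftrightarrow> (\<lambda>v. vec (f v) :: real^1) absolutely_integrable_on T"
     "(\<lambda>v. vec (f v) :: real^1) absolutely_integrable_on T \<Longrightarrow> integral T (\<lambda>v. vec (f v) :: real^1) = vec (integral T f)"
    for f :: "real^2 \<Rightarrow> real" and T
  proof -
    have bl: "bounded_linear (\<lambda>x. vec x :: real^1)"
      by (simp add: linear_conv_bounded_linear[symmetric] linearI vec_eq_iff)
    have bl2: "bounded_linear (\<lambda>x::real^1. x $ 1)" by (rule bounded_linear_vec_nth)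
    show *: "f absolutely_integrable_on T \<longleftrightarrow> (\<lambda>v. vec (f v) :: real^1) absolutely_integrable_on T"
    proof
      assume "f absolutely_integrable_on T"
      from absolutely_integrable_linear[OF this bl]
      show "(\<lambda>v. vec (f v) :: real^1) absolutely_integrable_on T" by (simp only: o_def)
    next
      assume "(\<lambda>v. vec (f v) :: real^1) absolutely_integrable_on T"
      from absolutely_integrable_linear[OF this bl2]
      show "f absolutely_integrable_on T" by (simp only: o_def vec_component)
    qed
    assume "(\<lambda>v. vec (f v) :: real^1) absolutely_integrable_on T"
    then have "f integrable_on T" using * set_lebesgue_integral_eq_integral(1) by blast
    from integral_linear[OF this bl] show "integral T (\<lambda>v. vec (f v) :: real^1) = vec (integral T f)" by (simp add: o_def)
  qed
  have cov: "(\<lambda>x. \<bar>det (matrix (g' x))\<bar> *\<^sub>R k (g x)) absolutely_integrable_on S \<and>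
           integral S (\<lambda>x. \<bar>det (matrix (g' x))\<bar> *\<^sub>R k (g x)) = b
     \<longleftrightarrow> k absolutely_integrable_on (g ` S) \<and> integral (g ` S) k = b" for b
    by (rule has_absolute_integral_change_of_variables[OF _ der injg]) (use S in auto)
  have e1: "\<bar>det (matrix (g' x))\<bar> *\<^sub>R k (g x) = vec (h (\<phi> (cvec x)) * (cmod (deriv \<phi> (cvec x)))\<^sup>2)" for x
    by (simp add: det k_def g_def vec_eq_iff)
  have cov2: "(\<lambda>v. h (\<phi> (cvec v)) * (cmod (deriv \<phi> (cvec v)))\<^sup>2) absolutely_integrable_on S \<longleftrightarrow>
      (\<lambda>v. h (cvec v)) absolutely_integrable_on (g ` S)"
    (is "?P = ?Q")
  proof -
    have "?P \<longleftrightarrow> (\<lambda>x. \<bar>det (matrix (g' x))\<bar> *\<^sub>R k (g x)) absolutely_integrable_on S"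
      unfolding e1 by (rule kk(1))
    also have "\<dots> \<longleftrightarrow> k absolutely_integrable_on (g ` S)"
      by (rule absolutely_integrable_change_of_variables[OF _ der injg, symmetric]) (use S in auto)
    also have "\<dots> \<longleftrightarrow> ?Q" unfolding k_def by (rule kk(1)[symmetric])
    finally show ?thesis .
  qed
  have cov3: "integral S (\<lambda>v. h (\<phi> (cvec v)) * (cmod (deriv \<phi> (cvec v)))\<^sup>2) = integral (g ` S) (\<lambda>v. h (cvec v))"
    if "(\<lambda>v. h (cvec v)) absolutely_integrable_on (g ` S)"
  proof -
    let ?k = "\<lambda>v. vec (h (\<phi> (cvec v)) * (cmod (deriv \<phi> (cvec v)))\<^sup>2) :: real^1"
    have "k absolutely_integrable_on (g ` S)" using that unfolding k_def by (rule iffD1[OF kk(1)])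
    from iffD2[OF cov[unfolded e1] conjI[OF this refl]]
    have "?k absolutely_integrable_on S \<and> integral S ?k = integral (g ` S) k" .
    then have D: "?k absolutely_integrable_on S" "integral S ?k = integral (g ` S) k" by auto
    have "vec (integral S (\<lambda>v. h (\<phi> (cvec v)) * (cmod (deriv \<phi> (cvec v)))\<^sup>2)) = integral (g ` S) k"
      using kk(2)[OF D(1)] D(2) by (rule subst)
    also have "\<dots> = vec (integral (g ` S) (\<lambda>v. h (cvec v)))"
      unfolding k_def by (intro kk(2) iffD1[OF kk(1)] that)
    finally have "(vec (integral S (\<lambda>v. h (\<phi> (cvec v)) * (cmod (deriv \<phi> (cvec v)))\<^sup>2)) :: real^1) = \<dots>" .
    then show ?thesis by (simp add: vec_eq_iff)
  qed
  have cc: "continuous_on S cvec" "continuous_on T cvec" for S T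
    by (auto intro: linear_continuous_on bounded_linear_cvec)
  have "(\<integral>\<^sup>+z\<in>A. ennreal (h (\<phi> z) * (cmod (deriv \<phi> z))\<^sup>2) \<partial>lborel)
      = (\<integral>\<^sup>+z. ennreal (indicator A z * (h (\<phi> z) * (cmod (deriv \<phi> z))\<^sup>2)) \<partial>lborel)"
    by (intro nn_integral_cong) (auto simp: indicator_def)
  also have "\<dots> = (\<integral>\<^sup>+v. ennreal (indicator A (cvec v) * (h (\<phi> (cvec v)) * (cmod (deriv \<phi> (cvec v)))\<^sup>2)) \<partial>lborel)"
    using indicator_continuous_measurable[OF A c1] by (intro nn_integral_cvec) simp
  also have "\<dots> = (\<integral>\<^sup>+v\<in>S. ennreal (h (\<phi> (cvec v)) * (cmod (deriv \<phi> (cvec v)))\<^sup>2) \<partial>lborel)"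
    by (intro nn_integral_cong) (auto simp: indicator_def S_def)
  also have "\<dots> = (if (\<lambda>v. h (\<phi> (cvec v)) * (cmod (deriv \<phi> (cvec v)))\<^sup>2) absolutely_integrable_on S then
      ennreal (integral S (\<lambda>v. h (\<phi> (cvec v)) * (cmod (deriv \<phi> (cvec v)))\<^sup>2)) else \<infinity>)"
    using S nn by (intro set_nn_integral_absolutely_integrable indicator_continuous_measurable
        continuous_on_compose2[OF c1 cc(1)]) (auto simp: S_def)
  also have "\<dots> = (if (\<lambda>v. h (cvec v)) absolutely_integrable_on (g ` S) then
      ennreal (integral (g ` S) (\<lambda>v. h (cvec v))) else \<infinity>)"
    using cov2 cov3 by simp
  also have "\<dots> = (\<integral>\<^sup>+v\<in>g ` S. ennreal (h (cvec v)) \<partial>lborel)"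
    using opgS nn by (intro set_nn_integral_absolutely_integrable[symmetric] indicator_continuous_measurable
        continuous_on_compose2[OF conth cc(1)]) (auto simp: gS)
  also have "\<dots> = (\<integral>\<^sup>+v. ennreal (indicator (\<phi> ` A) (cvec v) * h (cvec v)) \<partial>lborel)"
    unfolding gS by (intro nn_integral_cong) (auto simp: indicator_def)
  also have "\<dots> = (\<integral>\<^sup>+u. ennreal (indicator (\<phi> ` A) u * h u) \<partial>lborel)"
    using indicator_continuous_measurable[OF opA conth] by (intro nn_integral_cvec[symmetric]) simp
  also have "\<dots> = (\<integral>\<^sup>+u\<in>\<phi> ` A. ennreal (h u) \<partial>lborel)"
    by (intro nn_integral_cong) (auto simp: indicator_def)
  finally show ?thesis .
qed

section \<open>Area mean values\<close>

lemma distr_rotation: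
  assumes "cmod \<omega> = 1"
  shows "distr lborel borel ((*) \<omega>) = lborel"
proof (rule lborel_eqI[symmetric])
  fix l u :: complex assume le: "\<And>b. b \<in> Basis \<Longrightarrow> l \<bullet> b \<le> u \<bullet> b"
  have w0: "\<omega> \<noteq> 0" using assms by auto
  let ?A = "(*) \<omega> -` box l u"
  have op: "open ?A" by (intro open_vimage continuous_intros) auto
  have im: "(*) \<omega> ` ?A = box l u"
    using w0 by (auto intro!: image_eqI[where x = "_ / \<omega>"])
  have d: "deriv ((*) \<omega>) z = \<omega>" for z by simp
  have "(\<integral>\<^sup>+z\<in>?A. ennreal (1 * (cmod (deriv ((*) \<omega>) z))\<^sup>2) \<partial>lborel) = (\<integral>\<^sup>+u\<in>(*) \<omega> ` ?A. ennreal 1 \<partial>lborel)"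
  proof (rule conformal_change_of_variables[OF op])
    show "(*) \<omega> holomorphic_on ?A" by (intro holomorphic_intros)
    show "inj_on ((*) \<omega>) ?A" using w0 by (simp add: inj_on_def)
  qed auto
  then have "emeasure lborel ?A = emeasure lborel (box l u)"
    using op unfolding im d by (simp add: assms)
  then show "emeasure (distr lborel borel ((*) \<omega>)) (box l u) = (\<Prod>b\<in>Basis. (u - l) \<bullet> b)"
    using le by (simp add: emeasure_distr emeasure_lborel_box)
qed simp

lemma set_integrable_ball_power:
  "set_integrable lborel (ball 0 \<rho>) (\<lambda>z::complex. z ^ k)"
proof -
  have "set_integrable lborel (cball 0 \<rho>) (\<lambda>z::complex. z ^ k)"
    unfolding set_integrable_def
    by (rule borel_integrable_compact) (auto intro!: continuous_intros)
  then show ?thesis by (rule set_integrable_subset) auto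
qed

text \<open>The rotation by the angle \<open>pi / k\<close> preserves the disc and the area and
  turns \<open>z ^ k\<close> into its negative, so the integral equals its own negative.\<close>

lemma integral_ball_power:
  assumes "0 < k"
  shows "(LINT z:ball 0 \<rho>|lborel. z ^ k) = (0::complex)"
proof -
  define \<omega> where "\<omega> = cis (pi / k)"
  have w: "cmod \<omega> = 1" "\<omega> ^ k = -1"
    using assms Complex.DeMoivre[of "pi / k" k] by (simp_all add: \<omega>_def)
  have "(LINT z|lborel. indicator (ball 0 \<rho>) z *\<^sub>R z ^ k)
      = (LINT z|distr lborel borel ((*) \<omega>). indicator (ball 0 \<rho>) z *\<^sub>R z ^ k)"
    using distr_rotation[OF w(1)] by simp
  also have "\<dots> = (LINT z|lborel. indicator (ball 0 \<rho>) (\<omega> * z) *\<^sub>R (\<omega> * z) ^ k)"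
    by (intro integral_distr borel_measurable_scaleR borel_measurable_indicator
        borel_measurable_continuous_onI continuous_intros) auto
  also have "\<dots> = (LINT z|lborel. - (indicator (ball 0 \<rho>) z *\<^sub>R z ^ k))"
    by (intro Bochner_Integration.integral_cong) (auto simp: indicator_def norm_mult w power_mult_distrib)
  also have "\<dots> = - (LINT z|lborel. indicator (ball 0 \<rho>) z *\<^sub>R z ^ k)"
    by simp
  finally show ?thesis unfolding set_lebesgue_integral_def by (metis add.inverse_inverse eq_neg_iff_add_eq_0 mult_2 mult_eq_0_iff zero_neq_numeral)
qed

text \<open>Only the constant term of the power series survives integration over the disc; absolute
  convergence at radius \<open>\<rho>\<close> permits integration term by term.\<close>

lemma area_mean_value:
  assumes hol: "g holomorphic_on ball 0 R" and \<rho>: "0 < \<rho>" "\<rho> < R"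
  shows "set_integrable lborel (ball 0 \<rho>) g" "(LINT z:ball 0 \<rho>|lborel. g z) = of_real (pi * \<rho>\<^sup>2) * g 0"
proof -
  define a where "a k = (deriv ^^ k) g 0 / fact k" for k
  have ps: "(\<lambda>k. a k * z ^ k) sums g z" if "cmod z < R" for z
    using holomorphic_power_series[OF hol, of z] that by (simp add: a_def)
  define f where "f k z = indicator (ball 0 \<rho>) z *\<^sub>R (a k * z ^ k)" for k z
  \<comment> \<open>Convergence at a point strictly between \<open>\<rho>\<close> and
    \<open>R\<close> gives absolute convergence at \<open>\<rho>\<close>, and with it one summable
    majorant for the whole disc.\<close>
  have "summable (\<lambda>k. a k * (of_real ((\<rho> + R) / 2)) ^ k)"
    using ps[of "of_real ((\<rho> + R) / 2)"] \<rho> sums_summable by (auto simp del: of_real_divide of_real_add)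
  then have sm: "summable (\<lambda>k. norm (a k * of_real \<rho> ^ k))"
    by (rule powser_insidea) (use \<rho> in \<open>simp del: of_real_divide of_real_add\<close>)
  have nf: "norm (f k z) \<le> norm (a k * of_real \<rho> ^ k) * indicator (ball 0 \<rho>) z" for k z
    using \<rho> by (auto simp: f_def indicator_def norm_mult norm_power intro!: mult_left_mono power_mono)
  have int: "integrable lborel (f k)" for k
  proof -
    have "integrable lborel (\<lambda>z. a k * (indicator (ball 0 \<rho>) z *\<^sub>R z ^ k))"
      using set_integrable_ball_power[of \<rho> k] unfolding set_integrable_def
      by (rule integrable_mult_right)
    then show ?thesis by (simp add: f_def[abs_def] mult_ac)
  qed
  have intn: "norm (LINT z|lborel. norm (f k z)) \<le> norm (a k * of_real \<rho> ^ k) * measure lborel (ball (0::complex) \<rho>)" for k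
  proof -
    have "(LINT z|lborel. norm (f k z)) \<le> (LINT z|lborel. norm (a k * of_real \<rho> ^ k) * indicator (ball (0::complex) \<rho>) z)"
    proof (intro integral_mono integrable_norm int)
      have "integrable lborel (indicat_real (ball (0::complex) \<rho>))"
        using emeasure_bounded_finite[of "ball (0::complex) \<rho>"] by (simp add: integrable_indicator_iff)
      then show "integrable lborel (\<lambda>z. norm (a k * of_real \<rho> ^ k) * indicat_real (ball (0::complex) \<rho>) z)"
        by (rule integrable_mult_right)
    qed (use nf in auto)
    also have "\<dots> = norm (a k * of_real \<rho> ^ k) * measure lborel (ball (0::complex) \<rho>)"
      by simp
    finally show ?thesis by simp
  qed
  have nf': "norm (f k z) \<le> norm (a k * of_real \<rho> ^ k)" for k z
    by (rule order_trans[OF nf]) (simp add: indicator_def)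
  have s1: "summable (\<lambda>k. norm (f k z))" for z
    by (rule summable_comparison_test'[where N = 0, OF sm]) (use nf' in simp)
  have s2: "summable (\<lambda>k. LINT z|lborel. norm (f k z))"
    by (rule summable_comparison_test'[where N = 0, OF summable_mult2[OF sm]]) (use intn in auto)
  have fs: "(\<Sum>k. f k z) = indicator (ball 0 \<rho>) z *\<^sub>R g z" for z
    using ps[of z] \<rho> by (auto simp: f_def indicator_def sums_iff)
  show "set_integrable lborel (ball 0 \<rho>) g"
    using integrable_suminf[OF int AE_I2 s2] s1 fs by (simp add: set_integrable_def)
  have "(\<lambda>k. LINT z|lborel. f k z) sums (LINT z|lborel. (\<Sum>k. f k z))"
    using s1 s2 int by (intro sums_integral) auto
  moreover have "(LINT z|lborel. f k z) = (if k = 0 then of_real (pi * \<rho>\<^sup>2) * g 0 else 0)" for k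
  proof -
    have "(LINT z|lborel. f k z) = (LINT z|lborel. a k * (indicator (ball 0 \<rho>) z *\<^sub>R z ^ k))"
      by (simp add: f_def[abs_def] mult_ac)
    also have "\<dots> = a k * (LINT z:ball 0 \<rho>|lborel. z ^ k)"
      by (simp only: set_lebesgue_integral_def integral_mult_right_zero)
    also have "\<dots> = (if k = 0 then of_real (pi * \<rho>\<^sup>2) * g 0 else 0)"
      using integral_ball_power[of k \<rho>] \<rho>
      by (auto simp: a_def set_lebesgue_integral_def content_ball unit_ball_vol_2 scaleR_conv_of_real)
    finally show ?thesis .
  qed
  ultimately have "(\<lambda>k. if k = 0 then of_real (pi * \<rho>\<^sup>2) * g 0 else 0) sums (LINT z|lborel. indicator (ball 0 \<rho>) z *\<^sub>R g z)"
    by (simp add: fs)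
  then show "(LINT z:ball 0 \<rho>|lborel. g z) = of_real (pi * \<rho>\<^sup>2) * g 0"
    unfolding set_lebesgue_integral_def using sums_If_finite[of "\<lambda>k. k = 0" "\<lambda>_. of_real (pi * \<rho>\<^sup>2) * g 0"]
    by (simp add: sums_unique2)
qed

text \<open>This is subharmonicity of the squared modulus: the mean value property of the
  holomorphic function \<open>(g (c + z))^2\<close>, followed by the triangle inequality for
  integrals.\<close>

lemma area_mean_value_square:
  assumes hol: "g holomorphic_on ball c R" and \<rho>: "0 < \<rho>" "\<rho> < R"
  shows "ennreal (pi * \<rho>\<^sup>2 * (cmod (g c))\<^sup>2) \<le> (\<integral>\<^sup>+u\<in>ball c \<rho>. ennreal ((cmod (g u))\<^sup>2) \<partial>lborel)"
proof -
  define G where "G z = (g (c + z))\<^sup>2" for z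
  have im: "(+) c ` ball 0 \<rho> = ball c \<rho>" by simp
  have "(g \<circ> (+) c) holomorphic_on ball 0 R"
    by (rule holomorphic_on_compose_gen[OF _ hol]) (auto intro!: holomorphic_intros simp: dist_norm)
  then have holG: "G holomorphic_on ball 0 R"
    unfolding G_def o_def by (intro holomorphic_intros)
  have "pi * \<rho>\<^sup>2 * (cmod (g c))\<^sup>2 = norm (LINT z:ball 0 \<rho>|lborel. G z)"
    using area_mean_value(2)[OF holG \<rho>] by (simp add: G_def norm_mult norm_power)
  then have "ennreal (pi * \<rho>\<^sup>2 * (cmod (g c))\<^sup>2) \<le> (\<integral>\<^sup>+z. norm (indicator (ball 0 \<rho>) z *\<^sub>R G z) \<partial>lborel)"
    using area_mean_value(1)[OF holG \<rho>] unfolding set_lebesgue_integral_def set_integrable_def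
    using integral_norm_bound_ennreal by metis
  also have "\<dots> = (\<integral>\<^sup>+z\<in>ball 0 \<rho>. ennreal ((cmod (g (c + z)))\<^sup>2 * (cmod (deriv ((+) c) z))\<^sup>2) \<partial>lborel)"
    by (intro nn_integral_cong) (auto simp: indicator_def G_def norm_power)
  also have "\<dots> = (\<integral>\<^sup>+u\<in>(+) c ` ball 0 \<rho>. ennreal ((cmod (g u))\<^sup>2) \<partial>lborel)"
  proof (rule conformal_change_of_variables)
    show "(+) c holomorphic_on ball 0 \<rho>" by (intro holomorphic_intros)
    show "continuous_on ((+) c ` ball 0 \<rho>) (\<lambda>u. (cmod (g u))\<^sup>2)"
      unfolding im using \<rho>
      by (intro continuous_intros continuous_on_subset[OF holomorphic_on_imp_continuous_on[OF hol]]) auto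
  qed auto
  finally show ?thesis by simp
qed

section \<open>The strip model of the disk and of the lens map\<close>

definition strip :: "complex set" where
  "strip = {u. \<bar>Im u\<bar> < pi / 2}"

definition disk_of_strip :: "complex \<Rightarrow> complex" where
  "disk_of_strip u = (exp u - 1) / (exp u + 1)"

definition strip_of_disk :: "complex \<Rightarrow> complex" where
  "strip_of_disk z = Ln (1 + z) - Ln (1 - z)"

definition strip_weight :: "complex \<Rightarrow> real" where
  "strip_weight u = 1 - (cmod (disk_of_strip u))\<^sup>2"

lemma open_strip: "open strip"
  unfolding strip_def by (intro open_Collect_less continuous_intros)

lemma zero_in_strip [simp]: "0 \<in> strip"
  by (simp add: strip_def)

lemma ball_real_subset_strip: "ball (of_real x) (3 / 2) \<subseteq> strip"
proof
  fix u :: complex assume "u \<in> ball (of_real x) (3 / 2)"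
  then have "\<bar>Im u\<bar> < 3 / 2" using abs_Im_le_cmod[of "of_real x - u"] by (simp add: dist_norm)
  then show "u \<in> strip" using pi_gt3 by (simp add: strip_def)
qed

lemma convex_strip: "convex strip"
proof -
  have "strip = {u. Im u < pi / 2} \<inter> {u. Im u > - pi / 2}"
    by (auto simp: strip_def abs_less_iff)
  then show ?thesis by (metis convex_Int convex_halfspace_Im_lt convex_halfspace_Im_gt)
qed

section \<open>Exponential bounds for the weight\<close>

lemma cos_Im_strip: "u \<in> strip \<Longrightarrow> 0 < cos (Im u)"
  unfolding strip_def mem_Collect_eq by (intro cos_gt_zero_pi) linarith+

lemma Re_exp_strip: "u \<in> strip \<Longrightarrow> 0 < Re (exp u)"
  using cos_Im_strip by (simp add: Re_exp)

text \<open>In the denominator, \<open>exp x + 1\<close> is at most twice its larger summand, which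
  is \<open>exp x\<close> or \<open>1\<close> according to the sign of \<open>x\<close>. The bound
  serves both the weight and the Jacobian of \<open>disk_of_strip\<close>.\<close>

lemma exp_minus_abs_le: "exp (- \<bar>x\<bar>) \<le> 4 * exp x / (exp x + 1)\<^sup>2" for x :: real
proof (cases "x \<ge> 0")
  case True
  then have "exp (- \<bar>x\<bar>) = 4 * exp x / (2 * exp x)\<^sup>2"
    by (simp add: power2_eq_square exp_minus divide_simps)
  also have "\<dots> \<le> 4 * exp x / (exp x + 1)\<^sup>2"
    using True by (intro divide_left_mono power_mono) (auto intro!: mult_pos_pos zero_less_power add_pos_pos simp: add_pos_pos[THEN less_imp_neq, symmetric])
  finally show ?thesis .
next
  case False
  then have "exp (- \<bar>x\<bar>) = 4 * exp x / 2\<^sup>2" by simp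
  also have "\<dots> \<le> 4 * exp x / (exp x + 1)\<^sup>2"
    using False by (intro divide_left_mono power_mono) (auto intro!: mult_pos_pos zero_less_power add_pos_pos simp: add_pos_pos[THEN less_imp_neq, symmetric])
  finally show ?thesis .
qed

lemma exp_plus_one_nz: "u \<in> strip \<Longrightarrow> exp u + 1 \<noteq> 0"
  using Re_exp_strip[of u] by (metis add.commute add_eq_0_iff less_asym' minus_complex.sel(1) one_complex.sel(1) uminus_complex.sel(1) zero_less_one neg_0_less_iff_less)

lemma strip_weight_eq:
  assumes "u \<in> strip"
  shows "strip_weight u = 4 * Re (exp u) / (cmod (exp u + 1))\<^sup>2"
proof -
  have nz: "(cmod (exp u + 1))\<^sup>2 \<noteq> 0" using exp_plus_one_nz[OF assms] by simp
  have "strip_weight u = ((cmod (exp u + 1))\<^sup>2 - (cmod (exp u - 1))\<^sup>2) / (cmod (exp u + 1))\<^sup>2"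
    using nz by (simp add: strip_weight_def disk_of_strip_def norm_divide power_divide diff_divide_eq_iff)
  also have "(cmod (exp u + 1))\<^sup>2 - (cmod (exp u - 1))\<^sup>2 = 4 * Re (exp u)"
    unfolding cmod_power2 by (simp add: power2_eq_square algebra_simps)
  finally show ?thesis .
qed

lemma strip_weight_pos: "u \<in> strip \<Longrightarrow> 0 < strip_weight u"
  using Re_exp_strip[of u] exp_plus_one_nz[of u] by (simp add: strip_weight_eq)

lemma disk_of_strip_in_ball: "u \<in> strip \<Longrightarrow> disk_of_strip u \<in> ball 0 1"
  using strip_weight_pos[of u] by (simp add: strip_weight_def abs_square_less_1)

lemma cmod_exp_plus_one_sq: "(cmod (exp u + 1))\<^sup>2 = exp (2 * Re u) + 2 * exp (Re u) * cos (Im u) + 1"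
proof -
  have "(cmod (exp u + 1))\<^sup>2 = (exp (Re u) * cos (Im u) + 1)\<^sup>2 + (exp (Re u) * sin (Im u))\<^sup>2"
    unfolding cmod_power2 by (simp add: Re_exp Im_exp)
  also have "\<dots> = (exp (Re u))\<^sup>2 * ((cos (Im u))\<^sup>2 + (sin (Im u))\<^sup>2) + 2 * exp (Re u) * cos (Im u) + 1"
    by algebra
  finally show ?thesis by (simp add: exp_double)
qed

text \<open>With \<open>E = exp (Re u)\<close>, dropping the positive cosine term of the denominator
  leaves at most \<open>4 * E / (E^2 + 1)\<close>; one of the two remaining summands suffices,
  depending on the sign of \<open>Re u\<close>.\<close>

lemma strip_weight_le:
  assumes "u \<in> strip"
  shows "strip_weight u \<le> 4 * exp (- \<bar>Re u\<bar>)"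
proof -
  define E where "E = exp (Re u)"
  have E: "E > 0" by (simp add: E_def)
  have c: "0 < cos (Im u)" "cos (Im u) \<le> 1"
    using cos_Im_strip[OF assms] by auto
  have d: "exp (2 * Re u) = E\<^sup>2" by (simp add: E_def exp_double)
  have "strip_weight u = 4 * (E * cos (Im u)) / (E\<^sup>2 + 2 * E * cos (Im u) + 1)"
    unfolding strip_weight_eq[OF assms] cmod_exp_plus_one_sq d by (simp add: E_def Re_exp)
  also have "\<dots> \<le> 4 * (E * 1) / (E\<^sup>2 + 1)"
    using E c by (intro frac_le mult_left_mono) (auto simp: add_pos_pos)
  also have "\<dots> \<le> 4 * exp (- \<bar>Re u\<bar>)"
  proof (cases "Re u \<ge> 0")
    case True
    then have "4 * exp (- \<bar>Re u\<bar>) = 4 / E" by (simp add: E_def exp_minus divide_simps)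
    then show ?thesis using E by (simp add: field_simps power2_eq_square add_pos_pos)
  next
    case False
    then have "4 * exp (- \<bar>Re u\<bar>) = 4 * E" by (simp add: E_def)
    then show ?thesis using E by (simp add: field_simps add_pos_pos)
  qed
  finally show ?thesis .
qed

lemma strip_weight_powr_le:
  assumes \<alpha>: "0 \<le> \<alpha>" and u: "u \<in> strip"
  shows "strip_weight u powr \<alpha> \<le> 4 powr \<alpha> * exp (- \<alpha> * \<bar>Re u\<bar>)"
proof -
  have "strip_weight u powr \<alpha> \<le> (4 * exp (- \<bar>Re u\<bar>)) powr \<alpha>"
    using strip_weight_le[OF u] strip_weight_pos[OF u] \<alpha> by (intro powr_mono2) auto
  also have "\<dots> = 4 powr \<alpha> * exp (- \<alpha> * \<bar>Re u\<bar>)"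
    by (simp add: powr_mult exp_powr_real mult.commute)
  finally show ?thesis .
qed

text \<open>The factor \<open>cos (Im u)\<close> degenerates at the boundary lines, so this bound is
  effective on narrower strips, where the dilation by \<open>\<theta>\<close> takes all
  points.\<close>

lemma strip_weight_ge:
  assumes "u \<in> strip"
  shows "cos (Im u) * exp (- \<bar>Re u\<bar>) \<le> strip_weight u"
proof -
  define E where "E = exp (Re u)"
  have E: "E > 0" by (simp add: E_def)
  have c: "0 < cos (Im u)" "cos (Im u) \<le> 1"
    using cos_Im_strip[OF assms] by auto
  have d: "exp (2 * Re u) = E\<^sup>2" by (simp add: E_def exp_double)
  have "(E + 1)\<^sup>2 = E\<^sup>2 + 2 * E * 1 + 1" by (simp add: power2_eq_square algebra_simps)
  then have "exp (- \<bar>Re u\<bar>) \<le> 4 * E / (E\<^sup>2 + 2 * E * 1 + 1)"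
    using exp_minus_abs_le[of "Re u"] by (simp add: E_def)
  also have "\<dots> \<le> 4 * E / (E\<^sup>2 + 2 * E * cos (Im u) + 1)"
    using E c by (intro frac_le) (auto simp: add_pos_pos)
  finally have "cos (Im u) * exp (- \<bar>Re u\<bar>) \<le> cos (Im u) * (4 * E / (E\<^sup>2 + 2 * E * cos (Im u) + 1))"
    using c by (intro mult_left_mono) auto
  also have "\<dots> = strip_weight u"
    unfolding strip_weight_eq[OF assms] cmod_exp_plus_one_sq d by (simp add: E_def Re_exp)
  finally show ?thesis .
qed

section \<open>The inverse map and the lens map as a dilation\<close>

lemma Re_one_plus_disk: "z \<in> ball 0 1 \<Longrightarrow> 0 < Re (1 + z)" "z \<in> ball 0 1 \<Longrightarrow> 0 < Re (1 - z)"
  using abs_Re_le_cmod[of z] by (auto simp: abs_le_iff)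

lemma exp_strip_of_disk:
  assumes "z \<in> ball 0 1"
  shows "exp (strip_of_disk z) = (1 + z) / (1 - z)"
proof -
  have "1 + z \<noteq> 0" "1 - z \<noteq> 0" using Re_one_plus_disk[OF assms] by (metis zero_complex.sel(1) less_irrefl)+
  then show ?thesis by (simp add: strip_of_disk_def exp_diff)
qed

lemma disk_of_strip_of_disk [simp]:
  assumes "z \<in> ball 0 1"
  shows "disk_of_strip (strip_of_disk z) = z"
proof -
  have "1 - z \<noteq> 0" using Re_one_plus_disk[OF assms] by (metis zero_complex.sel(1) less_irrefl)
  then have "(1 + z) / (1 - z) - 1 = 2 * z / (1 - z)" "(1 + z) / (1 - z) + 1 = 2 / (1 - z)"
    by (simp_all add: divide_diff_eq_iff divide_add_eq_iff)
  then show ?thesis using \<open>1 - z \<noteq> 0\<close>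
    unfolding disk_of_strip_def exp_strip_of_disk[OF assms] by simp
qed

text \<open>Each logarithm has imaginary part below \<open>pi / 2\<close> in modulus, which bounds
  the difference only by \<open>pi\<close>. Since \<open>(1 + z) / (1 - z)\<close> has positive real
  part, the cosine of the imaginary part is positive, and this excludes the outer range.\<close>

lemma strip_of_disk_in_strip:
  assumes z: "z \<in> ball 0 1"
  shows "strip_of_disk z \<in> strip"
proof -
  have nz: "1 - z \<noteq> 0" using Re_one_plus_disk[OF z] by (metis zero_complex.sel(1) less_irrefl)
  have b: "\<bar>Im (Ln w)\<bar> < pi / 2" if "0 < Re w" for w
    using that by (subst Re_Ln_pos_lt) auto
  have im: "\<bar>Im (strip_of_disk z)\<bar> < pi"
    using b[OF Re_one_plus_disk(1)[OF z]] b[OF Re_one_plus_disk(2)[OF z]]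
    unfolding strip_of_disk_def minus_complex.sel by linarith
  have "Re ((1 + z) / (1 - z)) = (1 - (cmod z)\<^sup>2) / (cmod (1 - z))\<^sup>2"
    unfolding cmod_power2 by (simp add: Re_divide power2_eq_square algebra_simps)
  moreover have "(cmod z)\<^sup>2 < 1" using z by (simp add: abs_square_less_1)
  ultimately have "0 < Re (exp (strip_of_disk z))"
    using nz by (simp add: exp_strip_of_disk[OF z])
  then have c: "0 < cos (Im (strip_of_disk z))" by (simp add: Re_exp zero_less_mult_iff)
  have "\<bar>Im (strip_of_disk z)\<bar> < pi / 2"
  proof (rule ccontr)
    assume "\<not> ?thesis"
    then have "cos \<bar>Im (strip_of_disk z)\<bar> \<le> cos (pi / 2)"
      using im by (intro cos_monotone_0_pi_le) auto
    then show False using c by simp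
  qed
  then show ?thesis by (simp add: strip_def)
qed

lemma strip_of_disk_of_strip [simp]:
  assumes "u \<in> strip"
  shows "strip_of_disk (disk_of_strip u) = u"
proof -
  have nz: "exp u + 1 \<noteq> 0" by (rule exp_plus_one_nz[OF assms])
  have b: "disk_of_strip u \<in> ball 0 1" by (rule disk_of_strip_in_ball[OF assms])
  have "1 + disk_of_strip u = 2 * exp u / (exp u + 1)" "1 - disk_of_strip u = 2 / (exp u + 1)"
    using nz by (simp_all add: disk_of_strip_def field_simps)
  then have "exp (strip_of_disk (disk_of_strip u)) = exp u"
    using nz by (simp add: exp_strip_of_disk[OF b])
  moreover have "\<bar>Im (strip_of_disk (disk_of_strip u)) - Im u\<bar> < 2 * pi"
    using strip_of_disk_in_strip[OF b] assms unfolding strip_def mem_Collect_eq by linarith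
  ultimately show ?thesis by (rule exp_complex_eqI[rotated])
qed

lemma disk_of_strip_image: "disk_of_strip ` strip = ball 0 1"
proof
  show "ball 0 1 \<subseteq> disk_of_strip ` strip"
    using strip_of_disk_in_strip disk_of_strip_of_disk by (metis image_eqI subsetI)
qed (use disk_of_strip_in_ball in blast)

lemma inj_disk_of_strip: "inj_on disk_of_strip strip"
  by (metis inj_on_inverseI strip_of_disk_of_strip)

lemma disk_of_strip_0 [simp]: "disk_of_strip 0 = 0"
  by (simp add: disk_of_strip_def)

lemma holomorphic_disk_of_strip: "disk_of_strip holomorphic_on strip"
  unfolding disk_of_strip_def[abs_def]
  by (intro holomorphic_intros) (auto dest: exp_plus_one_nz)

lemma has_derivative_disk_of_strip:
  assumes "u \<in> strip"
  shows "(disk_of_strip has_field_derivative 2 * exp u / (exp u + 1)\<^sup>2) (at u)"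
  unfolding disk_of_strip_def[abs_def]
  using exp_plus_one_nz[OF assms]
  by (auto intro!: derivative_eq_intros simp: power2_eq_square field_simps)

lemma holomorphic_strip_of_disk: "strip_of_disk holomorphic_on ball 0 1"
proof -
  have "1 + z \<notin> \<real>\<^sub>\<le>\<^sub>0" "1 - z \<notin> \<real>\<^sub>\<le>\<^sub>0" if "z \<in> ball 0 1" for z :: complex
    using Re_one_plus_disk[OF that] by (auto simp: complex_nonpos_Reals_iff)
  then show ?thesis unfolding strip_of_disk_def[abs_def] by (intro holomorphic_intros) auto
qed

lemma strip_scale:
  assumes "0 < \<theta>" "\<theta> \<le> 1" "u \<in> strip"
  shows "of_real \<theta> * u \<in> strip"
proof -
  have "\<theta> * \<bar>Im u\<bar> \<le> 1 * \<bar>Im u\<bar>" using assms by (intro mult_right_mono) auto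
  then show ?thesis using assms by (simp add: strip_def abs_mult)
qed

text \<open>The principal powers are \<open>a = exp (\<theta> * Ln (1 + z))\<close> and
  \<open>b = exp (\<theta> * Ln (1 - z))\<close>. The exponential of the dilated point is
  \<open>a / b\<close>, and clearing \<open>b\<close> in \<open>disk_of_strip\<close> leaves the
  defining quotient of the lens map.\<close>

lemma lens_map_strip:
  assumes z: "z \<in> ball 0 1" and \<theta>: "0 < \<theta>" "\<theta> < 1"
  shows "lens_map \<theta> z = disk_of_strip (of_real \<theta> * strip_of_disk z)"
proof -
  have nz: "1 + z \<noteq> 0" "1 - z \<noteq> 0" using Re_one_plus_disk[OF z] by (metis zero_complex.sel(1) less_irrefl)+
  define a where "a = exp (of_real \<theta> * Ln (1 + z))"
  define b where "b = exp (of_real \<theta> * Ln (1 - z))"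
  have b0: "b \<noteq> 0" by (simp add: b_def)
  have e: "exp (of_real \<theta> * strip_of_disk z) = a / b"
    by (simp add: a_def b_def strip_of_disk_def exp_diff right_diff_distrib)
  have "of_real \<theta> * strip_of_disk z \<in> strip"
    using strip_scale strip_of_disk_in_strip[OF z] \<theta> by simp
  from exp_plus_one_nz[OF this] have "a + b \<noteq> 0" unfolding e using b0 by (auto simp: field_simps)
  then show ?thesis
    unfolding disk_of_strip_def e using nz b0
    by (simp add: lens_map_def powr_def a_def[symmetric] b_def[symmetric] divide_simps)
qed

lemma lens_map_disk_of_strip:
  assumes "u \<in> strip" "0 < \<theta>" "\<theta> < 1"
  shows "lens_map \<theta> (disk_of_strip u) = disk_of_strip (of_real \<theta> * u)"
  using assms lens_map_strip[OF disk_of_strip_in_ball] by simp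

lemma lens_map_in_ball:
  assumes "z \<in> ball 0 1" "0 < \<theta>" "\<theta> < 1"
  shows "lens_map \<theta> z \<in> ball 0 1"
  unfolding lens_map_strip[OF assms]
  using assms by (intro disk_of_strip_in_ball strip_scale strip_of_disk_in_strip) auto

lemma lens_map_0 [simp]: "lens_map \<theta> 0 = 0"
  by (simp add: lens_map_def)

lemma holomorphic_lens_map:
  assumes "0 < \<theta>" "\<theta> < 1"
  shows "lens_map \<theta> holomorphic_on ball 0 1"
proof -
  have "(disk_of_strip \<circ> (\<lambda>z. of_real \<theta> * strip_of_disk z)) holomorphic_on ball 0 1"
    using assms by (intro holomorphic_on_compose_gen[OF _ holomorphic_disk_of_strip] holomorphic_intros
        holomorphic_strip_of_disk) (auto intro!: strip_scale strip_of_disk_in_strip)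
  then show ?thesis
    by (rule holomorphic_transform) (simp add: lens_map_strip assms)
qed

lemma continuous_on_strip_weight: "continuous_on strip strip_weight"
  unfolding strip_weight_def[abs_def]
  by (intro continuous_intros holomorphic_on_imp_continuous_on holomorphic_disk_of_strip)

text \<open>The Jacobian of the map from the strip onto the disk is comparable with \<open>exp (-2 |Re u|)\<close>,
  so finiteness of the area of the disk gives the case \<open>a = 2\<close>; scaling the strip gives the rest.\<close>

lemma exp_abs_Re_integrable:
  assumes "0 < a"
  shows "set_integrable lborel strip (\<lambda>u. exp (- a * \<bar>Re u\<bar>))"
proof -
  \<comment> \<open>\<open>2 * s \<le> a\<close> makes \<open>exp (- 2 * |Re (s * u)|)\<close> a
    majorant of the integrand, and \<open>s \<le> 1\<close> keeps \<open>s * u\<close> in the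
    strip.\<close>
  define s where "s = min 1 (a / 2)"
  have s: "0 < s" "s \<le> 1" "2 * s \<le> a" using assms by (auto simp: s_def)
  have "(\<integral>\<^sup>+u\<in>strip. ennreal (1 * (cmod (deriv disk_of_strip u))\<^sup>2) \<partial>lborel) = (\<integral>\<^sup>+z\<in>disk_of_strip ` strip. ennreal 1 \<partial>lborel)"
    by (rule conformal_change_of_variables[OF open_strip holomorphic_disk_of_strip inj_disk_of_strip]) auto
  also have "\<dots> < \<infinity>"
    unfolding disk_of_strip_image by (simp add: emeasure_bounded_finite[unfolded infinity_ennreal_def])
  finally have fin: "(\<integral>\<^sup>+u\<in>strip. ennreal ((cmod (deriv disk_of_strip u))\<^sup>2) \<partial>lborel) < \<infinity>" by simp
  have jac: "exp (- 2 * \<bar>Re u\<bar>) \<le> 4 * (cmod (deriv disk_of_strip u))\<^sup>2" if "u \<in> strip" for u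
  proof -
    define E where "E = exp (Re u)"
    have E: "E > 0" by (simp add: E_def)
    have "exp (- \<bar>Re u\<bar>) \<le> 4 * E / (E + 1)\<^sup>2"
      using exp_minus_abs_le[of "Re u"] by (simp add: E_def)
    also have "4 * E / (E + 1)\<^sup>2 \<le> 4 * E / (cmod (exp u + 1))\<^sup>2"
      using E exp_plus_one_nz[OF that] norm_triangle_ineq[of "exp u" 1]
      by (intro divide_left_mono power_mono mult_pos_pos zero_less_power) (auto simp: E_def add_pos_pos)
    also have "\<dots> = 2 * cmod (deriv disk_of_strip u)"
      using DERIV_imp_deriv[OF has_derivative_disk_of_strip[OF that]]
      by (simp add: E_def norm_divide norm_mult norm_power)
    finally have "(exp (- \<bar>Re u\<bar>))\<^sup>2 \<le> (2 * cmod (deriv disk_of_strip u))\<^sup>2"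
      by (intro power_mono) auto
    then show ?thesis by (simp add: exp_double[symmetric] power_mult_distrib)
  qed
  have "(\<integral>\<^sup>+u\<in>strip. ennreal (exp (- 2 * \<bar>Re u\<bar>)) \<partial>lborel) \<le> (\<integral>\<^sup>+u\<in>strip. 4 * ennreal ((cmod (deriv disk_of_strip u))\<^sup>2) \<partial>lborel)"
    by (intro nn_integral_mono) (use jac in \<open>auto simp: indicator_def ennreal_mult'[symmetric] simp flip: ennreal_numeral\<close>)
  also have "\<dots> = 4 * (\<integral>\<^sup>+u\<in>strip. ennreal ((cmod (deriv disk_of_strip u))\<^sup>2) \<partial>lborel)"
  proof -
    have "(\<lambda>u. indicator strip u * (cmod (deriv disk_of_strip u))\<^sup>2) \<in> borel_measurable borel"
      by (intro indicator_continuous_measurable open_strip continuous_intros holomorphic_on_imp_continuous_on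
          holomorphic_deriv holomorphic_disk_of_strip)
    then have "(\<lambda>u. ennreal (indicator strip u * (cmod (deriv disk_of_strip u))\<^sup>2)) \<in> borel_measurable borel"
      by measurable
    also have "(\<lambda>u. ennreal (indicator strip u * (cmod (deriv disk_of_strip u))\<^sup>2)) =
        (\<lambda>u. ennreal ((cmod (deriv disk_of_strip u))\<^sup>2) * indicator strip u)"
      by (auto simp: indicator_def)
    finally show ?thesis by (simp add: nn_integral_cmult mult.assoc)
  qed
  also have "\<dots> < \<infinity>" using fin by (simp add: ennreal_mult_less_top)
  finally have fin2: "(\<integral>\<^sup>+u\<in>strip. ennreal (exp (- 2 * \<bar>Re u\<bar>)) \<partial>lborel) < \<infinity>" .
  have "(\<integral>\<^sup>+u\<in>strip. ennreal (exp (- a * \<bar>Re u\<bar>)) \<partial>lborel)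
      \<le> (\<integral>\<^sup>+u\<in>strip. ennreal (exp (- 2 * \<bar>Re (of_real s * u)\<bar>)) \<partial>lborel)"
    using s mult_right_mono[OF s(3)]
    by (intro nn_integral_mono mult_right_mono ennreal_leI) (auto simp: abs_mult mult.assoc)
  also have "\<dots> = (\<integral>\<^sup>+u\<in>strip. ennreal ((exp (- 2 * \<bar>Re (of_real s * u)\<bar>) / s\<^sup>2) * (cmod (deriv ((*) (of_real s)) u))\<^sup>2) \<partial>lborel)"
    using s by (intro nn_integral_cong) simp
  also have "\<dots> = (\<integral>\<^sup>+u\<in>(*) (of_real s) ` strip. ennreal (exp (- 2 * \<bar>Re u\<bar>) / s\<^sup>2) \<partial>lborel)"
    by (rule conformal_change_of_variables[OF open_strip])
       (use s in \<open>auto intro!: holomorphic_intros inj_onI continuous_intros\<close>)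
  also have "\<dots> \<le> (\<integral>\<^sup>+u\<in>strip. ennreal (1 / s\<^sup>2) * ennreal (exp (- 2 * \<bar>Re u\<bar>)) \<partial>lborel)"
    using strip_scale[OF s(1,2)] s by (intro nn_integral_mono) (auto simp: indicator_def ennreal_mult'[symmetric])
  also have "\<dots> = ennreal (1 / s\<^sup>2) * (\<integral>\<^sup>+u\<in>strip. ennreal (exp (- 2 * \<bar>Re u\<bar>)) \<partial>lborel)"
    using open_strip by (simp add: nn_integral_cmult mult.assoc)
  also have "\<dots> < \<infinity>" using fin2 by (simp add: ennreal_mult_less_top)
  finally have fin3: "(\<integral>\<^sup>+u\<in>strip. ennreal (exp (- a * \<bar>Re u\<bar>)) \<partial>lborel) < \<infinity>" .
  show ?thesis unfolding set_integrable_def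
  proof (rule integrableI_bounded)
    show "(\<lambda>u. indicat_real strip u *\<^sub>R exp (- a * \<bar>Re u\<bar>)) \<in> borel_measurable lborel"
      using open_strip by simp
    have "(\<integral>\<^sup>+u. ennreal (norm (indicat_real strip u *\<^sub>R exp (- a * \<bar>Re u\<bar>))) \<partial>lborel)
       = (\<integral>\<^sup>+u\<in>strip. ennreal (exp (- a * \<bar>Re u\<bar>)) \<partial>lborel)"
      by (intro nn_integral_cong) (auto simp: indicator_def)
    then show "(\<integral>\<^sup>+u. ennreal (norm (indicat_real strip u *\<^sub>R exp (- a * \<bar>Re u\<bar>))) \<partial>lborel) < \<infinity>"
      using fin3 by simp
  qed
qed

section \<open>Approximation numbers in quadratic normed spaces\<close>

lemma sum_fun_apply: "(\<Sum>v\<in>A. (f v :: 'a \<Rightarrow> 'b::comm_monoid_add)) z = (\<Sum>v\<in>A. f v z)"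
  by (induction A rule: infinite_finite_induct) auto

text \<open>The value at the vertex \<open>c = - p / B\<close> is nonnegative. This is the source of
  every Cauchy-Schwarz type estimate below.\<close>

lemma quadratic_nonneg_imp:
  fixes A B p :: real
  assumes nn: "\<And>c. 0 \<le> A + 2 * c * p + c\<^sup>2 * B" and B: "0 < B"
  shows "p\<^sup>2 \<le> A * B"
proof -
  define c where "c = - p / B"
  have p: "p = - c * B" using B by (simp add: c_def)
  have "0 \<le> A - c\<^sup>2 * B" using nn[of c] by (simp add: p power2_eq_square mult_ac)
  then have "(c\<^sup>2 * B) * B \<le> A * B" using B by (intro mult_right_mono) auto
  moreover have "p\<^sup>2 = (c\<^sup>2 * B) * B" by (simp add: p power2_eq_square)
  ultimately show ?thesis by simp
qed

text \<open>The inner product is present only through the polynomial in the last axiom, whose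
  coefficient \<open>p\<close> is the real part of the inner product of \<open>f\<close> and
  \<open>g\<close>. This encodes the geometry of angles without a sesquilinear form; as completeness
  is not part of the structure, projections have to be almost orthogonal instead of
  orthogonal.\<close>

locale quadratic_normed_space =
  fixes H :: "cfun set" and N :: "cfun \<Rightarrow> real"
  assumes zero_mem: "(\<lambda>z. 0) \<in> H"
    and lin_mem: "\<And>f g a b. f \<in> H \<Longrightarrow> g \<in> H \<Longrightarrow> (\<lambda>z. a * f z + b * g z) \<in> H"
    and N_nonneg: "\<And>f. f \<in> H \<Longrightarrow> 0 \<le> N f"
    and N_scale: "\<And>f a. f \<in> H \<Longrightarrow> N (\<lambda>z. a * f z) = cmod a * N f"
    and N_quadratic: "\<And>f g. f \<in> H \<Longrightarrow> g \<in> H \<Longrightarrow>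
      \<exists>p. \<forall>c::real. (N (\<lambda>z. f z + of_real c * g z))\<^sup>2 = (N f)\<^sup>2 + 2 * c * p + c\<^sup>2 * (N g)\<^sup>2"
begin

lemma add_mem: "f \<in> H \<Longrightarrow> g \<in> H \<Longrightarrow> (\<lambda>z. f z + g z) \<in> H"
  using lin_mem[of f g 1 1] by simp

lemma diff_mem: "f \<in> H \<Longrightarrow> g \<in> H \<Longrightarrow> (\<lambda>z. f z - g z) \<in> H"
  using lin_mem[of f g 1 "-1"] by simp

lemma scale_mem: "f \<in> H \<Longrightarrow> (\<lambda>z. a * f z) \<in> H"
  using lin_mem[of f f a 0] by simp

lemma sum_mem: "(\<And>k. k \<in> A \<Longrightarrow> f k \<in> H) \<Longrightarrow> (\<lambda>z. \<Sum>k\<in>A. a k * f k z) \<in> H"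
proof (induction A rule: infinite_finite_induct)
  case (insert x A)
  then show ?case using add_mem[OF scale_mem[of "f x" "a x"]] by simp
qed (simp_all add: zero_mem)

lemma N_zero: "N (\<lambda>z. 0) = 0"
  using N_scale[OF zero_mem, of 0] by simp

lemma N_triangle:
  assumes f: "f \<in> H" and g: "g \<in> H"
  shows "N (\<lambda>z. f z + g z) \<le> N f + N g"
proof -
  obtain p where p: "\<And>c::real. (N (\<lambda>z. f z + of_real c * g z))\<^sup>2 = (N f)\<^sup>2 + 2 * c * p + c\<^sup>2 * (N g)\<^sup>2"
    using N_quadratic[OF f g] by auto
  have nn: "0 \<le> (N f)\<^sup>2 + 2 * c * p + c\<^sup>2 * (N g)\<^sup>2" for c
    unfolding p[symmetric] by simp
  have "p \<le> N f * N g"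
  proof (cases "N g = 0")
    case True
    have "p \<le> 0"
    proof (rule ccontr)
      \<comment> \<open>With \<open>N g = 0\<close> the polynomial is affine in \<open>c\<close>,
        and at the point inserted below it takes the value \<open>-1\<close>.\<close>
      assume "\<not> p \<le> 0"
      then have "0 \<le> (N f)\<^sup>2 - ((N f)\<^sup>2 + 1)"
        using nn[of "- ((N f)\<^sup>2 + 1) / (2 * p)"] True by (simp add: field_simps)
      then show False by simp
    qed
    then show ?thesis using True by simp
  next
    case False
    then have B: "0 < N g" using N_nonneg[OF g] by simp
    have "p\<^sup>2 \<le> (N f * N g)\<^sup>2"
      using quadratic_nonneg_imp[OF nn] B by (simp add: power_mult_distrib)
    then show ?thesis by (rule power2_le_imp_le) (intro mult_nonneg_nonneg N_nonneg f g)
  qed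
  then have "(N (\<lambda>z. f z + g z))\<^sup>2 \<le> (N f + N g)\<^sup>2"
    using p[of 1] by (simp add: power2_sum)
  then show ?thesis by (rule power2_le_imp_le) (intro add_nonneg_nonneg N_nonneg f g)
qed

lemma N_minus: "f \<in> H \<Longrightarrow> N (\<lambda>z. - f z) = N f"
  using N_scale[of f "-1"] by simp

lemma N_diff_triangle: "f \<in> H \<Longrightarrow> g \<in> H \<Longrightarrow> N (\<lambda>z. f z - g z) \<le> N f + N g"
  using N_triangle[of f "\<lambda>z. - g z"] N_minus scale_mem[of g "-1"] by simp

text \<open>In an inner product space, if \<open>u\<close> is nearly orthogonal to \<open>v\<close> as seen from \<open>u\<close>, then the same
  holds as seen from \<open>v\<close>: both say that the angle is bounded below.\<close>

lemma near_orthogonal_sym: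
  assumes u: "u \<in> H" and v: "v \<in> H" and \<kappa>: "0 < \<kappa>" "\<kappa> \<le> 1"
    and near: "\<And>c::real. \<kappa> * N u \<le> N (\<lambda>z. u z + of_real c * v z)"
  shows "\<kappa> * N v \<le> N (\<lambda>z. u z + v z)"
proof -
  obtain p where p: "\<And>c::real. (N (\<lambda>z. u z + of_real c * v z))\<^sup>2 = (N u)\<^sup>2 + 2 * c * p + c\<^sup>2 * (N v)\<^sup>2"
    using N_quadratic[OF u v] by auto
  define A B where "A = (N u)\<^sup>2" and "B = (N v)\<^sup>2"
  have AB: "0 \<le> A" "0 \<le> B" by (auto simp: A_def B_def)
  have q: "\<kappa>\<^sup>2 * A \<le> A + 2 * c * p + c\<^sup>2 * B" for c
  proof -
    have "(\<kappa> * N u)\<^sup>2 \<le> (N (\<lambda>z. u z + of_real c * v z))\<^sup>2"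
      using near[of c] N_nonneg[OF u] \<kappa> by (intro power_mono) auto
    then show ?thesis unfolding p A_def B_def power_mult_distrib .
  qed
  have "\<kappa>\<^sup>2 * B \<le> A + 2 * p + B"
  proof (cases "B = 0")
    case True
    then have "0 \<le> A + 2 * p + B"
      using p[of 1] zero_le_power2[of "N (\<lambda>z. u z + v z)"] unfolding A_def B_def by simp
    then show ?thesis using True by simp
  next
    case False
    then have B: "0 < B" using AB by simp
    have "0 \<le> (1 - \<kappa>\<^sup>2) * A + 2 * c * p + c\<^sup>2 * B" for c
      using q[of c] by (simp add: algebra_simps)
    from quadratic_nonneg_imp[OF this B] have p2: "p\<^sup>2 \<le> (1 - \<kappa>\<^sup>2) * A * B" .
    show ?thesis
    proof (cases "A = 0")
      case True
      then have "p = 0" using p2 by simp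
      moreover have "\<kappa>\<^sup>2 \<le> 1" using \<kappa> by (simp add: power_le_one)
      ultimately show ?thesis using True B by simp
    next
      case False
      then have A: "0 < A" using AB by simp
      \<comment> \<open>Multiplied by \<open>A\<close>, the claim is a complete square plus the
        discriminant inequality \<open>p2\<close>.\<close>
      have "A * (A + 2 * p + B - \<kappa>\<^sup>2 * B) = (A + p)\<^sup>2 + ((1 - \<kappa>\<^sup>2) * A * B - p\<^sup>2)"
        by algebra
      then have "0 \<le> A * (A + 2 * p + B - \<kappa>\<^sup>2 * B)" using p2 by simp
      then show ?thesis using A by (simp add: zero_le_mult_iff)
    qed
  qed
  then have "(\<kappa> * N v)\<^sup>2 \<le> (N (\<lambda>z. u z + v z))\<^sup>2"
    using p[of 1] by (simp add: power_mult_distrib A_def B_def)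
  then show ?thesis using N_nonneg[OF add_mem[OF u v]] by (rule power2_le_imp_le)
qed

section \<open>Almost orthogonal projections onto common kernels\<close>

definition functional :: "(cfun \<Rightarrow> complex) \<Rightarrow> bool" where
  "functional l \<longleftrightarrow> (\<forall>f\<in>H. \<forall>g\<in>H. \<forall>a b. l (\<lambda>z. a * f z + b * g z) = a * l f + b * l g) \<and>
     (\<exists>K. \<forall>f\<in>H. cmod (l f) \<le> K * N f)"

lemma functional_lin: "functional l \<Longrightarrow> f \<in> H \<Longrightarrow> g \<in> H \<Longrightarrow> l (\<lambda>z. a * f z + b * g z) = a * l f + b * l g"
  unfolding functional_def by blast

lemma functional_bound:
  assumes "functional l"
  obtains K where "0 < K" "\<And>f. f \<in> H \<Longrightarrow> cmod (l f) \<le> K * N f"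
proof -
  obtain K where K: "\<And>f. f \<in> H \<Longrightarrow> cmod (l f) \<le> K * N f" using assms unfolding functional_def by blast
  show thesis
  proof (rule that[of "max K 1"])
    fix f assume f: "f \<in> H"
    have "K * N f \<le> max K 1 * N f" using N_nonneg[OF f] by (intro mult_right_mono) auto
    then show "cmod (l f) \<le> max K 1 * N f" using K[OF f] by linarith
  qed simp
qed

text \<open>A vector \<open>u\<close> almost maximising \<open>l\<close> is almost orthogonal
  to the kernel of \<open>l\<close>, so no completeness is needed.\<close>

lemma kernel_projection_step:
  assumes l: "functional l" and EH: "E \<subseteq> H" and E0: "(\<lambda>z. 0) \<in> E"
    and Elin: "\<And>f g a b. f \<in> E \<Longrightarrow> g \<in> E \<Longrightarrow> (\<lambda>z. a * f z + b * g z) \<in> E"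
    and nz: "\<exists>f\<in>E. l f \<noteq> 0" and K: "1 < K"
  shows "\<exists>u\<in>E. l u \<noteq> 0 \<and> (\<forall>f\<in>E. N (\<lambda>z. f z - l f / l u * u z) \<le> K * N f)"
proof -
  obtain C where C: "0 < C" "\<And>f. f \<in> H \<Longrightarrow> cmod (l f) \<le> C * N f" using functional_bound[OF l] by blast
  define X where "X = (\<lambda>f. cmod (l f)) ` {f\<in>E. N f \<le> 1}"
  define s where "s = Sup X"
  have bdd: "bdd_above X"
  proof (rule bdd_aboveI)
    fix x assume "x \<in> X"
    then obtain f where "f \<in> E" "N f \<le> 1" "x = cmod (l f)" by (auto simp: X_def)
    moreover from this have "C * N f \<le> C * 1" using C(1) by (intro mult_left_mono) auto
    ultimately show "x \<le> C" using C(2)[of f] EH by auto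
  qed
  have Escale: "(\<lambda>z. a * f z) \<in> E" if "f \<in> E" for f a using Elin[OF that that, of a 0] by simp
  have lscale: "l (\<lambda>z. a * f z) = a * l f" if "f \<in> H" for f a
    using functional_lin[OF l that that, of a 0] by simp
  have normalise: "cmod (l f) / N f \<in> X" if "f \<in> E" "N f \<noteq> 0" for f
  proof -
    have p: "0 < N f" using that N_nonneg EH by (metis less_eq_real_def subsetD)
    have fH: "f \<in> H" using that EH by auto
    have "cmod (l (\<lambda>z. of_real (1 / N f) * f z)) = cmod (l f) / N f"
      using p unfolding lscale[OF fH] by (simp add: norm_mult norm_divide)
    moreover have "N (\<lambda>z. of_real (1 / N f) * f z) \<le> 1"
      using p unfolding N_scale[OF fH] by (simp add: norm_divide)
    moreover have "(\<lambda>z. of_real (1 / N f) * f z) \<in> E" by (rule Escale[OF that(1)])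
    ultimately show ?thesis unfolding X_def
      by (intro image_eqI[where x = "\<lambda>z. of_real (1 / N f) * f z"] CollectI conjI) simp_all
  qed
  have le_s: "cmod (l f) \<le> s * N f" if "f \<in> E" for f
  proof (cases "N f = 0")
    case True
    then show ?thesis using C(2)[of f] that EH by auto
  next
    case False
    then have "0 < N f" using that N_nonneg EH by (metis less_eq_real_def subsetD)
    moreover have "cmod (l f) / N f \<le> s"
      unfolding s_def by (rule cSup_upper[OF normalise[OF that False] bdd])
    ultimately show ?thesis by (simp add: field_simps)
  qed
  have s0: "0 < s"
  proof -
    obtain f where f: "f \<in> E" "l f \<noteq> 0" using nz by blast
    then have "0 < s * N f" using le_s[OF f(1)] by (smt (verit) zero_less_norm_iff)
    then show ?thesis using N_nonneg[of f] f EH by (metis less_le_not_le subsetD zero_less_mult_iff order.strict_implies_order)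
  qed
  \<comment> \<open>The supremum need not be attained, so \<open>u\<close> realises it only up to
    the factor \<open>K\<close>. This slack is the loss in the norm of the projection.\<close>
  have "s / K < Sup X" using s0 K by (simp add: s_def[symmetric] divide_less_eq)
  then obtain x where "x \<in> X" "s / K < x"
    using less_cSup_iff[OF _ bdd] E0 N_zero by (force simp: X_def)
  then obtain u where u: "u \<in> E" "N u \<le> 1" "s / K < cmod (l u)" by (auto simp: X_def)
  have lu: "l u \<noteq> 0"
  proof
    assume "l u = 0"
    then have "s / K < 0" using u(3) by simp
    moreover have "0 < s / K" using s0 K by simp
    ultimately show False by simp
  qed
  have uH: "u \<in> H" using u EH by auto
  show ?thesis
  proof (intro bexI[of _ u] conjI ballI lu u(1))
    fix f assume f: "f \<in> E"
    then have fH: "f \<in> H" using EH by auto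
    define t where "t = l f / l u"
    define u' where "u' = (\<lambda>z. t * u z)"
    define v where "v = (\<lambda>z. f z - t * u z)"
    have u': "u' \<in> E" "u' \<in> H" unfolding u'_def using Escale u(1) EH by auto
    have v: "v \<in> E" "v \<in> H" using Elin[OF f u(1), of 1 "- t"] EH by (auto simp: v_def)
    have lv: "l v = 0" using functional_lin[OF l fH uH, of 1 "- t"] lu by (simp add: v_def t_def)
    \<comment> \<open>All vectors \<open>u' + c * v\<close> have the same value under
      \<open>l\<close>, because \<open>v\<close> lies in the kernel; by the choice of
      \<open>u\<close> their norms cannot drop below \<open>N u' / K\<close>. The symmetry lemma
      then turns this into a bound for the kernel component \<open>v\<close> of
      \<open>f\<close>.\<close>
    have "1 / K * N v \<le> N (\<lambda>z. u' z + v z)"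
    proof (rule near_orthogonal_sym[OF u'(2) v(2)])
      fix c :: real
      have "l (\<lambda>z. u' z + of_real c * v z) = t * l u"
        using functional_lin[OF l u'(2) v(2), of 1 "of_real c"] lv lscale[OF uH] by (simp add: u'_def)
      moreover have "(\<lambda>z. u' z + of_real c * v z) \<in> E" using Elin[OF u'(1) v(1), of 1] by simp
      ultimately have "cmod t * cmod (l u) \<le> s * N (\<lambda>z. u' z + of_real c * v z)"
        using le_s by (metis norm_mult)
      moreover have "cmod t * (s / K) \<le> cmod t * cmod (l u)" using u(3) by (intro mult_left_mono) auto
      ultimately have "s * (cmod t / K) \<le> s * N (\<lambda>z. u' z + of_real c * v z)" by (simp add: mult_ac)
      then have "cmod t / K \<le> N (\<lambda>z. u' z + of_real c * v z)" using s0 by (rule mult_left_le_imp_le)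
      moreover have "1 / K * N u' \<le> cmod t / K"
        using u(2) K N_scale[OF uH, of t] mult_left_le[of "N u" "cmod t"]
        by (simp add: u'_def divide_right_mono)
      ultimately show "1 / K * N u' \<le> N (\<lambda>z. u' z + of_real c * v z)" by linarith
    qed (use K in auto)
    then show "N (\<lambda>z. f z - l f / l u * u z) \<le> K * N f"
      using K by (simp add: u'_def v_def t_def[symmetric] field_simps)
  qed
qed

text \<open>A substitute for the orthogonal projection onto the common kernel of
  \<open>l 0, ..., l (m - 1)\<close>. Approximation numbers draw on two features: \<open>Q\<close>
  has norm at most \<open>K\<close>, and \<open>f - Q f\<close> ranges in the span of at most
  \<open>m\<close> vectors.\<close>

definition kernel_projection ::
    "(nat \<Rightarrow> cfun \<Rightarrow> complex) \<Rightarrow> nat \<Rightarrow> real \<Rightarrow> (cfun \<Rightarrow> cfun) \<Rightarrow> cfun set \<Rightarrow> bool" where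
  "kernel_projection l m K Q U \<longleftrightarrow> finite U \<and> card U \<le> m \<and> U \<subseteq> H \<and>
    (\<forall>f\<in>H. Q f \<in> H) \<and> (\<forall>f\<in>H. N (Q f) \<le> K * N f) \<and> (\<forall>f\<in>H. \<forall>i<m. l i (Q f) = 0) \<and>
    (\<forall>f\<in>H. (\<lambda>z. f z - Q f z) \<in> cfun_span U) \<and>
    (\<forall>f\<in>H. \<forall>g\<in>H. \<forall>a b. Q (\<lambda>z. a * f z + b * g z) = (\<lambda>z. a * Q f z + b * Q g z))"

lemma kernel_projectionD:
  assumes "kernel_projection l m K Q U"
  shows "finite U" "card U \<le> m" "U \<subseteq> H" "\<And>f. f \<in> H \<Longrightarrow> Q f \<in> H" "\<And>f. f \<in> H \<Longrightarrow> N (Q f) \<le> K * N f"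
    "\<And>f i. f \<in> H \<Longrightarrow> i < m \<Longrightarrow> l i (Q f) = 0" "\<And>f. f \<in> H \<Longrightarrow> (\<lambda>z. f z - Q f z) \<in> cfun_span U"
    "\<And>f g a b. f \<in> H \<Longrightarrow> g \<in> H \<Longrightarrow> Q (\<lambda>z. a * f z + b * g z) = (\<lambda>z. a * Q f z + b * Q g z)"
  using assms unfolding kernel_projection_def by blast+

text \<open>Functionals are treated one at a time, each on the common kernel \<open>E\<close> of the
  earlier ones. The norms of the successive projections multiply, so each induction step splits
  \<open>K\<close> as \<open>sqrt K * sqrt K\<close>; the final bound does not depend on
  \<open>m\<close>.\<close>

lemma finite_codim_projection:
  assumes "\<And>i. i < m \<Longrightarrow> functional (l i)" "1 < K"
  shows "\<exists>Q U. kernel_projection l m K Q U"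
  using assms
proof (induction m arbitrary: K)
  case 0
  have "(\<lambda>z. 0) \<in> cfun_span {}" using cfun.span_zero by (simp add: zero_fun_def)
  then show ?case using 0 N_nonneg unfolding kernel_projection_def
    by (intro exI[of _ "\<lambda>f. f"] exI[of _ "{}"]) (auto intro: order_trans[OF _ mult_right_mono[of 1 K]])
next
  case (Suc m)
  have K: "1 < sqrt K" "sqrt K * sqrt K = K" using Suc.prems(2) by auto
  obtain Q U where QU: "kernel_projection l m (sqrt K) Q U"
    using Suc.IH[OF _ K(1)] Suc.prems(1) by (metis less_Suc_eq)
  note U = kernel_projectionD(1-3)[OF QU] and Q = kernel_projectionD(4-7)[OF QU]
    and Qlin = kernel_projectionD(8)[OF QU]
  define E where "E = {f\<in>H. \<forall>i<m. l i f = 0}"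
  have fl: "functional (l i)" if "i \<le> m" for i using Suc.prems(1) that by simp
  have lm: "l m (\<lambda>z. a * f z + b * g z) = a * l m f + b * l m g" if "f \<in> H" "g \<in> H" for f g a b
    using functional_lin[OF fl[of m] that] by simp
  have E: "E \<subseteq> H" "(\<lambda>z. 0) \<in> E" "\<And>f g a b. f \<in> E \<Longrightarrow> g \<in> E \<Longrightarrow> (\<lambda>z. a * f z + b * g z) \<in> E"
    using functional_lin[OF fl zero_mem zero_mem, of _ 0 0] zero_mem lin_mem functional_lin[OF fl]
    by (auto simp: E_def)
  show ?case
  proof (cases "\<exists>f\<in>E. l m f \<noteq> 0")
    case False
    have "N (Q f) \<le> K * N f" if "f \<in> H" for f
    proof -
      have "sqrt K \<le> K" using K by (metis less_eq_real_def mult_le_cancel_right1 order_less_trans zero_less_one not_less)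
      then have "sqrt K * N f \<le> K * N f" using N_nonneg[OF that] by (rule mult_right_mono)
      then show ?thesis using Q(2)[OF that] by linarith
    qed
    moreover have "l i (Q f) = 0" if "f \<in> H" "i < Suc m" for f i
    proof (cases "i = m")
      case True
      have "Q f \<in> E" using that Q(1,3) by (auto simp: E_def)
      then show ?thesis using False True by blast
    qed (use that Q(3) in auto)
    ultimately show ?thesis using U Q Qlin unfolding kernel_projection_def
      by (intro exI[of _ Q] exI[of _ U]) auto
  next
    case True
    obtain u where u: "u \<in> E" "l m u \<noteq> 0" "\<And>f. f \<in> E \<Longrightarrow> N (\<lambda>z. f z - l m f / l m u * u z) \<le> sqrt K * N f"
      using kernel_projection_step[OF fl[of m] E True K(1)] by blast
    define Q' where "Q' f = (\<lambda>z. Q f z - l m (Q f) / l m u * u z)" for f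
    have uH: "u \<in> H" using u E by auto
    have QE: "Q f \<in> E" if "f \<in> H" for f using Q that by (auto simp: E_def)
    have Q'E: "Q' f \<in> E" if "f \<in> H" for f
      using E(3)[OF QE[OF that] u(1), of 1 "- (l m (Q f) / l m u)"] by (simp add: Q'_def)
    have "N (Q' f) \<le> K * N f" if "f \<in> H" for f
    proof -
      have "N (Q' f) \<le> sqrt K * N (Q f)" unfolding Q'_def by (rule u(3)[OF QE[OF that]])
      also have "\<dots> \<le> sqrt K * (sqrt K * N f)" using K Q(2)[OF that] by (intro mult_left_mono) auto
      finally show ?thesis using K(2) by (simp add: mult.assoc[symmetric])
    qed
    moreover have "l i (Q' f) = 0" if "f \<in> H" "i < Suc m" for f i
    proof (cases "i = m")
      case True
      then show ?thesis using lm[OF Q(1)[OF that(1)] uH, of 1 "- (l m (Q f) / l m u)"] u(2) by (simp add: Q'_def)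
    next
      case False
      then show ?thesis using that Q'E[OF that(1)] by (auto simp: E_def)
    qed
    moreover have "(\<lambda>z. f z - Q' f z) \<in> cfun_span (insert u U)" if "f \<in> H" for f
    proof -
      have "(\<lambda>z. f z - Q f z) \<in> cfun_span (insert u U)"
        using Q(4)[OF that] cfun.span_mono[of U "insert u U"] by blast
      moreover have "(\<lambda>z. l m (Q f) / l m u * u z) \<in> cfun_span (insert u U)"
        by (intro cfun.span_scale cfun.span_base) simp
      ultimately have "(\<lambda>z. f z - Q f z) + (\<lambda>z. l m (Q f) / l m u * u z) \<in> cfun_span (insert u U)"
        by (rule cfun.span_add)
      moreover have "(\<lambda>z. f z - Q' f z) = (\<lambda>z. f z - Q f z) + (\<lambda>z. l m (Q f) / l m u * u z)"
        by (simp add: fun_eq_iff Q'_def)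
      ultimately show ?thesis by (simp only:)
    qed
    moreover have "Q' (\<lambda>z. a * f z + b * g z) = (\<lambda>z. a * Q' f z + b * Q' g z)" if "f \<in> H" "g \<in> H" for f g a b
      unfolding Q'_def Qlin[OF that] lm[OF Q(1)[OF that(1)] Q(1)[OF that(2)]]
      by (simp add: fun_eq_iff algebra_simps add_divide_distrib)
    moreover have "card (insert u U) \<le> Suc m" using U by (simp add: card_insert_if)
    ultimately show ?thesis using U uH Q'E E(1) unfolding kernel_projection_def
      by (intro exI[of _ Q'] exI[of _ "insert u U"]) auto
  qed
qed

section \<open>Operator norms and the two estimates of approximation numbers\<close>

lemma bounded_operator_bound:
  assumes "bounded_operator H N T"
  obtains K where "0 < K" "\<And>f. f \<in> H \<Longrightarrow> N (T f) \<le> K * N f"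
proof -
  obtain K where K: "\<And>f. f \<in> H \<Longrightarrow> N (T f) \<le> K * N f" using assms unfolding bounded_operator_def by blast
  show thesis
  proof (rule that[of "max K 1"])
    fix f assume f: "f \<in> H"
    have "K * N f \<le> max K 1 * N f" using N_nonneg[OF f] by (intro mult_right_mono) auto
    then show "N (T f) \<le> max K 1 * N f" using K[OF f] by linarith
  qed simp
qed

lemma bounded_operator_mem: "bounded_operator H N T \<Longrightarrow> f \<in> H \<Longrightarrow> T f \<in> H"
  unfolding bounded_operator_def by blast

lemma bounded_operator_lin: "bounded_operator H N T \<Longrightarrow> f \<in> H \<Longrightarrow> g \<in> H \<Longrightarrow>
    T (\<lambda>z. a * f z + b * g z) = (\<lambda>z. a * T f z + b * T g z)"
  unfolding bounded_operator_def by blast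

text \<open>A real supremum has its meaning only on bounded sets; this is the side condition of
  every upper bound drawn from \<open>operator_norm\<close>.\<close>

lemma operator_norm_bdd:
  assumes T: "bounded_operator H N T" and R: "bounded_operator H N R"
  shows "bdd_above ((\<lambda>f. N (\<lambda>z. T f z - R f z)) ` {f\<in>H. N f \<le> 1})"
proof -
  obtain K where K: "0 < K" "\<And>f. f \<in> H \<Longrightarrow> N (T f) \<le> K * N f" using bounded_operator_bound[OF T] by blast
  obtain L where L: "0 < L" "\<And>f. f \<in> H \<Longrightarrow> N (R f) \<le> L * N f" using bounded_operator_bound[OF R] by blast
  show ?thesis
  proof (rule bdd_aboveI2)
    fix f assume f: "f \<in> {f\<in>H. N f \<le> 1}"
    have "N (\<lambda>z. T f z - R f z) \<le> N (T f) + N (R f)"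
      using f bounded_operator_mem T R by (intro N_diff_triangle) auto
    also have "\<dots> \<le> K * N f + L * N f" using f K L by (intro add_mono) auto
    also have "\<dots> \<le> K * 1 + L * 1" using f K L by (intro add_mono mult_left_mono) auto
    finally show "N (\<lambda>z. T f z - R f z) \<le> K + L" by simp
  qed
qed

lemma operator_norm_nonneg:
  assumes T: "bounded_operator H N T" and R: "bounded_operator H N R"
  shows "0 \<le> operator_norm H N (\<lambda>f z. T f z - R f z)"
proof -
  have "0 \<le> N (\<lambda>z. T (\<lambda>z. 0) z - R (\<lambda>z. 0) z)"
    using bounded_operator_mem[OF T zero_mem] bounded_operator_mem[OF R zero_mem] by (intro N_nonneg diff_mem)
  also have "\<dots> \<le> operator_norm H N (\<lambda>f z. T f z - R f z)"
    unfolding operator_norm_def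
    by (rule cSUP_upper[OF _ operator_norm_bdd[OF T R]]) (simp add: zero_mem N_zero)
  finally show ?thesis .
qed

lemma operator_norm_ge:
  assumes T: "bounded_operator H N T" and R: "bounded_operator H N R" and f: "f \<in> H" "0 < N f"
  shows "N (\<lambda>z. T f z - R f z) / N f \<le> operator_norm H N (\<lambda>f z. T f z - R f z)"
proof -
  define a :: complex where "a = of_real (1 / N f)"
  have lin: "S (\<lambda>z. a * f z) = (\<lambda>z. a * S f z)" if "bounded_operator H N S" for S
    using bounded_operator_lin[OF that f(1) f(1), of a 0] by simp
  have "N (\<lambda>z. a * (T f z - R f z)) = cmod a * N (\<lambda>z. T f z - R f z)"
    using bounded_operator_mem T R f by (intro N_scale diff_mem) auto
  then have "N (\<lambda>z. T f z - R f z) / N f = N (\<lambda>z. T (\<lambda>z. a * f z) z - R (\<lambda>z. a * f z) z)"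
    unfolding lin[OF T] lin[OF R] using f(2) by (simp add: a_def norm_divide right_diff_distrib)
  also have "\<dots> \<le> operator_norm H N (\<lambda>f z. T f z - R f z)"
    unfolding operator_norm_def
    by (rule cSUP_upper[OF _ operator_norm_bdd[OF T R]])
       (use f N_scale[OF f(1), of a] scale_mem[OF f(1), of a] in \<open>simp add: a_def norm_divide\<close>)
  finally show ?thesis .
qed

lemma approx_number_le:
  assumes T: "bounded_operator H N T" and R: "bounded_operator H N R" and rk: "rank_less H R n"
    and le: "\<And>f. f \<in> H \<Longrightarrow> N f \<le> 1 \<Longrightarrow> N (\<lambda>z. T f z - R f z) \<le> \<epsilon>"
  shows "approx_number H N n T \<le> \<epsilon>"
proof -
  have "approx_number H N n T \<le> operator_norm H N (\<lambda>f z. T f z - R f z)"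
    unfolding approx_number_def
    by (rule cINF_lower) (use R rk operator_norm_nonneg[OF T] in \<open>auto intro!: bdd_belowI2[where m = 0]\<close>)
  also have "\<dots> \<le> \<epsilon>"
    unfolding operator_norm_def
    by (rule cSUP_least) (use le zero_mem N_zero in auto)
  finally show ?thesis .
qed

text \<open>It makes the family in the infimum \<open>approx_number\<close> nonempty as soon as
  \<open>n \<ge> 1\<close>.\<close>

lemma zero_operator:
  assumes "1 \<le> n"
  shows "bounded_operator H N (\<lambda>f z. 0)" "rank_less H (\<lambda>f z. 0) n"
proof -
  show "bounded_operator H N (\<lambda>f z. 0)"
    unfolding bounded_operator_def using zero_mem N_zero N_nonneg by (auto intro!: exI[of _ 0])
  have "(\<lambda>f z. 0) ` H \<subseteq> cfun_span {}" by (auto simp: zero_fun_def)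
  moreover from cfun.dim_le_card[OF this] have "cfun_dim ((\<lambda>f z. 0) ` H) \<le> card {}" by simp
  ultimately show "rank_less H (\<lambda>f z. 0) n"
    unfolding rank_less_def using assms by (metis card.empty finite.emptyI le_zero_eq less_le_trans zero_less_one)
qed

lemma approx_number_nonneg:
  assumes T: "bounded_operator H N T" and n: "1 \<le> n"
  shows "0 \<le> approx_number H N n T"
  unfolding approx_number_def
  by (rule cINF_greatest) (use zero_operator[OF n] operator_norm_nonneg[OF T] in auto)

text \<open>Let \<open>Q\<close> be the projection with \<open>K = 2\<close> and
  \<open>P = I - Q\<close>. The operator \<open>R = T P\<close> has rank at most
  \<open>m < n\<close>, and \<open>T - R = T Q\<close> only sees vectors in the common kernel, where
  \<open>\<epsilon>\<close> applies; the factor \<open>2\<close> is the norm of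
  \<open>Q\<close>.\<close>

lemma approx_number_upper:
  assumes T: "bounded_operator H N T" and l: "\<And>i. i < m \<Longrightarrow> functional (l i)" and mn: "m < n"
    and \<epsilon>: "0 \<le> \<epsilon>" "\<And>g. g \<in> H \<Longrightarrow> (\<And>i. i < m \<Longrightarrow> l i g = 0) \<Longrightarrow> N (T g) \<le> \<epsilon> * N g"
  shows "approx_number H N n T \<le> 2 * \<epsilon>"
proof -
  have "(1::real) < 2" by simp
  from finite_codim_projection[where l = l, OF l this] obtain Q U
    where QU: "kernel_projection l m 2 Q U" by blast
  note U = kernel_projectionD(1-3)[OF QU] and Q = kernel_projectionD(4-7)[OF QU]
    and Qlin = kernel_projectionD(8)[OF QU]
  define P where "P f = (\<lambda>z. f z - Q f z)" for f
  define R where "R f = T (P f)" for f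
  have P: "P f \<in> H" if "f \<in> H" for f unfolding P_def using Q(1)[OF that] that by (rule diff_mem[rotated])
  have Plin: "P (\<lambda>z. a * f z + b * g z) = (\<lambda>z. a * P f z + b * P g z)" if "f \<in> H" "g \<in> H" for f g a b
    unfolding P_def Qlin[OF that] by (simp add: fun_eq_iff algebra_simps)
  have TQ: "(\<lambda>z. T f z - R f z) = T (Q f)" if "f \<in> H" for f
  proof -
    have "T (Q f) = T (\<lambda>z. 1 * f z + (-1) * P f z)" by (simp add: P_def)
    also have "\<dots> = (\<lambda>z. 1 * T f z + (-1) * T (P f) z)" by (rule bounded_operator_lin[OF T that P[OF that]])
    finally show ?thesis by (simp add: R_def)
  qed
  obtain K where K: "0 < K" "\<And>f. f \<in> H \<Longrightarrow> N (T f) \<le> K * N f" using bounded_operator_bound[OF T] by blast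
  have R: "bounded_operator H N R"
    unfolding bounded_operator_def
  proof (intro conjI ballI allI exI[of _ "K * 3"])
    fix f assume f: "f \<in> H"
    show "R f \<in> H" unfolding R_def by (intro bounded_operator_mem[OF T] P f)
    have "N (P f) \<le> N f + N (Q f)" unfolding P_def by (intro N_diff_triangle f Q)
    then have "N (P f) \<le> 3 * N f" using Q(2)[OF f] by simp
    then have "K * N (P f) \<le> K * (3 * N f)" using K by (intro mult_left_mono) auto
    then show "N (R f) \<le> K * 3 * N f" unfolding R_def using K(2)[OF P[OF f]] by linarith
  next
    fix f g a b assume "f \<in> H" "g \<in> H"
    then show "R (\<lambda>z. a * f z + b * g z) = (\<lambda>z. a * R f z + b * R g z)"
      unfolding R_def by (simp add: Plin bounded_operator_lin[OF T P P])
  qed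
  have span: "T v \<in> cfun_span (T ` U)" if "v \<in> cfun_span U" for v
  proof -
    \<comment> \<open>Linearity of \<open>T\<close> is available on \<open>H\<close> alone, hence
      membership in \<open>H\<close> is carried through the induction.\<close>
    have "v \<in> H \<and> T v \<in> cfun_span (T ` U)"
      using that
    proof (induction rule: cfun.span_induct_alt)
      case base
      have "T (\<lambda>z. 0) = (\<lambda>z. 0)" using bounded_operator_lin[OF T zero_mem zero_mem, of 0 0] by simp
      then show ?case using zero_mem cfun.span_zero by (simp add: zero_fun_def)
    next
      case (step c x y)
      have x: "x \<in> H" using step U by auto
      have eq: "(\<lambda>z. c * x z) + y = (\<lambda>z. c * x z + 1 * y z)" by (simp add: fun_eq_iff)
      have "(\<lambda>z. c * T x z) + T y \<in> cfun_span (T ` U)"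
        using step cfun.span_add[OF cfun.span_scale[OF cfun.span_base]] by blast
      moreover have "T ((\<lambda>z. c * x z) + y) = (\<lambda>z. c * T x z) + T y"
        unfolding eq using bounded_operator_lin[OF T x, of y c 1] step by (simp add: fun_eq_iff)
      ultimately have "T ((\<lambda>z. c * x z) + y) \<in> cfun_span (T ` U)" by simp
      moreover have "(\<lambda>z. c * x z) + y \<in> H"
        unfolding eq using step by (intro lin_mem x) blast
      ultimately show ?case by blast
    qed
    then show ?thesis by simp
  qed
  have RU: "R ` H \<subseteq> cfun_span (T ` U)" using span Q(4) by (auto simp: R_def P_def)
  have "cfun_dim (R ` H) \<le> card (T ` U)" using U by (intro cfun.dim_le_card RU) auto
  also have "\<dots> \<le> card U" using U by (intro card_image_le)
  finally have rk: "rank_less H R n" unfolding rank_less_def using RU U mn by (metis finite_imageI le_less_trans order_trans)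
  show ?thesis
  proof (rule approx_number_le[OF T R rk])
    fix f assume f: "f \<in> H" "N f \<le> 1"
    have "N (T (Q f)) \<le> \<epsilon> * N (Q f)" using Q f by (intro \<epsilon>) auto
    also have "\<dots> \<le> \<epsilon> * (2 * N f)" using \<epsilon>(1) Q(2)[OF f(1)] by (intro mult_left_mono)
    also have "\<dots> \<le> \<epsilon> * (2 * 1)" using \<epsilon>(1) f(2) by (intro mult_left_mono) auto
    finally show "N (\<lambda>z. T f z - R f z) \<le> 2 * \<epsilon>" unfolding TQ[OF f(1)] by simp
  qed
qed

text \<open>Dependence is a property of the set of values, whereas a relation between indexed
  vectors is wanted. A repeated value gives the relation \<open>g i - g j = 0\<close> directly;
  otherwise the \<open>n\<close> distinct values exceed the dimension.\<close>

lemma linear_relation: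
  fixes g :: "nat \<Rightarrow> cfun"
  assumes C: "finite C" "card C < n" "\<And>k. k < n \<Longrightarrow> g k \<in> cfun_span C"
  shows "\<exists>a. (\<exists>k<n. a k \<noteq> 0) \<and> (\<forall>z. (\<Sum>k<n. a k * g k z) = 0)"
proof (cases "inj_on g {..<n}")
  case False
  then obtain i j where ij: "i < n" "j < n" "i \<noteq> j" "g i = g j" by (auto simp: inj_on_def)
  define a :: "nat \<Rightarrow> complex" where "a k = (if k = i then 1 else if k = j then -1 else 0)" for k
  have "(\<Sum>k<n. a k * g k z) = (\<Sum>k<n. (if k = i then g i z else 0) - (if k = j then g j z else 0))" for z
    using ij by (intro sum.cong) (auto simp: a_def)
  then have "(\<Sum>k<n. a k * g k z) = 0" for z using ij by (simp add: sum_subtractf)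
  moreover have "\<exists>k<n. a k \<noteq> 0" using ij(1) by (auto simp: a_def intro!: exI[of _ i])
  ultimately show ?thesis by (intro exI[of _ a]) simp
next
  case True
  have "cfun.dependent (g ` {..<n})"
  proof (rule ccontr)
    assume "\<not> ?thesis"
    from cfun.independent_span_bound[OF C(1) this] C True show False
      by (auto simp: card_image)
  qed
  then obtain b v where b: "v \<in> g ` {..<n}" "b v \<noteq> 0" "(\<Sum>v\<in>g ` {..<n}. (\<lambda>z. b v * v z)) = 0"
    using cfun.dependent_finite[of "g ` {..<n}"] by auto
  have "(\<Sum>k<n. b (g k) * g k z) = 0" for z
  proof -
    have "(\<Sum>v\<in>g ` {..<n}. (\<lambda>z. b v * v z)) z = 0" using b(3) by simp
    then have "(\<Sum>v\<in>g ` {..<n}. b v * v z) = 0" by (simp add: sum_fun_apply)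
    then show ?thesis using True by (simp add: sum.reindex)
  qed
  then show ?thesis using b by (intro exI[of _ "\<lambda>k. b (g k)"]) auto
qed

lemma bounded_operator_sum:
  fixes f :: "nat \<Rightarrow> cfun"
  assumes T: "bounded_operator H N T" and f: "\<And>k. k < n \<Longrightarrow> f k \<in> H"
  shows "T (\<lambda>z. \<Sum>k<n. a k * f k z) = (\<lambda>z. \<Sum>k<n. a k * T (f k) z)"
  using f
proof (induction n)
  case 0
  then show ?case using bounded_operator_lin[OF T zero_mem zero_mem, of 0 0] by simp
next
  case (Suc n)
  have "T (\<lambda>z. 1 * (\<Sum>k<n. a k * f k z) + a n * f n z) = (\<lambda>z. 1 * T (\<lambda>z. \<Sum>k<n. a k * f k z) z + a n * T (f n) z)"
    by (rule bounded_operator_lin[OF T]) (use Suc.prems in \<open>auto intro: sum_mem\<close>)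
  then show ?case using Suc by simp
qed

text \<open>An operator \<open>R\<close> of rank below \<open>n\<close> annihilates some nontrivial
  combination of \<open>f 0, ..., f (n - 1)\<close>, and there \<open>T - R\<close> coincides with
  \<open>T\<close>. This bounds approximation numbers from below by Bernstein numbers.\<close>

lemma approx_number_lower:
  fixes f :: "nat \<Rightarrow> cfun"
  assumes T: "bounded_operator H N T" and n: "1 \<le> n" and f: "\<And>k. k < n \<Longrightarrow> f k \<in> H"
    and le: "\<And>a. \<exists>k<n. a k \<noteq> 0 \<Longrightarrow> 0 < N (\<lambda>z. \<Sum>k<n. a k * f k z) \<and>
      \<epsilon> * N (\<lambda>z. \<Sum>k<n. a k * f k z) \<le> N (T (\<lambda>z. \<Sum>k<n. a k * f k z))"
  shows "\<epsilon> \<le> approx_number H N n T"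
  unfolding approx_number_def
proof (rule cINF_greatest)
  show "{R. bounded_operator H N R \<and> rank_less H R n} \<noteq> {}" using zero_operator[OF n] by auto
  fix R assume "R \<in> {R. bounded_operator H N R \<and> rank_less H R n}"
  then have R: "bounded_operator H N R" and rk: "rank_less H R n" by auto
  obtain B where B: "finite B" "R ` H \<subseteq> cfun_span B" and dim: "cfun_dim (R ` H) < n"
    using rk unfolding rank_less_def by blast
  obtain C where C: "C \<subseteq> R ` H" "cfun.independent C" "R ` H \<subseteq> cfun_span C" "card C = cfun_dim (R ` H)"
    using cfun.basis_exists by blast
  \<comment> \<open>Finiteness comes from the spanning set \<open>B\<close> in
    \<open>rank_less\<close>; the value of \<open>cfun_dim\<close> alone does not entail it.\<close>
  have "finite C" using cfun.independent_span_bound[OF B(1) C(2)] C(1) B(2) by auto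
  moreover have "card C < n" using C(4) dim by simp
  moreover have "R (f k) \<in> cfun_span C" if "k < n" for k using f[OF that] C(3) by auto
  ultimately obtain a where a: "\<exists>k<n. a k \<noteq> 0" "\<And>z. (\<Sum>k<n. a k * R (f k) z) = 0"
    using linear_relation[of C n "\<lambda>k. R (f k)"] by blast
  define h where "h = (\<lambda>z. \<Sum>k<n. a k * f k z)"
  have h: "h \<in> H" unfolding h_def by (rule sum_mem) (use f in auto)
  have Rh: "R h = (\<lambda>z. 0)" unfolding h_def using bounded_operator_sum[OF R f] a(2) by simp
  have le': "0 < N h" "\<epsilon> * N h \<le> N (T h)" using le[OF a(1)] by (auto simp: h_def)
  then have "\<epsilon> \<le> N (T h) / N h" by (simp add: field_simps)
  also have "\<dots> \<le> operator_norm H N (\<lambda>f z. T f z - R f z)"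
    using operator_norm_ge[OF T R h le'(1)] by (simp add: Rh)
  finally show "\<epsilon> \<le> operator_norm H N (\<lambda>f z. T f z - R f z)" .
qed

end

section \<open>Weighted Dirichlet spaces on the strip\<close>

lemma set_integrable_dominated:
  fixes g :: "complex \<Rightarrow> 'b::{banach, second_countable_topology}" and f :: "complex \<Rightarrow> real"
  assumes A: "open A" "continuous_on A g" and f: "set_integrable lborel A f"
    and le: "\<And>x. x \<in> A \<Longrightarrow> norm (g x) \<le> f x"
  shows "set_integrable lborel A g"
proof (rule set_integrable_bound[OF f])
  show "set_borel_measurable lborel A g" unfolding set_borel_measurable_def
    using borel_measurable_continuous_on_indicator[OF borel_open[OF A(1)] A(2)] by simp
  show "AE x in lborel. x \<in> A \<longrightarrow> norm (g x) \<le> norm (f x)"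
    using le by (intro AE_I2) force
qed

text \<open>The second equation includes the divergent case, in which both sides have the default
  value \<open>0\<close>.\<close>

lemma set_integrable_iff_nn:
  fixes f :: "complex \<Rightarrow> real"
  assumes A: "open A" "continuous_on A f" and nn: "\<And>x. x \<in> A \<Longrightarrow> 0 \<le> f x"
  shows "set_integrable lborel A f \<longleftrightarrow> (\<integral>\<^sup>+x\<in>A. ennreal (f x) \<partial>lborel) < \<infinity>"
    and "(LINT x:A|lborel. f x) = enn2real (\<integral>\<^sup>+x\<in>A. ennreal (f x) \<partial>lborel)"
proof -
  have m: "(\<lambda>x. indicator A x * f x) \<in> borel_measurable lborel"
    using indicator_continuous_measurable[OF A] by simp
  have nn': "0 \<le> indicator A x * f x" for x using nn by (simp add: indicator_def)
  have eq: "(\<integral>\<^sup>+x. ennreal (indicator A x * f x) \<partial>lborel) = (\<integral>\<^sup>+x\<in>A. ennreal (f x) \<partial>lborel)"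
    by (intro nn_integral_cong) (auto simp: indicator_def)
  show "set_integrable lborel A f \<longleftrightarrow> (\<integral>\<^sup>+x\<in>A. ennreal (f x) \<partial>lborel) < \<infinity>"
    unfolding set_integrable_def real_scaleR_def integrable_iff_bounded eq[symmetric]
    using m nn' by simp
  show "(LINT x:A|lborel. f x) = enn2real (\<integral>\<^sup>+x\<in>A. ennreal (f x) \<partial>lborel)"
    unfolding set_lebesgue_integral_def real_scaleR_def eq[symmetric]
    by (rule integral_eq_nn_integral[OF m]) (use nn' in auto)
qed

lemma cmod_lin_sq_le: "(cmod (a * x + b * y))\<^sup>2 \<le> 2 * (cmod a)\<^sup>2 * (cmod x)\<^sup>2 + 2 * (cmod b)\<^sup>2 * (cmod y)\<^sup>2"
proof -
  have "(cmod (a * x + b * y))\<^sup>2 \<le> (cmod a * cmod x + cmod b * cmod y)\<^sup>2"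
    using norm_triangle_ineq[of "a * x" "b * y"] by (intro power_mono) (auto simp: norm_mult)
  also have "\<dots> \<le> 2 * (cmod a * cmod x)\<^sup>2 + 2 * (cmod b * cmod y)\<^sup>2"
    using sum_squares_bound[of "cmod a * cmod x" "cmod b * cmod y"] by (simp add: power2_sum)
  finally show ?thesis by (simp add: power_mult_distrib)
qed

context
  fixes A :: "complex set" and W :: "complex \<Rightarrow> real"
  assumes A: "open A" and W: "continuous_on A W" "\<And>z. z \<in> A \<Longrightarrow> 0 \<le> W z"
begin

lemma weighted_L2_lin:
  assumes F: "continuous_on A F" "set_integrable lborel A (\<lambda>z. (cmod (F z))\<^sup>2 * W z)"
    and G: "continuous_on A G" "set_integrable lborel A (\<lambda>z. (cmod (G z))\<^sup>2 * W z)"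
  shows "set_integrable lborel A (\<lambda>z. (cmod (a * F z + b * G z))\<^sup>2 * W z)"
proof (rule set_integrable_dominated[OF A])
  show "continuous_on A (\<lambda>z. (cmod (a * F z + b * G z))\<^sup>2 * W z)"
    by (intro continuous_intros F G W)
  show "set_integrable lborel A (\<lambda>z. 2 * (cmod a)\<^sup>2 * ((cmod (F z))\<^sup>2 * W z) + 2 * (cmod b)\<^sup>2 * ((cmod (G z))\<^sup>2 * W z))"
    using F G by (intro set_integral_add set_integrable_mult_right) auto
  fix z assume "z \<in> A"
  then show "norm ((cmod (a * F z + b * G z))\<^sup>2 * W z) \<le> 2 * (cmod a)\<^sup>2 * ((cmod (F z))\<^sup>2 * W z) + 2 * (cmod b)\<^sup>2 * ((cmod (G z))\<^sup>2 * W z)"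
    using mult_right_mono[OF cmod_lin_sq_le W(2)] W(2) by (simp add: distrib_right mult.assoc)
qed

text \<open>The coefficient \<open>p\<close> is the weighted integral of the real part of
  \<open>F * cnj G\<close>, which exists since the product of two moduli is at most the sum of their
  squares.\<close>

lemma weighted_L2_quadratic:
  assumes F: "continuous_on A F" "set_integrable lborel A (\<lambda>z. (cmod (F z))\<^sup>2 * W z)"
    and G: "continuous_on A G" "set_integrable lborel A (\<lambda>z. (cmod (G z))\<^sup>2 * W z)"
  shows "\<exists>p. \<forall>c::real. (LINT z:A|lborel. (cmod (F z + of_real c * G z))\<^sup>2 * W z) =
    (LINT z:A|lborel. (cmod (F z))\<^sup>2 * W z) + 2 * c * p + c\<^sup>2 * (LINT z:A|lborel. (cmod (G z))\<^sup>2 * W z)"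
proof -
  define P where "P z = Re (F z * cnj (G z)) * W z" for z
  have P: "set_integrable lborel A P"
  proof (rule set_integrable_dominated[OF A])
    show "continuous_on A P" unfolding P_def by (intro continuous_intros F G W)
    show "set_integrable lborel A (\<lambda>z. (cmod (F z))\<^sup>2 * W z + (cmod (G z))\<^sup>2 * W z)"
      using F G by (intro set_integral_add)
    fix z assume z: "z \<in> A"
    have "\<bar>Re (F z * cnj (G z))\<bar> \<le> cmod (F z) * cmod (G z)"
      using abs_Re_le_cmod[of "F z * cnj (G z)"] by (simp add: norm_mult)
    also have "\<dots> \<le> (cmod (F z))\<^sup>2 + (cmod (G z))\<^sup>2"
      using sum_squares_bound[of "cmod (F z)" "cmod (G z)"]
        mult_nonneg_nonneg[OF norm_ge_zero[of "F z"] norm_ge_zero[of "G z"]] by linarith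
    finally show "norm (P z) \<le> (cmod (F z))\<^sup>2 * W z + (cmod (G z))\<^sup>2 * W z"
      using W(2)[OF z] by (simp add: P_def abs_mult distrib_right[symmetric] mult_right_mono)
  qed
  have eq: "(cmod (F z + of_real c * G z))\<^sup>2 * W z =
      (cmod (F z))\<^sup>2 * W z + 2 * c * P z + c\<^sup>2 * ((cmod (G z))\<^sup>2 * W z)" for c z
    unfolding P_def cmod_power2 by (simp add: power2_eq_square algebra_simps)
  have i: "set_integrable lborel A (\<lambda>z. 2 * c * P z)" "set_integrable lborel A (\<lambda>z. c\<^sup>2 * ((cmod (G z))\<^sup>2 * W z))" for c
    using P G by (auto intro: set_integrable_mult_right)
  show ?thesis
    unfolding eq using F i
    by (intro exI[of _ "LINT z:A|lborel. P z"] allI)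
       (simp add: set_integral_add set_integral_mult_right)
qed

end

section \<open>The Dirichlet norm as a quadratic norm on the disk\<close>

lemma disk_weight_cont:
  "continuous_on (ball 0 1) (\<lambda>z::complex. (1 - (cmod z)\<^sup>2) powr \<alpha>)"
proof (intro continuous_intros ballI)
  fix z :: complex assume "z \<in> ball 0 1"
  then have "(cmod z)\<^sup>2 < 1" by (simp add: abs_square_less_1)
  then show "1 - (cmod z)\<^sup>2 \<noteq> 0" by simp
qed

lemma dirichlet_holomorphic: "f \<in> dirichlet_space \<alpha> \<Longrightarrow> f holomorphic_on ball 0 1"
  by (simp add: dirichlet_space_def)

lemma deriv_lin:
  assumes "f holomorphic_on A" "g holomorphic_on A" "open A" "z \<in> A"
  shows "deriv (\<lambda>z. a * f z + b * g z) z = a * deriv f z + b * deriv g z"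
proof -
  have "f field_differentiable at z" "g field_differentiable at z"
    using assms holomorphic_on_imp_differentiable_at by blast+
  then show ?thesis
    by (subst deriv_add) (auto intro!: derivative_intros simp: deriv_cmult)
qed

lemma deriv_holomorphic_cont: "f holomorphic_on A \<Longrightarrow> open A \<Longrightarrow> continuous_on A (deriv f)"
  by (intro holomorphic_on_imp_continuous_on holomorphic_deriv)

lemma dirichlet_norm_sq:
  assumes "0 \<le> \<alpha>"
  shows "(dirichlet_norm \<alpha> f)\<^sup>2 = (cmod (f 0))\<^sup>2 + (\<alpha> + 1) / pi *
     (LINT z:ball 0 1|lborel. (cmod (deriv f z))\<^sup>2 * (1 - (cmod z)\<^sup>2) powr \<alpha>)"
    and "0 \<le> dirichlet_norm \<alpha> f"
proof -
  have "0 \<le> (LINT z:ball 0 1|lborel. (cmod (deriv f z))\<^sup>2 * (1 - (cmod z)\<^sup>2) powr \<alpha>)"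
    unfolding set_lebesgue_integral_def by (intro Bochner_Integration.integral_nonneg) auto
  then have "0 \<le> (cmod (f 0))\<^sup>2 + (\<alpha> + 1) *
     ((LINT z:ball 0 1|lborel. (cmod (deriv f z))\<^sup>2 * (1 - (cmod z)\<^sup>2) powr \<alpha>) / pi)"
    using assms by simp
  then show "(dirichlet_norm \<alpha> f)\<^sup>2 = (cmod (f 0))\<^sup>2 + (\<alpha> + 1) / pi *
     (LINT z:ball 0 1|lborel. (cmod (deriv f z))\<^sup>2 * (1 - (cmod z)\<^sup>2) powr \<alpha>)"
    and "0 \<le> dirichlet_norm \<alpha> f"
    unfolding dirichlet_norm_def by simp_all
qed

lemma dirichlet_quadratic_normed_space:
  assumes \<alpha>: "0 \<le> \<alpha>"
  shows "quadratic_normed_space (dirichlet_space \<alpha>) (dirichlet_norm \<alpha>)"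
proof
  let ?W = "\<lambda>z::complex. (1 - (cmod z)\<^sup>2) powr \<alpha>"
  let ?B = "ball (0::complex) 1"
  note L2 = weighted_L2_lin[OF open_ball disk_weight_cont, simplified] weighted_L2_quadratic[OF open_ball disk_weight_cont, simplified]
  have d: "continuous_on ?B (deriv f)" "set_integrable lborel ?B (\<lambda>z. (cmod (deriv f z))\<^sup>2 * ?W z)"
    "f holomorphic_on ?B" if "f \<in> dirichlet_space \<alpha>" for f
    using that deriv_holomorphic_cont[of f ?B] by (auto simp: dirichlet_space_def)
  show "(\<lambda>z. 0) \<in> dirichlet_space \<alpha>" by (simp add: dirichlet_space_def set_integrable_def)
  show "0 \<le> dirichlet_norm \<alpha> f" for f by (rule dirichlet_norm_sq[OF \<alpha>])
  fix f assume f: "f \<in> dirichlet_space \<alpha>"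
  show "dirichlet_norm \<alpha> (\<lambda>z. a * f z) = cmod a * dirichlet_norm \<alpha> f" for a
  proof -
    have "deriv (\<lambda>z. a * f z) z = a * deriv f z" if "z \<in> ?B" for z
      using deriv_lin[OF d(3)[OF f] d(3)[OF f] open_ball that, of a 0] by simp
    then have "(LINT z:?B|lborel. (cmod (deriv (\<lambda>z. a * f z) z))\<^sup>2 * ?W z) = (LINT z:?B|lborel. (cmod a)\<^sup>2 * ((cmod (deriv f z))\<^sup>2 * ?W z))"
      by (intro set_lebesgue_integral_cong) (auto simp: norm_mult power_mult_distrib)
    also have "\<dots> = (cmod a)\<^sup>2 * (LINT z:?B|lborel. (cmod (deriv f z))\<^sup>2 * ?W z)"
      by (rule set_integral_mult_right)
    finally have "(dirichlet_norm \<alpha> (\<lambda>z. a * f z))\<^sup>2 = (cmod a * dirichlet_norm \<alpha> f)\<^sup>2"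
      unfolding power_mult_distrib dirichlet_norm_sq(1)[OF \<alpha>] by (simp add: norm_mult power_mult_distrib algebra_simps)
    then show ?thesis using dirichlet_norm_sq(2)[OF \<alpha>] by (subst (asm) power2_eq_iff_nonneg) auto
  qed
  fix g assume g: "g \<in> dirichlet_space \<alpha>"
  have dl: "deriv (\<lambda>z. a * f z + b * g z) z = a * deriv f z + b * deriv g z" if "z \<in> ?B" for a b z
    by (rule deriv_lin[OF d(3)[OF f] d(3)[OF g] open_ball that])
  show "(\<lambda>z. a * f z + b * g z) \<in> dirichlet_space \<alpha>" for a b
  proof -
    have "set_integrable lborel ?B (\<lambda>z. (cmod (a * deriv f z + b * deriv g z))\<^sup>2 * ?W z)"
      by (rule L2(1)[OF d(1,2)[OF f] d(1,2)[OF g]])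
    then have "set_integrable lborel ?B (\<lambda>z. (cmod (deriv (\<lambda>z. a * f z + b * g z) z))\<^sup>2 * ?W z)"
      by (subst set_integrable_cong[OF refl refl]) (auto simp: dl)
    then show ?thesis using f g unfolding dirichlet_space_def by (auto intro!: holomorphic_intros)
  qed
  obtain p where p: "\<And>c::real. (LINT z:?B|lborel. (cmod (deriv f z + of_real c * deriv g z))\<^sup>2 * ?W z) =
    (LINT z:?B|lborel. (cmod (deriv f z))\<^sup>2 * ?W z) + 2 * c * p + c\<^sup>2 * (LINT z:?B|lborel. (cmod (deriv g z))\<^sup>2 * ?W z)"
    using L2(2)[OF d(1,2)[OF f] d(1,2)[OF g]] by blast
  have "(dirichlet_norm \<alpha> (\<lambda>z. f z + of_real c * g z))\<^sup>2 = (dirichlet_norm \<alpha> f)\<^sup>2 +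
     2 * c * (Re (f 0 * cnj (g 0)) + (\<alpha> + 1) / pi * p) + c\<^sup>2 * (dirichlet_norm \<alpha> g)\<^sup>2" for c :: real
  proof -
    have "(LINT z:?B|lborel. (cmod (deriv (\<lambda>z. f z + of_real c * g z) z))\<^sup>2 * ?W z) =
        (LINT z:?B|lborel. (cmod (deriv f z + of_real c * deriv g z))\<^sup>2 * ?W z)"
      using dl[of _ 1 "of_real c"] by (intro set_lebesgue_integral_cong) auto
    moreover have "(cmod (f 0 + of_real c * g 0))\<^sup>2 = (cmod (f 0))\<^sup>2 + 2 * c * Re (f 0 * cnj (g 0)) + c\<^sup>2 * (cmod (g 0))\<^sup>2"
      unfolding cmod_power2 by (simp add: power2_eq_square algebra_simps)
    ultimately show ?thesis
      unfolding dirichlet_norm_sq(1)[OF \<alpha>] p by (simp add: algebra_simps)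
  qed
  then show "\<exists>p. \<forall>c::real. (dirichlet_norm \<alpha> (\<lambda>z. f z + of_real c * g z))\<^sup>2 = (dirichlet_norm \<alpha> f)\<^sup>2 + 2 * c * p + c\<^sup>2 * (dirichlet_norm \<alpha> g)\<^sup>2"
    by blast
qed

section \<open>Transfer of the Dirichlet integral to the strip\<close>

definition strip_deriv :: "cfun \<Rightarrow> cfun" where
  "strip_deriv f = deriv (\<lambda>u. f (disk_of_strip u))"

abbreviation (input) energy_density :: "real \<Rightarrow> cfun \<Rightarrow> complex \<Rightarrow> real" where
  "energy_density \<alpha> f \<equiv> (\<lambda>u. (cmod (strip_deriv f u))\<^sup>2 * strip_weight u powr \<alpha>)"

lemma holomorphic_on_strip:
  assumes "f holomorphic_on ball 0 1"
  shows "(\<lambda>u. f (disk_of_strip u)) holomorphic_on strip"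
proof -
  have "disk_of_strip ` strip \<subseteq> ball 0 1" by (simp only: disk_of_strip_image order_refl)
  from holomorphic_on_compose_gen[OF holomorphic_disk_of_strip assms this]
  show ?thesis by (simp add: o_def)
qed

lemma holomorphic_strip_deriv:
  assumes "f holomorphic_on ball 0 1"
  shows "strip_deriv f holomorphic_on strip"
  unfolding strip_deriv_def by (intro holomorphic_deriv holomorphic_on_strip assms open_strip)

lemma strip_deriv_cont: "f holomorphic_on ball 0 1 \<Longrightarrow> continuous_on strip (strip_deriv f)"
  by (intro holomorphic_on_imp_continuous_on holomorphic_strip_deriv)

lemma strip_deriv_eq:
  assumes f: "f holomorphic_on ball 0 1" and u: "u \<in> strip"
  shows "strip_deriv f u = deriv f (disk_of_strip u) * deriv disk_of_strip u"
proof -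
  have "disk_of_strip field_differentiable at u"
    using has_derivative_disk_of_strip[OF u] field_differentiable_def by blast
  moreover have "f field_differentiable at (disk_of_strip u)"
    using f disk_of_strip_in_ball[OF u] holomorphic_on_imp_differentiable_at by blast
  ultimately show ?thesis
    unfolding strip_deriv_def using deriv_chain[of disk_of_strip u f] by (simp add: o_def)
qed

lemma strip_deriv_lin:
  assumes "f holomorphic_on ball 0 1" "g holomorphic_on ball 0 1" "u \<in> strip"
  shows "strip_deriv (\<lambda>z. a * f z + b * g z) u = a * strip_deriv f u + b * strip_deriv g u"
  unfolding strip_deriv_def
  by (rule deriv_lin[OF holomorphic_on_strip[OF assms(1)] holomorphic_on_strip[OF assms(2)] open_strip assms(3)])

lemma strip_weight_powr_cont: "continuous_on strip (\<lambda>u. strip_weight u powr \<alpha>)"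
  using strip_weight_pos by (intro continuous_on_powr continuous_on_strip_weight continuous_intros) force

lemma strip_energy_cont:
  "f holomorphic_on ball 0 1 \<Longrightarrow> continuous_on strip (energy_density \<alpha> f)"
  by (intro continuous_intros strip_deriv_cont strip_weight_powr_cont)

text \<open>By the chain rule the Jacobian is absorbed into the derivative of the transported
  function. The Dirichlet integral therefore keeps its form and only the weight is
  transported.\<close>

lemma dirichlet_strip:
  assumes f: "f holomorphic_on ball 0 1"
  shows "set_integrable lborel (ball 0 1) (\<lambda>z. (cmod (deriv f z))\<^sup>2 * (1 - (cmod z)\<^sup>2) powr \<alpha>) \<longleftrightarrow>
      set_integrable lborel strip (energy_density \<alpha> f)"
    and "(LINT z:ball 0 1|lborel. (cmod (deriv f z))\<^sup>2 * (1 - (cmod z)\<^sup>2) powr \<alpha>) =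
      (LINT u:strip|lborel. energy_density \<alpha> f u)"
proof -
  let ?h = "\<lambda>z. (cmod (deriv f z))\<^sup>2 * (1 - (cmod z)\<^sup>2) powr \<alpha>"
  have c: "continuous_on (ball 0 1) ?h"
    by (intro continuous_intros disk_weight_cont deriv_holomorphic_cont f open_ball)
  have "(\<integral>\<^sup>+u\<in>strip. ennreal (energy_density \<alpha> f u) \<partial>lborel)
      = (\<integral>\<^sup>+u\<in>strip. ennreal (?h (disk_of_strip u) * (cmod (deriv disk_of_strip u))\<^sup>2) \<partial>lborel)"
    by (intro nn_integral_cong)
       (auto simp: indicator_def strip_deriv_eq[OF f] strip_weight_def norm_mult power_mult_distrib mult_ac)
  also have "\<dots> = (\<integral>\<^sup>+z\<in>disk_of_strip ` strip. ennreal (?h z) \<partial>lborel)"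
    by (rule conformal_change_of_variables[OF open_strip holomorphic_disk_of_strip inj_disk_of_strip])
       (use c in \<open>auto simp: disk_of_strip_image\<close>)
  finally have eq: "(\<integral>\<^sup>+u\<in>strip. ennreal (energy_density \<alpha> f u) \<partial>lborel)
      = (\<integral>\<^sup>+z\<in>ball 0 1. ennreal (?h z) \<partial>lborel)"
    unfolding disk_of_strip_image .
  show "set_integrable lborel (ball 0 1) ?h \<longleftrightarrow>
      set_integrable lborel strip (energy_density \<alpha> f)"
    unfolding set_integrable_iff_nn(1)[OF open_ball c, simplified]
      set_integrable_iff_nn(1)[OF open_strip strip_energy_cont[OF f], simplified] eq by simp
  show "(LINT z:ball 0 1|lborel. ?h z) = (LINT u:strip|lborel. energy_density \<alpha> f u)"
    unfolding set_integrable_iff_nn(2)[OF open_ball c, simplified]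
      set_integrable_iff_nn(2)[OF open_strip strip_energy_cont[OF f], simplified] eq by simp
qed

lemma dirichlet_space_iff:
  "f \<in> dirichlet_space \<alpha> \<longleftrightarrow> f holomorphic_on ball 0 1 \<and> (\<forall>z. z \<notin> ball 0 1 \<longrightarrow> f z = 0) \<and>
     set_integrable lborel strip (energy_density \<alpha> f)"
  unfolding dirichlet_space_def using dirichlet_strip(1) by blast

lemma dirichlet_norm_strip:
  assumes "0 \<le> \<alpha>" "f holomorphic_on ball 0 1"
  shows "(dirichlet_norm \<alpha> f)\<^sup>2 = (cmod (f 0))\<^sup>2 + (\<alpha> + 1) / pi *
     (LINT u:strip|lborel. energy_density \<alpha> f u)"
  unfolding dirichlet_norm_sq(1)[OF assms(1)] dirichlet_strip(2)[OF assms(2)] ..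

text \<open>Membership and a norm bound follow together from one integrable majorant of the energy
  density. The estimates of images for \<open>\<alpha> > 0\<close> and of exponential sums are all
  obtained in this form.\<close>

lemma dirichlet_norm_dominated:
  assumes \<alpha>: "0 \<le> \<alpha>" and f: "f holomorphic_on ball 0 1" "\<And>z. z \<notin> ball 0 1 \<Longrightarrow> f z = 0"
    and b: "set_integrable lborel strip b" "\<And>u. u \<in> strip \<Longrightarrow> energy_density \<alpha> f u \<le> b u"
  shows "f \<in> dirichlet_space \<alpha>" "(dirichlet_norm \<alpha> f)\<^sup>2 \<le> (cmod (f 0))\<^sup>2 + (\<alpha> + 1) / pi * (LINT u:strip|lborel. b u)"
proof -
  have i: "set_integrable lborel strip (energy_density \<alpha> f)"
    by (rule set_integrable_dominated[OF open_strip strip_energy_cont[OF f(1)] b(1)]) (use b(2) in simp)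
  then show "f \<in> dirichlet_space \<alpha>" using f by (simp add: dirichlet_space_iff)
  have "(LINT u:strip|lborel. energy_density \<alpha> f u) \<le> (LINT u:strip|lborel. b u)"
    by (rule set_integral_mono[OF i b(1)]) (use b(2) in auto)
  then show "(dirichlet_norm \<alpha> f)\<^sup>2 \<le> (cmod (f 0))\<^sup>2 + (\<alpha> + 1) / pi * (LINT u:strip|lborel. b u)"
    unfolding dirichlet_norm_strip[OF \<alpha> f(1)] using \<alpha> by (intro add_left_mono mult_left_mono) auto
qed

section \<open>Pointwise bounds by the norm\<close>

lemma cmod_value_0_le_dirichlet_norm:
  assumes "0 \<le> \<alpha>"
  shows "cmod (f 0) \<le> dirichlet_norm \<alpha> f"
proof -
  have "0 \<le> (LINT z:ball 0 1|lborel. (cmod (deriv f z))\<^sup>2 * (1 - (cmod z)\<^sup>2) powr \<alpha>)"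
    unfolding set_lebesgue_integral_def by (intro Bochner_Integration.integral_nonneg) auto
  then have "(cmod (f 0))\<^sup>2 \<le> (dirichlet_norm \<alpha> f)\<^sup>2"
    unfolding dirichlet_norm_sq(1)[OF assms] using assms by simp
  then show ?thesis using dirichlet_norm_sq(2)[OF assms] by (rule power2_le_imp_le)
qed

lemma strip_energy_le_norm:
  assumes "0 \<le> \<alpha>" "f \<in> dirichlet_space \<alpha>"
  shows "(LINT u:strip|lborel. energy_density \<alpha> f u) \<le> pi * (dirichlet_norm \<alpha> f)\<^sup>2"
proof -
  let ?I = "LINT u:strip|lborel. energy_density \<alpha> f u"
  have nn: "0 \<le> ?I"
    unfolding set_lebesgue_integral_def by (intro Bochner_Integration.integral_nonneg) auto
  have "?I \<le> (\<alpha> + 1) * ?I" using nn assms by (simp add: distrib_right)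
  also have "\<dots> = pi * ((\<alpha> + 1) / pi * ?I)" by simp
  also have "\<dots> \<le> pi * (dirichlet_norm \<alpha> f)\<^sup>2"
    unfolding dirichlet_norm_strip[OF assms(1) dirichlet_holomorphic[OF assms(2)]] by (intro mult_left_mono) auto
  finally show ?thesis .
qed

text \<open>The mean value inequality on a disc where the weight is at least \<open>m\<close> is
  compared with the energy of the whole strip. The area factor \<open>pi\<close> cancels against the
  normalisation of the norm; the larger radius \<open>R\<close> leaves room for the mean value
  property.\<close>

lemma strip_deriv_local_bound:
  assumes \<alpha>: "0 \<le> \<alpha>" and f: "f \<in> dirichlet_space \<alpha>" and \<rho>: "0 < \<rho>" "\<rho> < R" and sub: "ball v R \<subseteq> strip"
    and m: "0 < m" "\<And>u. u \<in> ball v \<rho> \<Longrightarrow> m \<le> strip_weight u powr \<alpha>"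
  shows "\<rho>\<^sup>2 * m * (cmod (strip_deriv f v))\<^sup>2 \<le> (dirichlet_norm \<alpha> f)\<^sup>2"
proof -
  let ?e = "\<lambda>u. energy_density \<alpha> f u"
  have hol: "strip_deriv f holomorphic_on ball v R"
    using holomorphic_strip_deriv[OF dirichlet_holomorphic[OF f]] sub by (rule holomorphic_on_subset)
  have i: "set_integrable lborel strip ?e" using f by (simp add: dirichlet_space_iff)
  have "ennreal (pi * \<rho>\<^sup>2 * (cmod (strip_deriv f v))\<^sup>2) \<le> (\<integral>\<^sup>+u\<in>ball v \<rho>. ennreal ((cmod (strip_deriv f u))\<^sup>2) \<partial>lborel)"
    by (rule area_mean_value_square[OF hol \<rho>])
  also have "\<dots> \<le> (\<integral>\<^sup>+u. ennreal (indicator strip u * (?e u / m)) \<partial>lborel)"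
  proof (intro nn_integral_mono)
    fix u
    show "ennreal ((cmod (strip_deriv f u))\<^sup>2) * indicator (ball v \<rho>) u \<le> ennreal (indicator strip u * (?e u / m))"
    proof (cases "u \<in> ball v \<rho>")
      case True
      then have "u \<in> strip" using sub \<rho> by auto
      have "(cmod (strip_deriv f u))\<^sup>2 * m \<le> ?e u" using m(2)[OF True] by (intro mult_left_mono) auto
      then have "(cmod (strip_deriv f u))\<^sup>2 \<le> ?e u / m" using m(1) by (simp add: field_simps)
      then show ?thesis using True \<open>u \<in> strip\<close> by (simp add: ennreal_leI)
    qed simp
  qed
  also have "\<dots> = ennreal (LINT u|lborel. indicator strip u * (?e u / m))"
  proof (rule nn_integral_eq_integral)
    have "integrable lborel (\<lambda>u. (indicator strip u * ?e u) / m)"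
      using i unfolding set_integrable_def by (intro integrable_divide) auto
    then show "integrable lborel (\<lambda>u. indicator strip u * (?e u / m))" by simp
  qed (use m(1) in auto)
  also have "(LINT u|lborel. indicator strip u * (?e u / m)) = (LINT u:strip|lborel. ?e u) / m"
    unfolding set_lebesgue_integral_def by simp
  finally have "pi * \<rho>\<^sup>2 * (cmod (strip_deriv f v))\<^sup>2 \<le> (LINT u:strip|lborel. ?e u) / m"
  proof (subst (asm) ennreal_le_iff)
    show "0 \<le> (LINT u:strip|lborel. ?e u) / m"
      unfolding set_lebesgue_integral_def using m(1)
      by (intro divide_nonneg_pos Bochner_Integration.integral_nonneg) auto
  qed
  also have "\<dots> \<le> pi * (dirichlet_norm \<alpha> f)\<^sup>2 / m"
    using strip_energy_le_norm[OF \<alpha> f] m(1) by (intro divide_right_mono) auto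
  finally have "pi * (\<rho>\<^sup>2 * m * (cmod (strip_deriv f v))\<^sup>2) \<le> pi * (dirichlet_norm \<alpha> f)\<^sup>2"
    using m(1) by (simp add: field_simps)
  then show ?thesis by simp
qed

lemma cos_mono_abs: "\<bar>x\<bar> \<le> y \<Longrightarrow> y \<le> pi \<Longrightarrow> cos y \<le> cos (x::real)"
  using cos_monotone_0_pi_le[of "\<bar>x\<bar>" y] by simp

text \<open>Around a point of the narrower strip, a disc of fixed radius carries weight at least a
  constant times \<open>exp (- |Re v|)\<close>. Its power \<open>\<alpha>\<close> bounds the squared
  derivative, and the square root leaves the exponent \<open>\<alpha> * |Re v| / 2\<close>.\<close>

lemma strip_deriv_bound:
  assumes \<alpha>: "0 \<le> \<alpha>" and \<nu>: "0 \<le> \<nu>" "\<nu> < 1"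
  shows "\<exists>K>0. \<forall>f\<in>dirichlet_space \<alpha>. \<forall>v. \<bar>Im v\<bar> \<le> \<nu> * pi / 2 \<longrightarrow>
      cmod (strip_deriv f v) \<le> K * exp (\<alpha> * \<bar>Re v\<bar> / 2) * dirichlet_norm \<alpha> f"
proof -
  \<comment> \<open>\<open>R\<close> is the distance of the narrower strip from the boundary and
    \<open>\<rho>\<close> is half of it. Discs of radius \<open>\<rho>\<close> reach at most the
    height \<open>(1 + \<nu>) * pi / 4\<close>, whose cosine is \<open>\<kappa>\<close>.\<close>
  define \<rho> where "\<rho> = (1 - \<nu>) * pi / 4"
  define R where "R = (1 - \<nu>) * pi / 2"
  define \<kappa> where "\<kappa> = cos ((1 + \<nu>) * pi / 4)"
  have \<rho>: "0 < \<rho>" "\<rho> < R" using \<nu> by (auto simp: \<rho>_def R_def)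
  have "(1 + \<nu>) * pi / 4 < pi / 2" "0 \<le> (1 + \<nu>) * pi / 4" using \<nu> by auto
  then have \<kappa>: "0 < \<kappa>" unfolding \<kappa>_def by (intro cos_gt_zero_pi) linarith+
  \<comment> \<open>This is the part of \<open>1 / (\<rho> * sqrt m)\<close> that does not depend on
    \<open>v\<close>, for the lower bound \<open>m\<close> of the weighted factor introduced
    below.\<close>
  define K where "K = exp (\<alpha> * \<rho> / 2) / (\<rho> * \<kappa> powr (\<alpha> / 2))"
  have K: "0 < K" using \<rho> \<kappa> by (simp add: K_def)
  show ?thesis
  proof (intro exI[of _ K] conjI K ballI allI impI)
    fix f v assume f: "f \<in> dirichlet_space \<alpha>" and v: "\<bar>Im v\<bar> \<le> \<nu> * pi / 2"
    define m where "m = (\<kappa> * exp (- \<bar>Re v\<bar> - \<rho>)) powr \<alpha>"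
    have m0: "0 < m" using \<kappa> by (simp add: m_def)
    have sub: "ball v R \<subseteq> strip"
    proof
      fix u assume "u \<in> ball v R"
      then have "\<bar>Im v - Im u\<bar> < R" using abs_Im_le_cmod[of "v - u"] by (simp add: dist_norm)
      moreover have "\<bar>Im u\<bar> \<le> \<bar>Im v\<bar> + \<bar>Im v - Im u\<bar>" by arith
      ultimately show "u \<in> strip" using v unfolding strip_def R_def
        by (simp add: field_simps)
    qed
    have "m \<le> strip_weight u powr \<alpha>" if "u \<in> ball v \<rho>" for u
    proof -
      have us: "u \<in> strip" using that sub \<rho> by auto
      have i: "\<bar>Im v - Im u\<bar> < \<rho>" "\<bar>Re v - Re u\<bar> < \<rho>"
        using that abs_Im_le_cmod[of "v - u"] abs_Re_le_cmod[of "v - u"] by (auto simp: dist_norm)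
      have "\<bar>Im u\<bar> \<le> \<bar>Im v\<bar> + \<bar>Im v - Im u\<bar>" by arith
      then have "\<bar>Im u\<bar> \<le> (1 + \<nu>) * pi / 4" using i(1) v unfolding \<rho>_def by (simp add: field_simps)
      then have "\<kappa> \<le> cos (Im u)" unfolding \<kappa>_def using \<nu> by (intro cos_mono_abs) auto
      moreover have "- \<bar>Re v\<bar> - \<rho> \<le> - \<bar>Re u\<bar>" using i(2) by linarith
      ultimately have "\<kappa> * exp (- \<bar>Re v\<bar> - \<rho>) \<le> cos (Im u) * exp (- \<bar>Re u\<bar>)"
        using \<kappa> by (intro mult_mono) auto
      also have "\<dots> \<le> strip_weight u" by (rule strip_weight_ge[OF us])
      finally show ?thesis unfolding m_def using \<kappa> \<alpha> by (intro powr_mono2) auto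
    qed
    from strip_deriv_local_bound[OF \<alpha> f \<rho> sub m0 this]
    have *: "\<rho>\<^sup>2 * m * (cmod (strip_deriv f v))\<^sup>2 \<le> (dirichlet_norm \<alpha> f)\<^sup>2" .
    have "m * (K * exp (\<alpha> * \<bar>Re v\<bar> / 2))\<^sup>2 * \<rho>\<^sup>2 = 1"
    proof -
      have "m = \<kappa> powr \<alpha> * exp (\<alpha> * (- \<bar>Re v\<bar> - \<rho>))"
        unfolding m_def using \<kappa> by (simp add: powr_mult exp_powr_real mult.commute)
      moreover have "(\<kappa> powr (\<alpha> / 2))\<^sup>2 = \<kappa> powr \<alpha>" using \<kappa> by (simp add: powr_power)
      moreover have "(exp (\<alpha> * \<rho> / 2))\<^sup>2 = exp (\<alpha> * \<rho>)" "(exp (\<alpha> * \<bar>Re v\<bar> / 2))\<^sup>2 = exp (\<alpha> * \<bar>Re v\<bar>)"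
        by (simp_all add: exp_double[symmetric])
      moreover have "exp (\<alpha> * (- \<bar>Re v\<bar> - \<rho>)) * (exp (\<alpha> * \<rho>) * exp (\<alpha> * \<bar>Re v\<bar>)) = 1"
        by (simp add: exp_add[symmetric] algebra_simps)
      ultimately show ?thesis using \<kappa> \<rho>
        by (simp add: K_def power_mult_distrib power_divide field_simps)
    qed
    then have "(cmod (strip_deriv f v))\<^sup>2 = (K * exp (\<alpha> * \<bar>Re v\<bar> / 2))\<^sup>2 * (\<rho>\<^sup>2 * m * (cmod (strip_deriv f v))\<^sup>2)"
      by (simp add: mult_ac)
    also have "\<dots> \<le> (K * exp (\<alpha> * \<bar>Re v\<bar> / 2))\<^sup>2 * (dirichlet_norm \<alpha> f)\<^sup>2"
      by (intro mult_left_mono *) auto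
    finally have "(cmod (strip_deriv f v))\<^sup>2 \<le> (K * exp (\<alpha> * \<bar>Re v\<bar> / 2) * dirichlet_norm \<alpha> f)\<^sup>2"
      by (simp add: power_mult_distrib)
    then show "cmod (strip_deriv f v) \<le> K * exp (\<alpha> * \<bar>Re v\<bar> / 2) * dirichlet_norm \<alpha> f"
      by (rule power2_le_imp_le) (intro mult_nonneg_nonneg less_imp_le[OF K] exp_ge_zero dirichlet_norm_sq(2)[OF \<alpha>])
  qed
qed

section \<open>Compactness criteria\<close>

text \<open>A \<open>Metric_space\<close> asks for nonnegativity and symmetry of the distance
  between arbitrary functions, inside \<open>H\<close> or not; hence the first two axioms carry no
  membership condition.\<close>

locale normed_function_space = quadratic_normed_space +
  assumes N_nonneg_all: "\<And>f. 0 \<le> N f"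
    and N_minus_all: "\<And>f. N (\<lambda>z. - f z) = N f"
    and N_definite: "\<And>f. f \<in> H \<Longrightarrow> N f = 0 \<Longrightarrow> f = (\<lambda>z. 0)"
begin

lemma metric_space: "Metric_space H (\<lambda>f g. N (\<lambda>z. f z - g z))"
proof
  fix f g :: cfun
  show "0 \<le> N (\<lambda>z. f z - g z)" by (rule N_nonneg_all)
  show "N (\<lambda>z. f z - g z) = N (\<lambda>z. g z - f z)" using N_minus_all[of "\<lambda>z. f z - g z"] by simp
next
  fix f g assume fg: "f \<in> H" "g \<in> H"
  show "N (\<lambda>z. f z - g z) = 0 \<longleftrightarrow> f = g"
  proof
    assume "N (\<lambda>z. f z - g z) = 0"
    from N_definite[OF diff_mem[OF fg] this] show "f = g" by (auto simp: fun_eq_iff)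
  qed (simp add: N_zero)
  fix h assume h: "h \<in> H"
  show "N (\<lambda>z. f z - h z) \<le> N (\<lambda>z. f z - g z) + N (\<lambda>z. g z - h z)"
    using N_triangle[OF diff_mem[OF fg] diff_mem[OF fg(2) h]] by simp
qed

text \<open>Compactness of the closure is equivalent to the Bolzano-Weierstrass property: an
  infinite subset of the image contains an injective sequence, and the limit of a subsequence is an
  accumulation point.\<close>

lemma compact_operatorI:
  assumes T: "bounded_operator H N T"
    and seq: "\<And>\<sigma> :: nat \<Rightarrow> cfun. \<forall>n. \<sigma> n \<in> H \<and> N (\<sigma> n) \<le> 1 \<Longrightarrow>
      \<exists>r g. strict_mono r \<and> g \<in> H \<and> (\<lambda>n. N (\<lambda>z. T (\<sigma> (r n)) z - g z)) \<longlonglongrightarrow> 0"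
  shows "compact_operator H N T"
proof -
  interpret M: Metric_space H "\<lambda>f g. N (\<lambda>z. f z - g z)" by (rule metric_space)
  have "M.mtopology derived_set_of S \<noteq> {}" if S: "infinite S" "S \<subseteq> T ` {f\<in>H. N f \<le> 1}" for S
  proof -
    obtain y :: "nat \<Rightarrow> cfun" where y: "inj y" "range y \<subseteq> S" using S(1) infinite_countable_subset by blast
    have "\<forall>n. \<exists>f. (f \<in> H \<and> N f \<le> 1) \<and> y n = T f"
    proof
      fix n
      have "y n \<in> T ` {f\<in>H. N f \<le> 1}" using subset_trans[OF y(2) S(2)] by (rule subsetD) (rule rangeI)
      then show "\<exists>f. (f \<in> H \<and> N f \<le> 1) \<and> y n = T f" by (elim imageE CollectE) (rule exI, rule conjI)
    qed
    from choice[OF this] obtain \<sigma> where \<sigma>': "\<forall>n. (\<sigma> n \<in> H \<and> N (\<sigma> n) \<le> 1) \<and> y n = T (\<sigma> n)" ..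
    have \<sigma>: "\<sigma> n \<in> H \<and> N (\<sigma> n) \<le> 1" for n by (rule conjunct1[OF spec[OF \<sigma>']])
    have y\<sigma>: "y n = T (\<sigma> n)" for n by (rule conjunct2[OF spec[OF \<sigma>']])
    have "\<forall>n. \<sigma> n \<in> H \<and> N (\<sigma> n) \<le> 1" using \<sigma> by (rule allI)
    from seq[OF this] obtain r g
      where r: "strict_mono r" "g \<in> H" "(\<lambda>n. N (\<lambda>z. T (\<sigma> (r n)) z - g z)) \<longlonglongrightarrow> 0"
      by (elim exE conjE) (rule that)
    have "\<exists>w\<in>S. w \<noteq> g \<and> w \<in> M.mball g e" if e: "0 < e" for e
    proof -
      obtain n0 where n0: "\<And>n. n \<ge> n0 \<Longrightarrow> N (\<lambda>z. T (\<sigma> (r n)) z - g z) < e"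
        using order_tendstoD(2)[OF r(3) e] unfolding eventually_sequentially by blast
      \<comment> \<open>An accumulation point must be approached by points other than itself. Two
        consecutive terms of the subsequence are distinct, so one of them differs from
        \<open>g\<close>.\<close>
      have "r n0 \<noteq> r (Suc n0)" using strict_monoD[OF r(1), of n0 "Suc n0"] by simp
      then have "y (r n0) \<noteq> y (r (Suc n0))" using y(1) by (simp add: inj_eq)
      then obtain n where n: "n \<ge> n0" "y (r n) \<noteq> g" by (metis le_Suc_eq order_refl)
      have "y (r n) \<in> H" unfolding y\<sigma> using \<sigma> bounded_operator_mem[OF T] by blast
      moreover have "N (\<lambda>z. g z - y (r n) z) < e" using n0[OF n(1)] M.commute unfolding y\<sigma> by metis
      ultimately have "y (r n) \<in> M.mball g e" using r(2) by simp
      then show ?thesis using n(2) y(2) by blast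
    qed
    then show ?thesis unfolding M.metric_derived_set_of using r(2) by blast
  qed
  then show ?thesis
    unfolding compact_operator_def norm_topology_def M.compact_closure_of_eq_Bolzano_Weierstrass
    using T by blast
qed

text \<open>A ball of radius \<open>e / 2\<close> around an accumulation point would contain two
  points of the sequence, which are at distance at least \<open>e\<close>.\<close>

lemma not_compact_operatorI:
  fixes \<sigma> :: "nat \<Rightarrow> cfun"
  assumes T: "bounded_operator H N T" and \<sigma>: "\<And>n. \<sigma> n \<in> H \<and> N (\<sigma> n) \<le> 1"
    and e: "0 < e" "\<And>m n. m \<noteq> n \<Longrightarrow> e \<le> N (\<lambda>z. T (\<sigma> m) z - T (\<sigma> n) z)"
  shows "\<not> compact_operator H N T"
proof
  assume c: "compact_operator H N T"
  interpret M: Metric_space H "\<lambda>f g. N (\<lambda>z. f z - g z)" by (rule metric_space)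
  define S where "S = range (\<lambda>n. T (\<sigma> n))"
  have "inj (\<lambda>n. T (\<sigma> n))"
  proof (rule injI, rule ccontr)
    fix m n assume "T (\<sigma> m) = T (\<sigma> n)" "m \<noteq> n"
    then show False using e(1) e(2)[of m n] N_zero by simp
  qed
  then have "infinite S" unfolding S_def using range_inj_infinite by blast
  moreover have "S \<subseteq> T ` {f\<in>H. N f \<le> 1}" "S \<subseteq> H"
    using \<sigma> bounded_operator_mem[OF T] by (auto simp: S_def)
  ultimately have "M.mtopology derived_set_of S \<noteq> {}"
    using c unfolding compact_operator_def norm_topology_def M.compact_closure_of_eq_Bolzano_Weierstrass
    by blast
  then obtain x where "x \<in> M.mtopology derived_set_of S" by auto
  then have x: "x \<in> H" "infinite (S \<inter> M.mball x (e / 2))"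
    using e(1) unfolding M.derived_set_of_infinite_mball by simp_all
  obtain a where a: "a \<in> S \<inter> M.mball x (e / 2)" using infinite_imp_nonempty[OF x(2)] by blast
  have "infinite (S \<inter> M.mball x (e / 2) - {a})" using x(2) by simp
  from infinite_imp_nonempty[OF this] obtain b where b: "b \<in> S \<inter> M.mball x (e / 2)" "b \<noteq> a" by blast
  obtain m n where mn: "a = T (\<sigma> m)" "b = T (\<sigma> n)" using a b by (auto simp: S_def)
  then have "m \<noteq> n" using b by auto
  then have "e \<le> N (\<lambda>z. a z - b z)" using e(2) mn by blast
  also have "\<dots> \<le> N (\<lambda>z. a z - x z) + N (\<lambda>z. x z - b z)"
    using a b x by (intro M.triangle) auto
  also have "\<dots> < e" using a b M.commute[of a x] by simp
  finally show False by simp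
qed

end

section \<open>Analysis on the strip\<close>

text \<open>Symmetry of the distance is required for all functions. Where \<open>f\<close> is not
  differentiable, \<open>deriv\<close> is a choice from an empty predicate, and the choice is the
  same for \<open>f\<close> and \<open>- f\<close>.\<close>

lemma deriv_minus_norm: "cmod (deriv (\<lambda>z. - f z) z) = cmod (deriv f z)"
proof (cases "f field_differentiable at z")
  case True
  then show ?thesis by (simp add: deriv_minus)
next
  case False
  then have "\<not> (\<lambda>z. - f z) field_differentiable at z"
    using field_differentiable_minus[of "\<lambda>z. - f z" "at z"] by auto
  then have "(\<lambda>D. DERIV (\<lambda>z. - f z) z :> D) = (\<lambda>D. DERIV f z :> D)"
    using False by (auto simp: field_differentiable_def)
  then show ?thesis by (simp add: deriv_def)
qed

lemma strip_deriv_zero_imp_const: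
  assumes f: "f holomorphic_on ball 0 1" and z: "\<And>u. u \<in> strip \<Longrightarrow> strip_deriv f u = 0" and w: "w \<in> ball 0 1"
  shows "f w = f 0"
proof -
  have "\<exists>c. \<forall>u\<in>strip. f (disk_of_strip u) = c"
  proof (rule has_field_derivative_zero_constant[OF convex_strip])
    fix u assume u: "u \<in> strip"
    have "((\<lambda>u. f (disk_of_strip u)) has_field_derivative strip_deriv f u) (at u)"
      unfolding strip_deriv_def using holomorphic_on_strip[OF f] open_strip u by (rule holomorphic_derivI)
    then show "((\<lambda>u. f (disk_of_strip u)) has_field_derivative 0) (at u within strip)"
      using z[OF u] by (simp add: has_field_derivative_at_within)
  qed
  then obtain c where "\<And>u. u \<in> strip \<Longrightarrow> f (disk_of_strip u) = c" by blast
  from this[OF strip_of_disk_in_strip[OF w]] this[OF zero_in_strip] show ?thesis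
    using disk_of_strip_of_disk[OF w] by simp
qed

lemma dirichlet_normed_function_space:
  assumes \<alpha>: "0 \<le> \<alpha>"
  shows "normed_function_space (dirichlet_space \<alpha>) (dirichlet_norm \<alpha>)"
proof (intro normed_function_space.intro dirichlet_quadratic_normed_space[OF \<alpha>] normed_function_space_axioms.intro)
  show "0 \<le> dirichlet_norm \<alpha> f" for f by (rule dirichlet_norm_sq(2)[OF \<alpha>])
  show "dirichlet_norm \<alpha> (\<lambda>z. - f z) = dirichlet_norm \<alpha> f" for f
    unfolding dirichlet_norm_def deriv_minus_norm by simp
  fix f assume f: "f \<in> dirichlet_space \<alpha>" and N0: "dirichlet_norm \<alpha> f = 0"
  have hol: "f holomorphic_on ball 0 1" by (rule dirichlet_holomorphic[OF f])
  have "strip_deriv f u = 0" if u: "u \<in> strip" for u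
  proof -
    \<comment> \<open>This value of \<open>\<nu>\<close> puts \<open>u\<close> exactly on the
      boundary of the narrower strip in \<open>strip_deriv_bound\<close>.\<close>
    have "0 \<le> \<bar>Im u\<bar> * 2 / pi" "\<bar>Im u\<bar> * 2 / pi < 1" using u by (auto simp: strip_def)
    then obtain K where K: "\<forall>f\<in>dirichlet_space \<alpha>. \<forall>v. \<bar>Im v\<bar> \<le> (\<bar>Im u\<bar> * 2 / pi) * pi / 2 \<longrightarrow>
      cmod (strip_deriv f v) \<le> K * exp (\<alpha> * \<bar>Re v\<bar> / 2) * dirichlet_norm \<alpha> f"
      using strip_deriv_bound[OF \<alpha>, of "\<bar>Im u\<bar> * 2 / pi"] by blast
    show ?thesis using K[rule_format, OF f, of u] N0 by simp
  qed
  from strip_deriv_zero_imp_const[OF hol this] have "f z = f 0" if "z \<in> ball 0 1" for z using that by blast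
  moreover have "f 0 = 0" using cmod_value_0_le_dirichlet_norm[OF \<alpha>, of f] N0 by simp
  moreover have "f z = 0" if "z \<notin> ball 0 1" for z using f that by (simp add: dirichlet_space_def)
  ultimately show "f = (\<lambda>z. 0)" by (metis)
qed

section \<open>Bounded functionals and functions constructed on the strip\<close>

lemma value_0_functional:
  assumes \<alpha>: "0 \<le> \<alpha>"
  shows "quadratic_normed_space.functional (dirichlet_space \<alpha>) (dirichlet_norm \<alpha>) (\<lambda>f. f 0)"
  unfolding quadratic_normed_space.functional_def[OF dirichlet_quadratic_normed_space[OF \<alpha>]]
  using cmod_value_0_le_dirichlet_norm[OF \<alpha>] by (auto intro!: exI[of _ 1])

text \<open>Cauchy's inequality on the unit circle around a real point bounds all derivatives there.
  The circle lies in \<open>|Im v| \<le> 1\<close>, which is the narrower strip with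
  \<open>\<nu> = 2 / pi\<close>.\<close>

lemma higher_strip_deriv_functional:
  assumes \<alpha>: "0 \<le> \<alpha>"
  shows "quadratic_normed_space.functional (dirichlet_space \<alpha>) (dirichlet_norm \<alpha>)
    (\<lambda>f. (deriv ^^ k) (strip_deriv f) (of_real x))"
  unfolding quadratic_normed_space.functional_def[OF dirichlet_quadratic_normed_space[OF \<alpha>]]
proof (intro conjI ballI allI)
  have x: "of_real x \<in> strip" by (simp add: strip_def)
  fix f g a b assume f: "f \<in> dirichlet_space \<alpha>" and g: "g \<in> dirichlet_space \<alpha>"
  note hf = holomorphic_strip_deriv[OF dirichlet_holomorphic[OF f]]
    and hg = holomorphic_strip_deriv[OF dirichlet_holomorphic[OF g]]
  have "(\<lambda>z. a * f z + b * g z) holomorphic_on ball 0 1"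
    using dirichlet_holomorphic f g by (intro holomorphic_intros) auto
  then have "(deriv ^^ k) (strip_deriv (\<lambda>z. a * f z + b * g z)) (of_real x)
      = (deriv ^^ k) (\<lambda>u. a * strip_deriv f u + b * strip_deriv g u) (of_real x)"
    using strip_deriv_lin dirichlet_holomorphic f g
    by (intro higher_deriv_transform_within_open[OF _ _ open_strip x] holomorphic_strip_deriv
        holomorphic_intros hf hg) auto
  also have "\<dots> = a * (deriv ^^ k) (strip_deriv f) (of_real x) + b * (deriv ^^ k) (strip_deriv g) (of_real x)"
    using hf hg x open_strip
    by (subst higher_deriv_add[OF _ _ open_strip x]) (auto intro!: holomorphic_intros simp: higher_deriv_cmult)
  finally show "(deriv ^^ k) (strip_deriv (\<lambda>z. a * f z + b * g z)) (of_real x)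
      = a * (deriv ^^ k) (strip_deriv f) (of_real x) + b * (deriv ^^ k) (strip_deriv g) (of_real x)" .
next
  have "0 \<le> 2 / pi" "2 / pi < 1" using pi_gt3 by auto
  from strip_deriv_bound[OF \<alpha> this] obtain K where K: "0 < K"
    and K': "\<forall>f\<in>dirichlet_space \<alpha>. \<forall>v. \<bar>Im v\<bar> \<le> (2 / pi) * pi / 2 \<longrightarrow>
      cmod (strip_deriv f v) \<le> K * exp (\<alpha> * \<bar>Re v\<bar> / 2) * dirichlet_norm \<alpha> f" by blast
  define C where "C = K * exp (\<alpha> * (\<bar>x\<bar> + 1) / 2)"
  have "cmod ((deriv ^^ k) (strip_deriv f) (of_real x)) \<le> fact k * C * dirichlet_norm \<alpha> f"
    if f: "f \<in> dirichlet_space \<alpha>" for f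
  proof -
    have "cball (of_real x) 1 \<subseteq> strip" using ball_real_subset_strip[of x] by force
    then have hol: "strip_deriv f holomorphic_on cball (of_real x) 1"
      using holomorphic_strip_deriv[OF dirichlet_holomorphic[OF f]] holomorphic_on_subset by blast
    have "norm ((deriv ^^ k) (strip_deriv f) (of_real x)) \<le> fact k * (C * dirichlet_norm \<alpha> f) / 1 ^ k"
    proof (rule Cauchy_inequality)
      show "strip_deriv f holomorphic_on ball (of_real x) 1" using hol ball_subset_cball holomorphic_on_subset by blast
      show "continuous_on (cball (of_real x) 1) (strip_deriv f)" by (rule holomorphic_on_imp_continuous_on[OF hol])
      fix u assume "cmod (of_real x - u) = 1"
      then have i: "\<bar>Im u\<bar> \<le> 1" "\<bar>x - Re u\<bar> \<le> 1"
        using abs_Im_le_cmod[of "of_real x - u"] abs_Re_le_cmod[of "of_real x - u"] by auto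
      have "cmod (strip_deriv f u) \<le> K * exp (\<alpha> * \<bar>Re u\<bar> / 2) * dirichlet_norm \<alpha> f"
        using i by (intro K'[rule_format] f) simp
      also have "\<dots> \<le> C * dirichlet_norm \<alpha> f"
      proof -
        have "\<bar>Re u\<bar> \<le> \<bar>x\<bar> + 1" using i by linarith
        then have "\<alpha> * \<bar>Re u\<bar> \<le> \<alpha> * (\<bar>x\<bar> + 1)" using \<alpha> by (rule mult_left_mono)
        then show ?thesis unfolding C_def using K dirichlet_norm_sq(2)[OF \<alpha>]
          by (intro mult_right_mono mult_left_mono) auto
      qed
      finally show "cmod (strip_deriv f u) \<le> C * dirichlet_norm \<alpha> f" .
    qed simp
    then show ?thesis by (simp add: mult.assoc)
  qed
  then show "\<exists>K. \<forall>f\<in>dirichlet_space \<alpha>. cmod ((deriv ^^ k) (strip_deriv f) (of_real x)) \<le> K * dirichlet_norm \<alpha> f"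
    by blast
qed

lemma strip_energy_nn:
  assumes f: "f holomorphic_on ball 0 1"
  shows "set_integrable lborel strip (energy_density \<alpha> f) \<longleftrightarrow>
      (\<integral>\<^sup>+u\<in>strip. ennreal (energy_density \<alpha> f u) \<partial>lborel) < \<infinity>"
    and "(LINT u:strip|lborel. energy_density \<alpha> f u) =
      enn2real (\<integral>\<^sup>+u\<in>strip. ennreal (energy_density \<alpha> f u) \<partial>lborel)"
  by (rule set_integrable_iff_nn[OF open_strip strip_energy_cont[OF f]]; simp)+

lemma strip_of_disk_0 [simp]: "strip_of_disk 0 = 0"
  by (simp add: strip_of_disk_def)

text \<open>The reverse passage from the strip to the disk: limits and test functions are produced
  on the strip, and the \<open>if\<close> supplies the extension by zero that
  \<open>dirichlet_space\<close> demands.\<close>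

lemma strip_deriv_of_strip:
  assumes F: "F holomorphic_on strip"
    and f_def: "\<And>z. f z = (if z \<in> ball 0 1 then F (strip_of_disk z) else 0)"
  shows "f holomorphic_on ball 0 1" "\<And>z. z \<notin> ball 0 1 \<Longrightarrow> f z = 0" "f 0 = F 0"
    "\<And>u. u \<in> strip \<Longrightarrow> strip_deriv f u = deriv F u"
proof -
  have "strip_of_disk ` ball 0 1 \<subseteq> strip" using strip_of_disk_in_strip by blast
  from holomorphic_on_compose_gen[OF holomorphic_strip_of_disk F this]
  show hol: "f holomorphic_on ball 0 1"
    by (rule holomorphic_transform) (simp add: f_def)
  show "f z = 0" if "z \<notin> ball 0 1" for z using that by (simp add: f_def)
  show "f 0 = F 0" by (simp add: f_def strip_of_disk_def)
  fix u assume u: "u \<in> strip"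
  show "strip_deriv f u = deriv F u" unfolding strip_deriv_def
    by (rule complex_derivative_transform_within_open[OF holomorphic_on_strip[OF hol] F open_strip u])
       (use disk_of_strip_in_ball in \<open>auto simp: f_def\<close>)
qed

lemma compact_strip_bound:
  assumes "compact K" "K \<subseteq> strip"
  obtains \<nu> X where "0 \<le> \<nu>" "\<nu> < 1" "\<And>v. v \<in> K \<Longrightarrow> \<bar>Im v\<bar> \<le> \<nu> * pi / 2" "\<And>v. v \<in> K \<Longrightarrow> \<bar>Re v\<bar> \<le> X"
proof (cases "K = {}")
  case True
  show ?thesis by (rule that[of 0 0]) (use True in auto)
next
  case False
  have "continuous_on K (\<lambda>v. \<bar>Im v\<bar>)" "continuous_on K (\<lambda>v. \<bar>Re v\<bar>)" by (intro continuous_intros)+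
  from continuous_attains_sup[OF assms(1) False this(1)] continuous_attains_sup[OF assms(1) False this(2)]
  obtain a b where a: "a \<in> K" "\<forall>v\<in>K. \<bar>Im v\<bar> \<le> \<bar>Im a\<bar>" and b: "\<forall>v\<in>K. \<bar>Re v\<bar> \<le> \<bar>Re b\<bar>" by blast
  show ?thesis
  proof (rule that[of "2 * \<bar>Im a\<bar> / pi" "\<bar>Re b\<bar>"])
    show "2 * \<bar>Im a\<bar> / pi < 1" using a(1) assms(2) by (auto simp: strip_def)
  qed (use a b in auto)
qed

text \<open>A Schwarz lemma of order \<open>M\<close>, up to the factor \<open>1 / (1 - q)\<close>:
  Cauchy's inequality bounds the term of order \<open>k\<close> in the power series by
  \<open>B * q ^ k\<close>, and the first \<open>M\<close> terms vanish.\<close>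

lemma vanishing_order_bound:
  assumes hol: "g holomorphic_on ball c R" and cont: "continuous_on (cball c R) g" and R: "0 < R"
    and B: "\<And>x. cmod (c - x) = R \<Longrightarrow> cmod (g x) \<le> B" and van: "\<And>k. k < M \<Longrightarrow> (deriv ^^ k) g c = 0"
    and q: "0 \<le> q" "q < 1" "cmod (v - c) \<le> q * R"
  shows "cmod (g v) \<le> B * q ^ M / (1 - q)"
proof -
  define t where "t k = (deriv ^^ k) g c / fact k * (v - c) ^ k" for k
  have "q * R < R" using q R by simp
  then have v: "v \<in> ball c R" using q(3) by (simp add: dist_norm norm_minus_commute)
  have ts: "t sums g v" unfolding t_def by (rule holomorphic_power_series[OF hol v])
  have B0: "0 \<le> B" using B[of "c + of_real R"] R order_trans[OF norm_ge_zero] by auto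
  have t_le: "cmod (t k) \<le> B * q ^ k" for k
  proof -
    have "cmod ((deriv ^^ k) g c) \<le> fact k * B / R ^ k" by (rule Cauchy_inequality[OF hol cont R B])
    then have "cmod ((deriv ^^ k) g c) / fact k \<le> B / R ^ k" by (simp add: field_simps)
    moreover have "cmod (v - c) ^ k \<le> (q * R) ^ k" using q(3) by (intro power_mono) auto
    ultimately have "cmod ((deriv ^^ k) g c) / fact k * cmod (v - c) ^ k \<le> B / R ^ k * (q * R) ^ k"
      using B0 R by (intro mult_mono) auto
    then show ?thesis using R by (simp add: t_def norm_mult norm_divide norm_power power_mult_distrib)
  qed
  have tz: "t k = 0" if "k < M" for k using van[OF that] by (simp add: t_def)
  have "(\<lambda>k. t (k + M)) sums (g v - (\<Sum>k<M. t k))" using ts by (simp add: sums_iff_shift)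
  then have s: "(\<lambda>k. t (k + M)) sums g v" using tz by simp
  have gs: "(\<lambda>k. B * q ^ M * q ^ k) sums (B * q ^ M * (1 / (1 - q)))"
    using q by (intro sums_mult geometric_sums) auto
  have le: "cmod (t (k + M)) \<le> B * q ^ M * q ^ k" for k using t_le[of "k + M"] by (simp add: power_add mult_ac)
  have "cmod (\<Sum>k. t (k + M)) \<le> (\<Sum>k. B * q ^ M * q ^ k)"
    by (rule norm_suminf_le[OF le sums_summable[OF gs]])
  then show ?thesis using sums_unique[OF s] sums_unique[OF gs] by simp
qed

text \<open>By discrete Fourier inversion, \<open>b k\<close> is the mean over the
  \<open>n\<close>-th roots of unity of the polynomial times a unimodular factor. A mean cannot
  exceed all the moduli that it averages.\<close>

lemma exists_large_value_at_root_of_unity: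
  fixes b :: "nat \<Rightarrow> complex"
  assumes k: "k < n"
  shows "\<exists>j<n. cmod (b k) \<le> cmod (\<Sum>l<n. b l * (exp (2 * of_real pi * \<i> * of_nat j / of_nat n)) ^ l)"
proof (rule ccontr)
  assume neg: "\<not> ?thesis"
  define \<omega> where "\<omega> j = exp (2 * of_real pi * \<i> * of_nat j / of_nat n)" for j
  have n: "0 < n" using k by simp
  have \<omega>_pow: "\<omega> j ^ l = \<omega> l ^ j" for j l
    by (simp add: \<omega>_def exp_of_nat_mult[symmetric] mult_ac)
  have \<omega>_norm: "cmod (\<omega> j) = 1" for j
    by (simp add: \<omega>_def)
  have \<omega>_n: "\<omega> j ^ n = 1" for j
    unfolding \<omega>_def using complex_root_unity[of n j] n by simp
  have ortho: "(\<Sum>j<n. \<omega> j ^ l * cnj (\<omega> j ^ k)) = (if l = k then of_nat n else 0)" if l: "l < n" for l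
  proof -
    define r where "r = \<omega> l * cnj (\<omega> k)"
    have "(\<Sum>j<n. \<omega> j ^ l * cnj (\<omega> j ^ k)) = (\<Sum>j<n. r ^ j)"
      unfolding \<omega>_pow[of _ l] \<omega>_pow[of _ k] r_def by (simp add: power_mult_distrib)
    moreover have "r = 1" if "l = k"
      using \<omega>_norm[of k] that by (simp add: r_def complex_norm_square[symmetric])
    moreover have "r \<noteq> 1" if "l \<noteq> k"
    proof
      assume "r = 1"
      then have "\<omega> l * (cnj (\<omega> k) * \<omega> k) = \<omega> k" by (simp add: r_def mult.assoc[symmetric])
      moreover have "cnj (\<omega> k) * \<omega> k = 1" using \<omega>_norm[of k] complex_norm_square[of "\<omega> k"] by (simp add: mult.commute)
      ultimately have "\<omega> l = \<omega> k" by simp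
      then show False using complex_root_unity_eq[of n l k] n l k that unfolding \<omega>_def by simp
    qed
    moreover have "r ^ n = 1" using \<omega>_n by (simp add: r_def power_mult_distrib complex_cnj_power[symmetric] del: complex_cnj_power)
    ultimately show ?thesis by (auto simp: geometric_sum)
  qed
  define p where "p j = (\<Sum>l<n. b l * \<omega> j ^ l)" for j
  have "(\<Sum>j<n. p j * cnj (\<omega> j ^ k)) = (\<Sum>j<n. \<Sum>l<n. b l * (\<omega> j ^ l * cnj (\<omega> j ^ k)))"
    by (simp add: p_def sum_distrib_right mult.assoc)
  also have "\<dots> = (\<Sum>l<n. b l * (\<Sum>j<n. \<omega> j ^ l * cnj (\<omega> j ^ k)))"
    by (subst sum.swap) (simp add: sum_distrib_left)
  also have "\<dots> = (\<Sum>l<n. if l = k then b k * of_nat n else 0)"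
    by (intro sum.cong) (auto simp: ortho simp del: complex_cnj_power)
  also have "\<dots> = b k * of_nat n" using k by simp
  finally have "real n * cmod (b k) = cmod (\<Sum>j<n. p j * cnj (\<omega> j ^ k))" by (simp add: norm_mult)
  also have "\<dots> \<le> (\<Sum>j<n. cmod (p j))"
    by (rule order_trans[OF norm_sum]) (simp add: norm_mult norm_power \<omega>_norm)
  also have "\<dots> < (\<Sum>j<n. cmod (b k))"
    by (rule sum_strict_mono) (use n neg in \<open>auto simp: p_def \<omega>_def not_le\<close>)
  finally show False by simp
qed

section \<open>Lens operators\<close>

context
  fixes \<theta> :: real
  assumes \<theta>: "0 < \<theta>" "\<theta> < 1"
begin

abbreviation (input) lens_operator :: "cfun \<Rightarrow> cfun" where
  "lens_operator \<equiv> composition_operator (lens_map \<theta>)"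

lemma lens_operator_holomorphic:
  assumes "f holomorphic_on ball 0 1"
  shows "lens_operator f holomorphic_on ball 0 1"
proof -
  have "lens_map \<theta> ` ball 0 1 \<subseteq> ball 0 1" using lens_map_in_ball[OF _ \<theta>] by blast
  from holomorphic_on_compose_gen[OF holomorphic_lens_map[OF \<theta>] assms this]
  show ?thesis by (rule holomorphic_transform) (simp add: composition_operator_def)
qed

lemma lens_operator_outside: "z \<notin> ball 0 1 \<Longrightarrow> lens_operator f z = 0"
  by (simp add: composition_operator_def)

lemma lens_operator_0 [simp]: "lens_operator f 0 = f 0"
  by (simp add: composition_operator_def)

lemma lens_operator_lin: "lens_operator (\<lambda>z. a * f z + b * g z) = (\<lambda>z. a * lens_operator f z + b * lens_operator g z)"
  by (auto simp: composition_operator_def fun_eq_iff)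

lemma deriv_scaled_strip:
  assumes F: "F holomorphic_on strip" and u: "u \<in> strip"
  shows "deriv (\<lambda>u. F (of_real \<theta> * u)) u = of_real \<theta> * deriv F (of_real \<theta> * u)"
proof (rule deriv_compose_linear)
  have "of_real \<theta> * u \<in> strip" using strip_scale \<theta> u by simp
  then show "F field_differentiable at (of_real \<theta> * u)"
    using F open_strip holomorphic_on_imp_differentiable_at by blast
qed

lemma holomorphic_scaled_strip:
  assumes F: "F holomorphic_on strip"
  shows "(\<lambda>u. F (of_real \<theta> * u)) holomorphic_on strip"
proof -
  have "(*) (of_real \<theta>) ` strip \<subseteq> strip" using strip_scale \<theta> by auto
  from holomorphic_on_compose_gen[OF _ F this] show ?thesis by (simp add: o_def holomorphic_intros)
qed

lemma strip_deriv_lens_operator: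
  assumes f: "f holomorphic_on ball 0 1" and u: "u \<in> strip"
  shows "strip_deriv (lens_operator f) u = of_real \<theta> * strip_deriv f (of_real \<theta> * u)"
proof -
  have "deriv (\<lambda>u. lens_operator f (disk_of_strip u)) u = deriv (\<lambda>u. f (disk_of_strip (of_real \<theta> * u))) u"
  proof (rule complex_derivative_transform_within_open[OF _ _ open_strip u])
    show "(\<lambda>u. lens_operator f (disk_of_strip u)) holomorphic_on strip"
      by (intro holomorphic_on_strip lens_operator_holomorphic f)
    show "(\<lambda>u. f (disk_of_strip (of_real \<theta> * u))) holomorphic_on strip"
      by (rule holomorphic_scaled_strip[OF holomorphic_on_strip[OF f]])
    show "lens_operator f (disk_of_strip w) = f (disk_of_strip (of_real \<theta> * w))" if "w \<in> strip" for w
      using disk_of_strip_in_ball[OF that] lens_map_disk_of_strip[OF that \<theta>] by (simp add: composition_operator_def)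
  qed
  also have "\<dots> = of_real \<theta> * strip_deriv f (of_real \<theta> * u)"
    unfolding strip_deriv_def by (rule deriv_scaled_strip[OF holomorphic_on_strip[OF f] u])
  finally show ?thesis unfolding strip_deriv_def .
qed

text \<open>Squaring gives growth at rate \<open>\<alpha> * \<theta>\<close> against decay of the
  weight at rate \<open>\<alpha>\<close>. The constant \<open>B\<close> stays free: it is a multiple
  of the norm in general, and geometrically small near zeros of high order.\<close>

lemma lens_operator_energy_bound:
  assumes \<alpha>: "0 \<le> \<alpha>" and u: "u \<in> strip" and "0 \<le> B"
    and le: "cmod (strip_deriv f (of_real \<theta> * u)) \<le> B * exp (\<alpha> * \<bar>Re (of_real \<theta> * u)\<bar> / 2)"
  shows "(cmod (of_real \<theta> * strip_deriv f (of_real \<theta> * u)))\<^sup>2 * strip_weight u powr \<alpha>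
      \<le> 4 powr \<alpha> * B\<^sup>2 * exp (- (\<alpha> * (1 - \<theta>)) * \<bar>Re u\<bar>)"
proof -
  have "cmod (of_real \<theta> * strip_deriv f (of_real \<theta> * u)) \<le> 1 * cmod (strip_deriv f (of_real \<theta> * u))"
    unfolding norm_mult using \<theta> by (intro mult_right_mono) auto
  then have "(cmod (of_real \<theta> * strip_deriv f (of_real \<theta> * u)))\<^sup>2 \<le> (B * exp (\<alpha> * \<bar>Re (of_real \<theta> * u)\<bar> / 2))\<^sup>2"
    using le by (intro power_mono) auto
  also have "\<dots> = B\<^sup>2 * exp (\<alpha> * \<theta> * \<bar>Re u\<bar>)"
    using \<theta> by (simp add: power_mult_distrib exp_double[symmetric] abs_mult mult.assoc)
  finally have 1: "(cmod (of_real \<theta> * strip_deriv f (of_real \<theta> * u)))\<^sup>2 \<le> B\<^sup>2 * exp (\<alpha> * \<theta> * \<bar>Re u\<bar>)" .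
  note strip_weight_powr_le[OF \<alpha> u]
  with 1 have "(cmod (of_real \<theta> * strip_deriv f (of_real \<theta> * u)))\<^sup>2 * strip_weight u powr \<alpha>
      \<le> (B\<^sup>2 * exp (\<alpha> * \<theta> * \<bar>Re u\<bar>)) * (4 powr \<alpha> * exp (- \<alpha> * \<bar>Re u\<bar>))"
    by (intro mult_mono) auto
  also have "\<dots> = 4 powr \<alpha> * B\<^sup>2 * (exp (\<alpha> * \<theta> * \<bar>Re u\<bar>) * exp (- \<alpha> * \<bar>Re u\<bar>))" by simp
  also have "exp (\<alpha> * \<theta> * \<bar>Re u\<bar>) * exp (- \<alpha> * \<bar>Re u\<bar>) = exp (- (\<alpha> * (1 - \<theta>)) * \<bar>Re u\<bar>)"
    unfolding exp_add[symmetric] by (simp add: algebra_simps)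
  finally show ?thesis .
qed

lemma abs_Im_scaled_strip: "u \<in> strip \<Longrightarrow> \<bar>Im (of_real \<theta> * u)\<bar> \<le> \<theta> * pi / 2"
  using \<theta> by (simp add: strip_def abs_mult)

lemma lens_operator_energy_dominated:
  assumes \<alpha>: "0 \<le> \<alpha>"
  shows "\<exists>D>0. \<forall>f\<in>dirichlet_space \<alpha>. \<forall>u\<in>strip.
    (cmod (of_real \<theta> * strip_deriv f (of_real \<theta> * u)))\<^sup>2 * strip_weight u powr \<alpha>
      \<le> D * (dirichlet_norm \<alpha> f)\<^sup>2 * exp (- (\<alpha> * (1 - \<theta>)) * \<bar>Re u\<bar>)"
proof -
  obtain K where K: "0 < K"
    and K': "\<forall>f\<in>dirichlet_space \<alpha>. \<forall>v. \<bar>Im v\<bar> \<le> \<theta> * pi / 2 \<longrightarrow> cmod (strip_deriv f v) \<le> K * exp (\<alpha> * \<bar>Re v\<bar> / 2) * dirichlet_norm \<alpha> f"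
    using strip_deriv_bound[OF \<alpha> less_imp_le[OF \<theta>(1)] \<theta>(2)] by blast
  show ?thesis
  proof (intro exI[of _ "4 powr \<alpha> * K\<^sup>2"] conjI ballI)
    fix f u assume f: "f \<in> dirichlet_space \<alpha>" and u: "u \<in> strip"
    have "(cmod (of_real \<theta> * strip_deriv f (of_real \<theta> * u)))\<^sup>2 * strip_weight u powr \<alpha>
      \<le> 4 powr \<alpha> * (K * dirichlet_norm \<alpha> f)\<^sup>2 * exp (- (\<alpha> * (1 - \<theta>)) * \<bar>Re u\<bar>)"
    proof (rule lens_operator_energy_bound[OF \<alpha> u])
      show "0 \<le> K * dirichlet_norm \<alpha> f" by (intro mult_nonneg_nonneg less_imp_le[OF K] dirichlet_norm_sq(2)[OF \<alpha>])
      show "cmod (strip_deriv f (of_real \<theta> * u)) \<le> K * dirichlet_norm \<alpha> f * exp (\<alpha> * \<bar>Re (of_real \<theta> * u)\<bar> / 2)"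
        using K'[rule_format, OF f abs_Im_scaled_strip[OF u]] by (simp add: mult_ac)
    qed
    then show "(cmod (of_real \<theta> * strip_deriv f (of_real \<theta> * u)))\<^sup>2 * strip_weight u powr \<alpha>
      \<le> 4 powr \<alpha> * K\<^sup>2 * (dirichlet_norm \<alpha> f)\<^sup>2 * exp (- (\<alpha> * (1 - \<theta>)) * \<bar>Re u\<bar>)"
      by (simp add: power_mult_distrib mult_ac)
  qed (use K in simp)
qed

section \<open>Boundedness of the lens operator\<close>

lemma lens_operator_bounded_pos:
  assumes \<alpha>: "0 < \<alpha>"
  shows "bounded_operator (dirichlet_space \<alpha>) (dirichlet_norm \<alpha>) lens_operator"
proof -
  have \<alpha>': "0 \<le> \<alpha>" using \<alpha> by simp
  obtain D where D: "0 < D" and D': "\<forall>f\<in>dirichlet_space \<alpha>. \<forall>u\<in>strip.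
    (cmod (of_real \<theta> * strip_deriv f (of_real \<theta> * u)))\<^sup>2 * strip_weight u powr \<alpha>
      \<le> D * (dirichlet_norm \<alpha> f)\<^sup>2 * exp (- (\<alpha> * (1 - \<theta>)) * \<bar>Re u\<bar>)"
    using lens_operator_energy_dominated[OF \<alpha>'] by blast
  define I where "I = (LINT u:strip|lborel. exp (- (\<alpha> * (1 - \<theta>)) * \<bar>Re u\<bar>))"
  have i: "set_integrable lborel strip (\<lambda>u. exp (- (\<alpha> * (1 - \<theta>)) * \<bar>Re u\<bar>))"
    using \<alpha> \<theta> by (intro exp_abs_Re_integrable) simp
  have I: "0 \<le> I" unfolding I_def set_lebesgue_integral_def by (intro Bochner_Integration.integral_nonneg) auto
  have main: "lens_operator f \<in> dirichlet_space \<alpha> \<and>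
      dirichlet_norm \<alpha> (lens_operator f) \<le> sqrt (1 + (\<alpha> + 1) / pi * (D * I)) * dirichlet_norm \<alpha> f"
    if f: "f \<in> dirichlet_space \<alpha>" for f
  proof -
    note hol = dirichlet_holomorphic[OF f]
    let ?b = "\<lambda>u. D * (dirichlet_norm \<alpha> f)\<^sup>2 * exp (- (\<alpha> * (1 - \<theta>)) * \<bar>Re u\<bar>)"
    have b: "energy_density \<alpha> (lens_operator f) u \<le> ?b u" if "u \<in> strip" for u
      using D'[rule_format, OF f that] strip_deriv_lens_operator[OF hol that] by simp
    note dn = dirichlet_norm_dominated[OF \<alpha>' lens_operator_holomorphic[OF hol] lens_operator_outside
        set_integrable_mult_right[OF i] b]
    have "(dirichlet_norm \<alpha> (lens_operator f))\<^sup>2 \<le> (cmod (f 0))\<^sup>2 + (\<alpha> + 1) / pi * (LINT u:strip|lborel. ?b u)"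
      using dn(2) by simp
    also have "(LINT u:strip|lborel. ?b u) = D * (dirichlet_norm \<alpha> f)\<^sup>2 * I"
      unfolding I_def by (rule set_integral_mult_right)
    also have "(cmod (f 0))\<^sup>2 \<le> (dirichlet_norm \<alpha> f)\<^sup>2"
      using cmod_value_0_le_dirichlet_norm[OF \<alpha>'] by (intro power_mono) auto
    finally have "(dirichlet_norm \<alpha> (lens_operator f))\<^sup>2 \<le> (1 + (\<alpha> + 1) / pi * (D * I)) * (dirichlet_norm \<alpha> f)\<^sup>2"
      by (simp add: algebra_simps)
    also have "\<dots> = (sqrt (1 + (\<alpha> + 1) / pi * (D * I)) * dirichlet_norm \<alpha> f)\<^sup>2"
      using I D \<alpha> by (simp add: power_mult_distrib)
    finally have "dirichlet_norm \<alpha> (lens_operator f) \<le> sqrt (1 + (\<alpha> + 1) / pi * (D * I)) * dirichlet_norm \<alpha> f"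
      by (rule power2_le_imp_le) (use I D \<alpha> in \<open>intro mult_nonneg_nonneg dirichlet_norm_sq(2)[OF \<alpha>'], simp\<close>)
    then show ?thesis using dn(1) by blast
  qed
  then show ?thesis unfolding bounded_operator_def using lens_operator_lin by blast
qed

text \<open>For \<open>\<alpha> = 0\<close> the exponential majorant degenerates to a constant,
  which is not integrable over the strip. Instead, a change of variables shows that the energy of
  the image is the energy of \<open>f\<close> over the dilated strip, a subset of the strip; so the
  operator is a contraction.\<close>

lemma lens_operator_bounded_0: "bounded_operator (dirichlet_space 0) (dirichlet_norm 0) lens_operator"
proof -
  have main: "lens_operator f \<in> dirichlet_space 0 \<and> dirichlet_norm 0 (lens_operator f) \<le> 1 * dirichlet_norm 0 f"
    if f: "f \<in> dirichlet_space 0" for f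
  proof -
    note hol = dirichlet_holomorphic[OF f]
    have w: "strip_weight u powr 0 = 1" if "u \<in> strip" for u using strip_weight_pos[OF that] by simp
    have sub: "(*) (of_real \<theta>) ` strip \<subseteq> strip" using strip_scale \<theta> by auto
    let ?E = "\<lambda>f. (\<integral>\<^sup>+u\<in>strip. ennreal (energy_density 0 f u) \<partial>lborel)"
    have "?E (lens_operator f) = (\<integral>\<^sup>+u\<in>strip. ennreal ((cmod (strip_deriv f (of_real \<theta> * u)))\<^sup>2 * (cmod (deriv ((*) (of_real \<theta>)) u))\<^sup>2) \<partial>lborel)"
      by (intro nn_integral_cong)
         (auto simp: indicator_def strip_deriv_lens_operator[OF hol] norm_mult power_mult_distrib mult_ac dest: strip_weight_pos)
    also have "\<dots> = (\<integral>\<^sup>+u\<in>(*) (of_real \<theta>) ` strip. ennreal ((cmod (strip_deriv f u))\<^sup>2) \<partial>lborel)"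
    proof (rule conformal_change_of_variables[OF open_strip])
      show "(*) (of_real \<theta>) holomorphic_on strip" by (intro holomorphic_intros)
      show "inj_on ((*) (complex_of_real \<theta>)) strip" using \<theta> by (simp add: inj_on_def)
      show "continuous_on ((*) (of_real \<theta>) ` strip) (\<lambda>u. (cmod (strip_deriv f u))\<^sup>2)"
        by (intro continuous_intros continuous_on_subset[OF strip_deriv_cont[OF hol] sub])
    qed simp
    also have "\<dots> \<le> ?E f"
      using sub by (intro nn_integral_mono) (auto simp: indicator_def dest: strip_weight_pos)
    finally have le: "?E (lens_operator f) \<le> ?E f" .
    have ff: "?E f < \<infinity>"
      using f unfolding dirichlet_space_iff strip_energy_nn(1)[OF hol] by blast
    have "lens_operator f \<in> dirichlet_space 0"
      unfolding dirichlet_space_iff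
      using iffD2[OF strip_energy_nn(1)[OF lens_operator_holomorphic[OF hol]] le_less_trans[OF le ff]]
        lens_operator_holomorphic[OF hol] lens_operator_outside by blast
    moreover have "enn2real (?E (lens_operator f)) \<le> enn2real (?E f)"
      using le ff by (intro enn2real_mono) auto
    then have "(dirichlet_norm 0 (lens_operator f))\<^sup>2 \<le> (dirichlet_norm 0 f)\<^sup>2"
      unfolding dirichlet_norm_strip[OF order_refl hol]
        dirichlet_norm_strip[OF order_refl lens_operator_holomorphic[OF hol]]
        strip_energy_nn(2)[OF hol] strip_energy_nn(2)[OF lens_operator_holomorphic[OF hol]] lens_operator_0
      by (intro add_left_mono mult_left_mono) auto
    then have "dirichlet_norm 0 (lens_operator f) \<le> dirichlet_norm 0 f"
      by (rule power2_le_imp_le) (rule dirichlet_norm_sq(2)[OF order_refl])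
    ultimately show ?thesis by simp
  qed
  then show ?thesis unfolding bounded_operator_def using lens_operator_lin by blast
qed

subsection \<open>Compactness and its failure\<close>

text \<open>The norm controls derivatives, so Montel's theorem is applied to these and the values at
  \<open>0\<close> are made to converge separately. The limit function is rebuilt as a primitive,
  and dominated convergence of the energy densities upgrades pointwise convergence to convergence in
  norm.\<close>

lemma lens_operator_compact:
  assumes \<alpha>: "0 < \<alpha>"
  shows "compact_operator (dirichlet_space \<alpha>) (dirichlet_norm \<alpha>) lens_operator"
proof -
  have \<alpha>': "0 \<le> \<alpha>" using \<alpha> by simp
  let ?T = lens_operator
  interpret normed_function_space "dirichlet_space \<alpha>" "dirichlet_norm \<alpha>"
    by (rule dirichlet_normed_function_space[OF \<alpha>'])
  obtain D where D: "0 < D" and D': "\<forall>f\<in>dirichlet_space \<alpha>. \<forall>u\<in>strip.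
    (cmod (of_real \<theta> * strip_deriv f (of_real \<theta> * u)))\<^sup>2 * strip_weight u powr \<alpha>
      \<le> D * (dirichlet_norm \<alpha> f)\<^sup>2 * exp (- (\<alpha> * (1 - \<theta>)) * \<bar>Re u\<bar>)"
    using lens_operator_energy_dominated[OF \<alpha>'] by blast
  define b where "b u = D * exp (- (\<alpha> * (1 - \<theta>)) * \<bar>Re u\<bar>)" for u
  have b: "set_integrable lborel strip b" unfolding b_def
    using \<alpha> \<theta> by (intro set_integrable_mult_right exp_abs_Re_integrable) simp
  show ?thesis
  proof (rule compact_operatorI[OF lens_operator_bounded_pos[OF \<alpha>]])
    fix \<sigma> :: "nat \<Rightarrow> cfun"
    assume \<sigma>: "\<forall>n. \<sigma> n \<in> dirichlet_space \<alpha> \<and> dirichlet_norm \<alpha> (\<sigma> n) \<le> 1"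
    then have \<sigma>H: "\<sigma> n \<in> dirichlet_space \<alpha>" and \<sigma>N: "dirichlet_norm \<alpha> (\<sigma> n) \<le> 1" for n by blast+
    note hol = dirichlet_holomorphic[OF \<sigma>H]
    have "bounded (range (\<lambda>n. \<sigma> n 0))"
      using cmod_value_0_le_dirichlet_norm[OF \<alpha>'] \<sigma>N by (intro boundedI[of _ 1]) (auto intro: order_trans)
    from bounded_imp_convergent_subsequence[OF this] obtain c r1
      where r1: "strict_mono r1" "(\<lambda>n. \<sigma> (r1 n) 0) \<longlonglongrightarrow> c" by (auto simp: o_def)
    have bd: "\<exists>B. \<forall>h\<in>range (\<lambda>n. strip_deriv (\<sigma> (r1 n))). \<forall>z\<in>K. cmod (h z) \<le> B"
      if K: "compact K" "K \<subseteq> strip" for K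
    proof -
      obtain \<nu> X where \<nu>: "0 \<le> \<nu>" "\<nu> < 1" and v: "\<And>v. v \<in> K \<Longrightarrow> \<bar>Im v\<bar> \<le> \<nu> * pi / 2" "\<And>v. v \<in> K \<Longrightarrow> \<bar>Re v\<bar> \<le> X"
        using compact_strip_bound[OF K] by metis
      obtain C where C: "0 < C" and C': "\<forall>f\<in>dirichlet_space \<alpha>. \<forall>v. \<bar>Im v\<bar> \<le> \<nu> * pi / 2 \<longrightarrow>
          cmod (strip_deriv f v) \<le> C * exp (\<alpha> * \<bar>Re v\<bar> / 2) * dirichlet_norm \<alpha> f"
        using strip_deriv_bound[OF \<alpha>' \<nu>] by blast
      have "cmod (strip_deriv (\<sigma> n) z) \<le> C * exp (\<alpha> * X / 2) * 1" if z: "z \<in> K" for n z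
      proof -
        have "cmod (strip_deriv (\<sigma> n) z) \<le> C * exp (\<alpha> * \<bar>Re z\<bar> / 2) * dirichlet_norm \<alpha> (\<sigma> n)"
          using C'[rule_format, OF \<sigma>H v(1)[OF z]] .
        also have "\<dots> \<le> C * exp (\<alpha> * X / 2) * 1"
          using C \<alpha> v(2)[OF z] \<sigma>N N_nonneg_all by (intro mult_mono) auto
        finally show ?thesis .
      qed
      then show ?thesis by blast
    qed
    obtain G r2 where G: "G holomorphic_on strip" "strict_mono (r2 :: nat \<Rightarrow> nat)"
      and lim: "\<And>u. u \<in> strip \<Longrightarrow> (\<lambda>n. strip_deriv (\<sigma> (r1 (r2 n))) u) \<longlonglongrightarrow> G u"
    proof (rule Montel[of strip "range (\<lambda>n. strip_deriv (\<sigma> (r1 n)))" "\<lambda>n. strip_deriv (\<sigma> (r1 n))"])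
      show "h holomorphic_on strip" if "h \<in> range (\<lambda>n. strip_deriv (\<sigma> (r1 n)))" for h
        using that holomorphic_strip_deriv[OF hol] by auto
    qed (use open_strip bd in auto)
    obtain P where P: "\<And>u. u \<in> strip \<Longrightarrow> (P has_field_derivative G u) (at u within strip)"
      using holomorphic_convex_primitive'[OF convex_strip open_strip G(1)] by metis
    then have P': "(P has_field_derivative G u) (at u)" if "u \<in> strip" for u
      using that at_within_open[OF that open_strip] by metis
    \<comment> \<open>The primitive of the limit is dilated and normalised to the value
      \<open>c\<close> at \<open>0\<close>: it represents the limit of the images, as the sequence
      itself need not converge in norm.\<close>
    define F where "F u = P (of_real \<theta> * u) - P 0 + c" for u
    have dF: "(F has_field_derivative of_real \<theta> * G (of_real \<theta> * u)) (at u)" if "u \<in> strip" for u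
    proof -
      have "of_real \<theta> * u \<in> strip" using strip_scale \<theta> that by simp
      from DERIV_chain2[OF P'[OF this] DERIV_cmult[OF DERIV_ident]]
      show ?thesis unfolding F_def by (auto intro!: derivative_eq_intros)
    qed
    have F: "F holomorphic_on strip"
      using dF open_strip by (auto simp: holomorphic_on_open)
    define g where "g z = (if z \<in> ball 0 1 then F (strip_of_disk z) else 0)" for z
    note g' = strip_deriv_of_strip[OF F g_def]
    have g0: "g 0 = c" using g'(3) by (simp add: F_def)
    have sg: "strip_deriv g u = of_real \<theta> * G (of_real \<theta> * u)" if "u \<in> strip" for u
      using g'(4)[OF that] DERIV_imp_deriv[OF dF[OF that]] by simp
    define r where "r n = r1 (r2 n)" for n
    have r: "strict_mono r" unfolding r_def using r1(1) G(2) by (auto simp: strict_mono_def)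
    have lim': "(\<lambda>n. of_real \<theta> * strip_deriv (\<sigma> (r n)) (of_real \<theta> * u)) \<longlonglongrightarrow> strip_deriv g u" if "u \<in> strip" for u
      unfolding sg[OF that] r_def using strip_scale[OF \<theta>(1) _ that] \<theta> by (intro tendsto_intros lim) simp
    have dom: "(cmod (of_real \<theta> * strip_deriv (\<sigma> n) (of_real \<theta> * u)))\<^sup>2 * strip_weight u powr \<alpha> \<le> b u" if "u \<in> strip" for n u
    proof -
      have "(dirichlet_norm \<alpha> (\<sigma> n))\<^sup>2 \<le> 1" using \<sigma>N N_nonneg_all by (simp add: power_le_one)
      then have "D * (dirichlet_norm \<alpha> (\<sigma> n))\<^sup>2 * exp (- (\<alpha> * (1 - \<theta>)) * \<bar>Re u\<bar>) \<le> D * 1 * exp (- (\<alpha> * (1 - \<theta>)) * \<bar>Re u\<bar>)"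
        using D by (intro mult_right_mono mult_left_mono) auto
      then show ?thesis using D'[rule_format, OF \<sigma>H that, of n] by (simp add: b_def)
    qed
    \<comment> \<open>The majorant survives the pointwise limit; this places \<open>g\<close> in the
      space.\<close>
    have domg: "energy_density \<alpha> g u \<le> b u" if "u \<in> strip" for u
      by (rule tendsto_upperbound[OF _ always_eventually[OF allI[OF dom[OF that]]]])
         (auto intro!: tendsto_intros lim' that)
    have gH: "g \<in> dirichlet_space \<alpha>"
      by (rule dirichlet_norm_dominated(1)[OF \<alpha>' g'(1,2) b domg])
    let ?h = "\<lambda>n z. ?T (\<sigma> (r n)) z - g z"
    let ?e = "\<lambda>n u. energy_density \<alpha> (?h n) u"
    have TH: "?T (\<sigma> n) holomorphic_on ball 0 1" for n by (rule lens_operator_holomorphic[OF hol])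
    have hh: "?h n holomorphic_on ball 0 1" for n by (intro holomorphic_intros TH g'(1))
    have sh: "strip_deriv (?h n) u = of_real \<theta> * strip_deriv (\<sigma> (r n)) (of_real \<theta> * u) - strip_deriv g u"
      if "u \<in> strip" for n u
      using strip_deriv_lin[OF TH g'(1) that, of 1 "r n" "-1"] strip_deriv_lens_operator[OF hol that] by simp
    have e_le: "?e n u \<le> 4 * b u" if "u \<in> strip" for n u
    proof -
      have "(cmod (strip_deriv (?h n) u))\<^sup>2 \<le> 2 * (cmod (of_real \<theta> * strip_deriv (\<sigma> (r n)) (of_real \<theta> * u)))\<^sup>2 + 2 * (cmod (strip_deriv g u))\<^sup>2"
        using cmod_lin_sq_le[of 1 "of_real \<theta> * strip_deriv (\<sigma> (r n)) (of_real \<theta> * u)" "-1" "strip_deriv g u"]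
        unfolding sh[OF that] by simp
      from mult_right_mono[OF this powr_ge_zero[of "strip_weight u" \<alpha>]]
      show ?thesis using dom[OF that, of "r n"] domg[OF that] by (simp add: distrib_right)
    qed
    have "(\<lambda>n. LINT u|lborel. indicator strip u *\<^sub>R ?e n u) \<longlonglongrightarrow> (LINT u|(lborel :: complex measure). (0::real))"
    proof (rule integral_dominated_convergence)
      show "(\<lambda>u. indicator strip u *\<^sub>R ?e n u) \<in> borel_measurable lborel" for n
        using indicator_continuous_measurable[OF open_strip strip_energy_cont[OF hh]] by simp
      show "integrable lborel (\<lambda>u. indicator strip u *\<^sub>R (4 * b u))"
        using set_integrable_mult_right[OF b, of 4] unfolding set_integrable_def .
      show "AE u in lborel. (\<lambda>n. indicator strip u *\<^sub>R ?e n u) \<longlonglongrightarrow> 0"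
      proof (rule AE_I2)
        fix u :: complex
        show "(\<lambda>n. indicator strip u *\<^sub>R ?e n u) \<longlonglongrightarrow> 0"
        proof (cases "u \<in> strip")
          case True
          have "(\<lambda>n. (cmod (of_real \<theta> * strip_deriv (\<sigma> (r n)) (of_real \<theta> * u) - strip_deriv g u))\<^sup>2 * strip_weight u powr \<alpha>)
             \<longlonglongrightarrow> (cmod (strip_deriv g u - strip_deriv g u))\<^sup>2 * strip_weight u powr \<alpha>"
            by (intro tendsto_intros lim' True)
          then show ?thesis using True by (simp add: sh)
        qed simp
      qed
      show "AE u in lborel. norm (indicator strip u *\<^sub>R ?e n u) \<le> indicator strip u *\<^sub>R (4 * b u)" for n
        using e_le by (intro AE_I2) (auto simp: indicator_def)
    qed simp
    then have lim_e: "(\<lambda>n. LINT u:strip|lborel. ?e n u) \<longlonglongrightarrow> 0"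
      by (simp add: set_lebesgue_integral_def)
    have lim_0: "(\<lambda>n. ?h n 0) \<longlonglongrightarrow> c - c"
      unfolding g0 lens_operator_0 r_def
      by (intro tendsto_diff tendsto_const LIMSEQ_subseq_LIMSEQ[OF r1(2) G(2), unfolded o_def])
    have "(\<lambda>n. (cmod (?h n 0))\<^sup>2 + (\<alpha> + 1) / pi * (LINT u:strip|lborel. ?e n u)) \<longlonglongrightarrow> (cmod (c - c))\<^sup>2 + (\<alpha> + 1) / pi * 0"
      by (rule tendsto_add[OF tendsto_power[OF tendsto_norm[OF lim_0]] tendsto_mult_left[OF lim_e]])
    then have "(\<lambda>n. (dirichlet_norm \<alpha> (?h n))\<^sup>2) \<longlonglongrightarrow> 0"
      unfolding dirichlet_norm_strip[OF \<alpha>' hh] by simp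
    then have "(\<lambda>n. sqrt ((dirichlet_norm \<alpha> (?h n))\<^sup>2)) \<longlonglongrightarrow> sqrt 0"
      by (rule tendsto_real_sqrt)
    then have "(\<lambda>n. dirichlet_norm \<alpha> (?h n)) \<longlonglongrightarrow> 0" using N_nonneg_all by simp
    then show "\<exists>r g. strict_mono r \<and> g \<in> dirichlet_space \<alpha> \<and> (\<lambda>n. dirichlet_norm \<alpha> (\<lambda>z. ?T (\<sigma> (r n)) z - g z)) \<longlonglongrightarrow> 0"
      using r gH by blast
  qed
qed

text \<open>Translations of the strip are automorphisms of the disk, and the Dirichlet integral is
  invariant under them; the images of their restrictions stay apart because translating by \<open>a\<close>
  moves the derivative at \<open>0\<close> from \<open>1/2\<close> to a value of order \<open>exp (- |a|)\<close>.\<close>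

lemma lens_operator_not_compact:
  "\<not> compact_operator (dirichlet_space 0) (dirichlet_norm 0) lens_operator"
proof -
  let ?T = lens_operator
  interpret normed_function_space "dirichlet_space 0" "dirichlet_norm 0"
    by (rule dirichlet_normed_function_space) simp
  \<comment> \<open>Division by \<open>2\<close> brings the norm below \<open>1\<close> and the
    derivative at the centre of each translate to \<open>1 / 4\<close>. Steps of length
    \<open>8\<close> make the other translates contribute at most
    \<open>exp (- 8) \<le> 1 / 8\<close> there, which leaves the gap
    \<open>\<theta> / 8\<close>.\<close>
  define F where "F n u = disk_of_strip (u - of_real (8 * real n)) / 2" for n u
  have shift: "u - of_real x \<in> strip" if "u \<in> strip" for u x using that by (simp add: strip_def)
  have shift': "u + of_real x \<in> strip" if "u \<in> strip" for u x using that by (simp add: strip_def)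
  have dF: "(F n has_field_derivative exp (u - of_real (8 * real n)) / (exp (u - of_real (8 * real n)) + 1)\<^sup>2) (at u)"
    if "u \<in> strip" for n u
  proof -
    have "((\<lambda>u. u - of_real (8 * real n)) has_field_derivative 1) (at u)" by (auto intro!: derivative_eq_intros)
    from DERIV_cdivide[OF DERIV_chain2[OF has_derivative_disk_of_strip[OF shift[OF that]] this], of 2]
    show ?thesis unfolding F_def by simp
  qed
  have F: "F n holomorphic_on strip" for n
    using dF open_strip by (auto simp: holomorphic_on_open)
  define \<sigma> where "\<sigma> n z = (if z \<in> ball 0 1 then F n (strip_of_disk z) else 0)" for n z
  note \<sigma> = strip_deriv_of_strip[OF F \<sigma>_def]
  have s\<sigma>: "strip_deriv (\<sigma> n) u = deriv disk_of_strip (u - of_real (8 * real n)) / 2" if "u \<in> strip" for n u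
    unfolding \<sigma>(4)[OF that] DERIV_imp_deriv[OF dF[OF that]]
      DERIV_imp_deriv[OF has_derivative_disk_of_strip[OF shift[OF that]]] by simp
  have mem: "\<sigma> n \<in> dirichlet_space 0 \<and> dirichlet_norm 0 (\<sigma> n) \<le> 1" for n
  proof -
    let ?s = "\<lambda>u. u - of_real (8 * real n)"
    have im: "?s ` strip = strip"
    proof
      show "?s ` strip \<subseteq> strip" using shift by blast
      show "strip \<subseteq> ?s ` strip"
      proof
        fix u assume "u \<in> strip"
        then show "u \<in> ?s ` strip" using shift'[of u "8 * real n"]
          by (intro image_eqI[where x = "u + of_real (8 * real n)"]) simp_all
      qed
    qed
    have "(\<integral>\<^sup>+u\<in>strip. ennreal (energy_density 0 (\<sigma> n) u) \<partial>lborel)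
       = (\<integral>\<^sup>+u\<in>strip. ennreal ((cmod (deriv disk_of_strip (?s u)))\<^sup>2 / 4 * (cmod (deriv ?s u))\<^sup>2) \<partial>lborel)"
      by (intro nn_integral_cong) (auto simp: indicator_def s\<sigma> norm_divide power_divide dest: strip_weight_pos)
    also have "\<dots> = (\<integral>\<^sup>+u\<in>?s ` strip. ennreal ((cmod (deriv disk_of_strip u))\<^sup>2 / 4) \<partial>lborel)"
    proof (rule conformal_change_of_variables[OF open_strip])
      show "continuous_on (?s ` strip) (\<lambda>u. (cmod (deriv disk_of_strip u))\<^sup>2 / 4)"
        unfolding im by (intro continuous_intros deriv_holomorphic_cont holomorphic_disk_of_strip open_strip) auto
    qed (auto intro!: holomorphic_intros inj_onI)
    also have "\<dots> = (\<integral>\<^sup>+u\<in>strip. ennreal (1 / 4 * (cmod (deriv disk_of_strip u))\<^sup>2) \<partial>lborel)"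
      unfolding im by simp
    also have "\<dots> = (\<integral>\<^sup>+z\<in>disk_of_strip ` strip. ennreal (1 / 4) \<partial>lborel)"
      by (rule conformal_change_of_variables[OF open_strip holomorphic_disk_of_strip inj_disk_of_strip]) auto
    also have "\<dots> = ennreal (1 / 4) * emeasure lborel (ball (0::complex) 1)"
      unfolding disk_of_strip_image by (rule nn_integral_cmult_indicator) simp
    also have "emeasure lborel (ball (0::complex) 1) = ennreal pi"
      by (simp add: emeasure_ball unit_ball_vol_2)
    also have "ennreal (1 / 4) * ennreal pi = ennreal (pi / 4)"
      by (simp add: ennreal_mult'[symmetric])
    finally have E: "(\<integral>\<^sup>+u\<in>strip. ennreal (energy_density 0 (\<sigma> n) u) \<partial>lborel) = ennreal (pi / 4)" .
    have "\<sigma> n \<in> dirichlet_space 0"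
      unfolding dirichlet_space_iff strip_energy_nn(1)[OF \<sigma>(1)] conj_assoc[symmetric] using \<sigma>(1,2) E
      by (metis ennreal_less_top infinity_ennreal_def strip_energy_nn(1))
    moreover have "(dirichlet_norm 0 (\<sigma> n))\<^sup>2 \<le> 1\<^sup>2"
    proof -
      have "(dirichlet_norm 0 (\<sigma> n))\<^sup>2 = (cmod (\<sigma> n 0))\<^sup>2 + 1 / pi * (pi / 4)"
        unfolding dirichlet_norm_strip[OF order_refl \<sigma>(1)] strip_energy_nn(2)[OF \<sigma>(1)] E by simp
      moreover have "cmod (\<sigma> n 0) \<le> 1 / 2"
      proof -
        have "cmod (\<sigma> n 0) = cmod (disk_of_strip (0 - of_real (8 * real n))) / 2"
          unfolding \<sigma>(3) F_def norm_divide by simp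
        then show ?thesis using disk_of_strip_in_ball[OF shift[OF zero_in_strip, of "8 * real n"]] by simp
      qed
      then have "(cmod (\<sigma> n 0))\<^sup>2 \<le> (1 / 2)\<^sup>2" by (intro power_mono) auto
      ultimately show ?thesis by (simp add: power2_eq_square)
    qed
    ultimately show ?thesis by (metis power2_le_imp_le zero_le_one)
  qed
  have far: "\<theta> / 8 \<le> dirichlet_norm 0 (\<lambda>z. ?T (\<sigma> m) z - ?T (\<sigma> n) z)" if mn: "m \<noteq> n" for m n
  proof -
    \<comment> \<open>The point whose dilation by \<open>\<theta>\<close> is the centre of the
      translate with index \<open>m\<close>.\<close>
    define v :: complex where "v = of_real (8 * real m / \<theta>)"
    have v: "v \<in> strip" "of_real \<theta> * v = of_real (8 * real m)" using \<theta> by (auto simp: v_def strip_def)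
    let ?h = "\<lambda>z. ?T (\<sigma> m) z - ?T (\<sigma> n) z"
    have TH: "?T (\<sigma> n) \<in> dirichlet_space 0" for n
      using bounded_operator_mem[OF lens_operator_bounded_0] mem by blast
    have hH: "?h \<in> dirichlet_space 0" by (intro diff_mem TH)
    have sub: "ball v (3 / 2) \<subseteq> strip" unfolding v_def by (rule ball_real_subset_strip)
    have loc: "1\<^sup>2 * 1 * (cmod (strip_deriv ?h v))\<^sup>2 \<le> (dirichlet_norm 0 ?h)\<^sup>2"
    proof (rule strip_deriv_local_bound[OF order_refl hH _ _ sub])
      fix u assume "u \<in> ball v 1"
      then have "u \<in> strip" using sub by auto
      then show "1 \<le> strip_weight u powr 0" using strip_weight_pos[of u] by simp
    qed auto
    then have loc': "cmod (strip_deriv ?h v) \<le> dirichlet_norm 0 ?h"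
      using N_nonneg_all power2_le_imp_le by simp
    have u8: "of_real (8 * real m) \<in> strip" by (simp add: strip_def)
    define d where "d = 8 * real m - 8 * real n"
    have d: "8 \<le> \<bar>d\<bar>"
    proof -
      have "1 \<le> \<bar>real m - real n\<bar>" using mn by linarith
      then show ?thesis unfolding d_def by linarith
    qed
    have "strip_deriv ?h v = 1 * strip_deriv (?T (\<sigma> m)) v + (-1) * strip_deriv (?T (\<sigma> n)) v"
      using strip_deriv_lin[OF dirichlet_holomorphic[OF TH] dirichlet_holomorphic[OF TH] v(1), of 1 m "-1" n] by simp
    also have "\<dots> = of_real \<theta> * (strip_deriv (\<sigma> m) (of_real (8 * real m)) - strip_deriv (\<sigma> n) (of_real (8 * real m)))"
      using strip_deriv_lens_operator[OF \<sigma>(1) v(1)] unfolding v(2) by (simp add: algebra_simps)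
    also have "strip_deriv (\<sigma> m) (of_real (8 * real m)) = 1 / 4"
      using s\<sigma>[OF u8, of m] unfolding diff_self DERIV_imp_deriv[OF has_derivative_disk_of_strip[OF zero_in_strip]]
      by simp
    also have "strip_deriv (\<sigma> n) (of_real (8 * real m)) = of_real (exp d / (exp d + 1)\<^sup>2)"
    proof -
      have "of_real d \<in> strip" by (simp add: strip_def)
      moreover have "of_real (8 * real m) - of_real (8 * real n) = (of_real d :: complex)" by (simp add: d_def)
      ultimately show ?thesis
        using DERIV_imp_deriv[OF has_derivative_disk_of_strip[of "of_real d"]] s\<sigma>[OF u8, of n]
        by (simp add: exp_of_real)
    qed
    finally have sd: "strip_deriv ?h v = of_real (\<theta> * (1 / 4 - exp d / (exp d + 1)\<^sup>2))" by simp
    have "exp d / (exp d + 1)\<^sup>2 \<le> exp (- \<bar>d\<bar>)"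
    proof (cases "0 \<le> d")
      case True
      have "exp d / (exp d + 1)\<^sup>2 \<le> exp d / (exp d)\<^sup>2"
        by (intro divide_left_mono power_mono mult_pos_pos zero_less_power) (auto simp: add_pos_pos)
      also have "\<dots> = exp (- \<bar>d\<bar>)" using True by (simp add: exp_minus power2_eq_square divide_simps)
      finally show ?thesis .
    next
      case False
      have "exp d / (exp d + 1)\<^sup>2 \<le> exp d / 1\<^sup>2"
        by (intro divide_left_mono power_mono mult_pos_pos zero_less_power) (auto simp: add_pos_pos)
      then show ?thesis using False by simp
    qed
    also have "\<dots> \<le> exp (- 8)" using d by simp
    also have "\<dots> \<le> 1 / 8"
      using exp_ge_add_one_self[of 8] by (simp add: exp_minus divide_simps)
    finally have "\<theta> * (1 / 8) \<le> \<theta> * (1 / 4 - exp d / (exp d + 1)\<^sup>2)" using \<theta> by (intro mult_left_mono) auto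
    also have "\<dots> \<le> cmod (strip_deriv ?h v)" unfolding sd norm_of_real by (rule abs_ge_self)
    finally show ?thesis using loc' by simp
  qed
  have "0 < \<theta> / 8" using \<theta> by simp
  from not_compact_operatorI[where \<sigma> = \<sigma>, OF lens_operator_bounded_0 mem this far]
  show ?thesis by blast
qed

subsection \<open>Approximation numbers\<close>

lemma lens_operator_vanishing_bound:
  assumes \<alpha>: "0 < \<alpha>"
  shows "\<exists>h A \<eta>. 0 \<le> A \<and> 0 < \<eta> \<and> \<eta> < 1 \<and> (\<forall>N::nat. \<forall>f\<in>dirichlet_space \<alpha>. f 0 = 0 \<longrightarrow>
    (\<forall>j::int. \<forall>k<N. \<bar>j\<bar> \<le> int N \<longrightarrow> (deriv ^^ k) (strip_deriv f) (of_real (h * of_int j)) = 0) \<longrightarrow>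
      dirichlet_norm \<alpha> (lens_operator f) \<le> A * \<eta> ^ N * dirichlet_norm \<alpha> f)"
proof -
  have \<alpha>': "0 \<le> \<alpha>" using \<alpha> by simp
  \<comment> \<open>\<open>\<nu>\<close> is the midpoint of \<open>\<theta>\<close> and
    \<open>1\<close>, and discs of radius \<open>R\<close> about real points stay in
    \<open>|Im v| \<le> \<nu> * pi / 2\<close>. The spacing \<open>h\<close> is fine enough that a
    point of \<open>|Im v| \<le> \<theta> * pi / 2\<close> is within
    \<open>h / 2 + \<theta> * pi / 2 = q * R\<close> of the nearest node, with
    \<open>q < 1\<close>.\<close>
  define \<nu> where "\<nu> = (1 + \<theta>) / 2"
  define R where "R = \<nu> * pi / 2"
  define h where "h = (1 - \<theta>) * pi / 4"
  define q where "q = (1 + 3 * \<theta>) / (2 + 2 * \<theta>)"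
  define \<beta> where "\<beta> = \<alpha> * (1 - \<theta>)"
  have \<nu>: "0 \<le> \<nu>" "\<nu> < 1" "\<theta> \<le> \<nu>" using \<theta> by (auto simp: \<nu>_def)
  have R: "0 < R" using \<theta> by (simp add: R_def \<nu>_def)
  have h: "0 < h" using \<theta> by (simp add: h_def)
  have q: "0 < q" "q < 1" using \<theta> by (auto simp: q_def divide_simps)
  have qR: "q * R = h / 2 + \<theta> * pi / 2"
    using \<theta> by (simp add: q_def R_def \<nu>_def h_def divide_simps) (simp add: algebra_simps)
  have \<beta>: "0 < \<beta>" using \<alpha> \<theta> by (simp add: \<beta>_def)
  obtain K where K: "0 < K" and K': "\<forall>f\<in>dirichlet_space \<alpha>. \<forall>v. \<bar>Im v\<bar> \<le> \<nu> * pi / 2 \<longrightarrow>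
      cmod (strip_deriv f v) \<le> K * exp (\<alpha> * \<bar>Re v\<bar> / 2) * dirichlet_norm \<alpha> f"
    using strip_deriv_bound[OF \<alpha>' \<nu>(1,2)] by blast
  define K1 where "K1 = K * exp (\<alpha> * (h / 2 + R) / 2) / (1 - q)"
  have K1: "0 < K1" using K q by (simp add: K1_def)
  \<comment> \<open>The worse of two rates for the squared norm: \<open>q^2\<close> near the zeros,
    and beyond \<open>|Re u| = h * N / \<theta>\<close> the decay of half of the exponent
    \<open>\<beta>\<close>. The other half is kept for integrability in \<open>I\<close>.\<close>
  define \<eta>2 where "\<eta>2 = max (q\<^sup>2) (exp (- (\<beta> * h / (2 * \<theta>))))"
  have \<eta>2: "0 < \<eta>2" "\<eta>2 < 1" using q h \<beta> \<theta> by (auto simp: \<eta>2_def less_max_iff_disj power_less_one_iff)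
  define I where "I = (LINT u:strip|lborel. exp (- (\<beta> / 2) * \<bar>Re u\<bar>))"
  have i: "set_integrable lborel strip (\<lambda>u. exp (- (\<beta> / 2) * \<bar>Re u\<bar>))"
    using \<beta> by (intro exp_abs_Re_integrable) simp
  have I: "0 \<le> I" unfolding I_def set_lebesgue_integral_def by (intro Bochner_Integration.integral_nonneg) auto
  define A where "A = sqrt ((\<alpha> + 1) / pi * (4 powr \<alpha> * (K1\<^sup>2 + K\<^sup>2) * I))"
  have A: "0 \<le> A" using \<alpha> I by (simp add: A_def)
  show ?thesis
  proof (rule exI[of _ h], rule exI[of _ A], rule exI[of _ "sqrt \<eta>2"], intro conjI A allI ballI impI)
    show "0 < sqrt \<eta>2" "sqrt \<eta>2 < 1" using \<eta>2 by auto
    fix N :: nat and f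
    assume f: "f \<in> dirichlet_space \<alpha>" and f0: "f 0 = 0"
      and "\<forall>j::int. \<forall>k<N. \<bar>j\<bar> \<le> int N \<longrightarrow> (deriv ^^ k) (strip_deriv f) (of_real (h * of_int j)) = 0"
    then have van: "(deriv ^^ k) (strip_deriv f) (of_real (h * of_int j)) = 0" if "\<bar>j\<bar> \<le> int N" "k < N" for j :: int and k
      using that by blast
    note hol = dirichlet_holomorphic[OF f]
    define n where "n = dirichlet_norm \<alpha> f"
    have n0: "0 \<le> n" unfolding n_def by (rule dirichlet_norm_sq(2)[OF \<alpha>'])
    have near: "cmod (strip_deriv f v) \<le> (K1 * q ^ N * n) * exp (\<alpha> * \<bar>Re v\<bar> / 2)"
      if v: "\<bar>Im v\<bar> \<le> \<theta> * pi / 2" "\<bar>Re v\<bar> \<le> h * real N" for v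
    proof -
      define j where "j = round (Re v / h)"
      define c :: complex where "c = of_real (h * of_int j)"
      have "\<bar>of_int j - Re v / h\<bar> \<le> 1 / 2" unfolding j_def by (rule of_int_round_abs_le)
      then have "h * \<bar>of_int j - Re v / h\<bar> \<le> h * (1 / 2)" using h by (intro mult_left_mono) auto
      moreover have "h * \<bar>of_int j - Re v / h\<bar> = \<bar>h * of_int j - Re v\<bar>"
        using h by (simp add: abs_mult_pos' right_diff_distrib)
      ultimately have jh: "\<bar>h * of_int j - Re v\<bar> \<le> h / 2" by simp
      have "\<bar>Re v / h\<bar> \<le> real N" using v(2) h by (simp add: field_simps)
      then have "- real N \<le> Re v / h" "Re v / h \<le> real N" by linarith+
      \<comment> \<open>Rounding is monotone and fixes integers, so the node nearest to
        \<open>v\<close> is one of the \<open>2 * N + 1\<close> nodes that carry zeros.\<close>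
      then have "\<bar>j\<bar> \<le> int N"
        using round_mono[of "Re v / h" "real N"] round_mono[of "- real N" "Re v / h"]
        unfolding j_def by (simp add: abs_le_iff) (metis minus_le_iff of_int_minus of_int_of_nat_eq round_of_int)
      note van' = van[OF this]
      have cb: "\<bar>Im u\<bar> \<le> \<nu> * pi / 2 \<and> \<bar>Re u\<bar> \<le> \<bar>Re v\<bar> + (h / 2 + R)" if "u \<in> cball c R" for u
      proof -
        have "\<bar>Im (c - u)\<bar> \<le> R" "\<bar>Re (c - u)\<bar> \<le> R"
          using that abs_Im_le_cmod[of "c - u"] abs_Re_le_cmod[of "c - u"] by (auto simp: dist_norm)
        moreover have "\<bar>b\<bar> \<le> \<bar>a\<bar> + \<bar>x - a\<bar> + \<bar>x - b\<bar>" for a b x :: real by arith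
        from this[of "Re u" "Re v" "h * of_int j"]
        have "\<bar>Re u\<bar> \<le> \<bar>Re v\<bar> + \<bar>h * of_int j - Re v\<bar> + \<bar>Re (c - u)\<bar>" by (simp add: c_def)
        ultimately show ?thesis using jh by (simp add: c_def R_def)
      qed
      have sub: "cball c R \<subseteq> strip"
      proof
        fix u assume "u \<in> cball c R"
        then have "\<bar>Im u\<bar> \<le> \<nu> * pi / 2" using cb by blast
        also have "\<dots> < pi / 2" using \<nu> by simp
        finally show "u \<in> strip" by (simp add: strip_def)
      qed
      have holc: "strip_deriv f holomorphic_on cball c R"
        by (rule holomorphic_on_subset[OF holomorphic_strip_deriv[OF hol] sub])
      have "cmod (strip_deriv f v) \<le> (K * exp (\<alpha> * (\<bar>Re v\<bar> + (h / 2 + R)) / 2) * n) * q ^ N / (1 - q)"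
      proof (rule vanishing_order_bound[OF _ _ R _ _ less_imp_le[OF q(1)] q(2), where c = c and g = "strip_deriv f" and v = v])
        show "strip_deriv f holomorphic_on ball c R" using holc ball_subset_cball by (rule holomorphic_on_subset)
        show "continuous_on (cball c R) (strip_deriv f)" by (rule holomorphic_on_imp_continuous_on[OF holc])
        show "(deriv ^^ k) (strip_deriv f) c = 0" if "k < N" for k unfolding c_def by (rule van'[OF that])
        have "cmod (v - c) \<le> \<bar>Re (v - c)\<bar> + \<bar>Im (v - c)\<bar>" by (rule cmod_le)
        also have "\<dots> \<le> h / 2 + \<theta> * pi / 2" using jh v(1) by (simp add: c_def abs_minus_commute)
        finally show "cmod (v - c) \<le> q * R" unfolding qR .
        fix u assume "cmod (c - u) = R"
        then have u: "\<bar>Im u\<bar> \<le> \<nu> * pi / 2" "\<bar>Re u\<bar> \<le> \<bar>Re v\<bar> + (h / 2 + R)" using cb[of u] by (auto simp: dist_norm)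
        have "cmod (strip_deriv f u) \<le> K * exp (\<alpha> * \<bar>Re u\<bar> / 2) * n"
          unfolding n_def by (rule K'[rule_format, OF f u(1)])
        also have "\<dots> \<le> K * exp (\<alpha> * (\<bar>Re v\<bar> + (h / 2 + R)) / 2) * n"
        proof -
          have "\<alpha> * \<bar>Re u\<bar> \<le> \<alpha> * (\<bar>Re v\<bar> + (h / 2 + R))" using u(2) \<alpha>' by (rule mult_left_mono)
          then show ?thesis using K n0 by (intro mult_right_mono mult_left_mono) auto
        qed
        finally show "cmod (strip_deriv f u) \<le> K * exp (\<alpha> * (\<bar>Re v\<bar> + (h / 2 + R)) / 2) * n" .
      qed
      also have "exp (\<alpha> * (\<bar>Re v\<bar> + (h / 2 + R)) / 2) = exp (\<alpha> * (h / 2 + R) / 2) * exp (\<alpha> * \<bar>Re v\<bar> / 2)"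
        unfolding exp_add[symmetric] by (simp add: field_simps)
      finally show ?thesis by (simp add: K1_def mult_ac)
    qed
    define b where "b u = (4 powr \<alpha> * n\<^sup>2 * ((K1\<^sup>2 + K\<^sup>2) * \<eta>2 ^ N)) * exp (- (\<beta> / 2) * \<bar>Re u\<bar>)" for u
    have bi: "set_integrable lborel strip b" unfolding b_def by (rule set_integrable_mult_right[OF i])
    have bb: "energy_density \<alpha> (lens_operator f) u \<le> b u" if u: "u \<in> strip" for u
    proof -
      let ?v = "of_real \<theta> * u"
      have im: "\<bar>Im ?v\<bar> \<le> \<theta> * pi / 2" by (rule abs_Im_scaled_strip[OF u])
      have E1: "exp (- \<beta> * \<bar>Re u\<bar>) = exp (- (\<beta> / 2) * \<bar>Re u\<bar>) * exp (- (\<beta> / 2) * \<bar>Re u\<bar>)"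
        unfolding exp_add[symmetric] by (simp add: field_simps)
      have pw: "0 \<le> \<eta>2 ^ N" using \<eta>2 by simp
      \<comment> \<open>\<open>S\<close> is \<open>K1^2 * q^(2 * N)\<close> on the middle part and
        \<open>K^2\<close> outside. Multiplied by one half of the exponential, either is at most a
        constant times \<open>\<eta>2 ^ N\<close>.\<close>
      have main: "\<exists>S. 0 \<le> S \<and> S * exp (- (\<beta> / 2) * \<bar>Re u\<bar>) \<le> (K1\<^sup>2 + K\<^sup>2) * \<eta>2 ^ N \<and>
         (cmod (of_real \<theta> * strip_deriv f ?v))\<^sup>2 * strip_weight u powr \<alpha> \<le> 4 powr \<alpha> * n\<^sup>2 * S * exp (- \<beta> * \<bar>Re u\<bar>)"
      proof (cases "\<bar>Re ?v\<bar> \<le> h * real N")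
        case True
        have "q ^ N * q ^ N = (q\<^sup>2) ^ N" by (simp add: power2_eq_square power_mult_distrib)
        also have "\<dots> \<le> \<eta>2 ^ N" by (intro power_mono) (auto simp: \<eta>2_def)
        finally have "K1\<^sup>2 * (q ^ N * q ^ N) * exp (- (\<beta> / 2) * \<bar>Re u\<bar>) \<le> K1\<^sup>2 * \<eta>2 ^ N * 1"
          using \<beta> pw by (intro mult_mono) auto
        also have "\<dots> \<le> (K1\<^sup>2 + K\<^sup>2) * \<eta>2 ^ N" using pw by (simp add: distrib_right)
        finally have 1: "K1\<^sup>2 * (q ^ N * q ^ N) * exp (- (\<beta> / 2) * \<bar>Re u\<bar>) \<le> (K1\<^sup>2 + K\<^sup>2) * \<eta>2 ^ N" .
        have "0 \<le> K1 * q ^ N * n" using K1 q n0 by simp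
        from lens_operator_energy_bound[OF \<alpha>' u this near[OF im True]] 1 show ?thesis
          using q K1 by (intro exI[of _ "K1\<^sup>2 * (q ^ N * q ^ N)"]) (simp add: \<beta>_def power_mult_distrib power2_eq_square mult_ac)
      next
        case False
        have "h * real N / \<theta> \<le> \<bar>Re u\<bar>" using False \<theta> by (simp add: abs_mult field_simps)
        then have "\<beta> / 2 * (h * real N / \<theta>) \<le> \<beta> / 2 * \<bar>Re u\<bar>" using \<beta> by (intro mult_left_mono) auto
        then have "exp (- (\<beta> / 2) * \<bar>Re u\<bar>) \<le> exp (real N * (- (\<beta> * h / (2 * \<theta>))))" by (simp add: mult_ac)
        also have "\<dots> \<le> \<eta>2 ^ N" unfolding exp_of_nat_mult by (intro power_mono) (auto simp: \<eta>2_def)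
        finally have "K\<^sup>2 * exp (- (\<beta> / 2) * \<bar>Re u\<bar>) \<le> K\<^sup>2 * \<eta>2 ^ N" by (intro mult_left_mono) auto
        also have "\<dots> \<le> (K1\<^sup>2 + K\<^sup>2) * \<eta>2 ^ N" using pw by (simp add: distrib_right)
        finally have 1: "K\<^sup>2 * exp (- (\<beta> / 2) * \<bar>Re u\<bar>) \<le> (K1\<^sup>2 + K\<^sup>2) * \<eta>2 ^ N" .
        have "\<bar>Im ?v\<bar> \<le> \<nu> * pi / 2" using im \<nu>(3) by (smt (verit) mult_right_mono pi_gt_zero divide_right_mono)
        from K'[rule_format, OF f this] have "cmod (strip_deriv f ?v) \<le> (K * n) * exp (\<alpha> * \<bar>Re ?v\<bar> / 2)"
          by (simp add: n_def mult_ac)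
        from lens_operator_energy_bound[OF \<alpha>' u _ this] 1 show ?thesis
          using K n0 by (intro exI[of _ "K\<^sup>2"]) (simp add: \<beta>_def power_mult_distrib mult_ac)
      qed
      then obtain S where S: "0 \<le> S" "S * exp (- (\<beta> / 2) * \<bar>Re u\<bar>) \<le> (K1\<^sup>2 + K\<^sup>2) * \<eta>2 ^ N"
         "(cmod (of_real \<theta> * strip_deriv f ?v))\<^sup>2 * strip_weight u powr \<alpha> \<le> 4 powr \<alpha> * n\<^sup>2 * S * exp (- \<beta> * \<bar>Re u\<bar>)"
        by blast
      have "4 powr \<alpha> * n\<^sup>2 * S * exp (- \<beta> * \<bar>Re u\<bar>)
          = (4 powr \<alpha> * n\<^sup>2 * (S * exp (- (\<beta> / 2) * \<bar>Re u\<bar>))) * exp (- (\<beta> / 2) * \<bar>Re u\<bar>)"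
        unfolding E1 by simp
      also have "\<dots> \<le> b u" unfolding b_def using S(2) by (intro mult_right_mono mult_left_mono) auto
      finally show ?thesis using S(3) strip_deriv_lens_operator[OF hol u] by simp
    qed
    have "(dirichlet_norm \<alpha> (lens_operator f))\<^sup>2 \<le> (cmod (lens_operator f 0))\<^sup>2 + (\<alpha> + 1) / pi * (LINT u:strip|lborel. b u)"
      by (rule dirichlet_norm_dominated(2)[OF \<alpha>' lens_operator_holomorphic[OF hol] lens_operator_outside bi bb])
    also have "(LINT u:strip|lborel. b u) = 4 powr \<alpha> * n\<^sup>2 * ((K1\<^sup>2 + K\<^sup>2) * \<eta>2 ^ N) * I"
      unfolding b_def I_def by (rule set_integral_mult_right)
    also have "(cmod (lens_operator f 0))\<^sup>2 = 0" using f0 lens_operator_0 by simp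
    also have "0 + (\<alpha> + 1) / pi * (4 powr \<alpha> * n\<^sup>2 * ((K1\<^sup>2 + K\<^sup>2) * \<eta>2 ^ N) * I) = A\<^sup>2 * \<eta>2 ^ N * n\<^sup>2"
      using \<alpha> I by (simp add: A_def mult_ac)
    also have "\<eta>2 ^ N = (sqrt \<eta>2 ^ N)\<^sup>2" using \<eta>2 by (simp add: power_mult[symmetric] mult.commute[of N 2]) (simp add: power_mult)
    finally have "(dirichlet_norm \<alpha> (lens_operator f))\<^sup>2 \<le> (A * sqrt \<eta>2 ^ N * n)\<^sup>2"
      by (simp add: power_mult_distrib)
    then show "dirichlet_norm \<alpha> (lens_operator f) \<le> A * sqrt \<eta>2 ^ N * dirichlet_norm \<alpha> f"
      unfolding n_def[symmetric] using A \<eta>2 n0 by (rule_tac power2_le_imp_le) auto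
  qed
qed

lemma lens_operator_approx_step:
  assumes \<alpha>: "0 < \<alpha>"
  shows "\<exists>A \<eta>. 0 \<le> A \<and> 0 < \<eta> \<and> \<eta> < 1 \<and> (\<forall>N n::nat. 1 + (2 * N + 1) * N < n \<longrightarrow>
    approx_number (dirichlet_space \<alpha>) (dirichlet_norm \<alpha>) n lens_operator \<le> 2 * (A * \<eta> ^ N))"
proof -
  have \<alpha>': "0 \<le> \<alpha>" using \<alpha> by simp
  interpret quadratic_normed_space "dirichlet_space \<alpha>" "dirichlet_norm \<alpha>"
    by (rule dirichlet_quadratic_normed_space[OF \<alpha>'])
  obtain h A \<eta> where A: "0 \<le> A" and \<eta>: "0 < \<eta>" "\<eta> < 1"
    and bound: "\<forall>N::nat. \<forall>f\<in>dirichlet_space \<alpha>. f 0 = 0 \<longrightarrow>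
    (\<forall>j::int. \<forall>k<N. \<bar>j\<bar> \<le> int N \<longrightarrow> (deriv ^^ k) (strip_deriv f) (of_real (h * of_int j)) = 0) \<longrightarrow>
      dirichlet_norm \<alpha> (lens_operator f) \<le> A * \<eta> ^ N * dirichlet_norm \<alpha> f"
    using lens_operator_vanishing_bound[OF \<alpha>] by blast
  have "approx_number (dirichlet_space \<alpha>) (dirichlet_norm \<alpha>) n lens_operator \<le> 2 * (A * \<eta> ^ N)"
    if n: "1 + (2 * N + 1) * N < n" for N n
  proof -
    \<comment> \<open>Index \<open>0\<close> is the value at the origin. The others encode a node
      and an order of differentiation below \<open>N\<close> as quotient and remainder of
      \<open>i - 1\<close> by \<open>N\<close>; subtracting \<open>N\<close> centres the
      \<open>2 * N + 1\<close> nodes at \<open>0\<close>.\<close>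
    define l where "l i = (if i = 0 then (\<lambda>f. f 0) else (\<lambda>f. (deriv ^^ ((i - 1) mod N)) (strip_deriv f)
        (of_real (h * of_int (int ((i - 1) div N) - int N)))))" for i :: nat
    have lf: "functional (l i)" for i
      unfolding l_def
      by (cases "i = 0")
         (simp_all only: simp_thms if_True if_False value_0_functional[OF \<alpha>'] higher_strip_deriv_functional[OF \<alpha>'])
    show ?thesis
    proof (rule approx_number_upper[where l = l, OF lens_operator_bounded_pos[OF \<alpha>] lf n])
      show "0 \<le> A * \<eta> ^ N" using A \<eta> by simp
      fix f assume f: "f \<in> dirichlet_space \<alpha>" and lz: "\<And>i. i < 1 + (2 * N + 1) * N \<Longrightarrow> l i f = 0"
      have f0: "f 0 = 0" using lz[of 0] by (simp add: l_def)
      have van: "(deriv ^^ k) (strip_deriv f) (of_real (h * of_int j)) = 0" if j: "\<bar>j\<bar> \<le> int N" and k: "k < N" for j k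
      proof -
        define a where "a = nat (j + int N)"
        have a: "a \<le> 2 * N" "int a - int N = j" using j by (auto simp: a_def)
        have "a * N + k < (2 * N + 1) * N"
        proof -
          have "a * N \<le> 2 * N * N" using a(1) by (rule mult_right_mono) simp
          then have "a * N + k < 2 * N * N + N" using k by (rule add_le_less_mono)
          then show ?thesis by (simp only: distrib_right mult_1)
        qed
        then have "l (1 + (a * N + k)) f = 0" by (intro lz) simp
        moreover have "(a * N + k) mod N = k" "(a * N + k) div N = a" using k by auto
        ultimately show ?thesis by (simp add: l_def a(2))
      qed
      show "dirichlet_norm \<alpha> (lens_operator f) \<le> A * \<eta> ^ N * dirichlet_norm \<alpha> f"
        using bound[rule_format, OF f f0 van] by blast
    qed
  qed
  then show ?thesis using A \<eta> by blast
qed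

lemma lens_operator_approx_upper:
  assumes \<alpha>: "0 < \<alpha>"
  shows "\<exists>b>0. \<exists>C>0. \<forall>n\<ge>1.
    approx_number (dirichlet_space \<alpha>) (dirichlet_norm \<alpha>) n lens_operator \<le> C * exp (- b * sqrt (real n))"
proof -
  let ?a = "\<lambda>n. approx_number (dirichlet_space \<alpha>) (dirichlet_norm \<alpha>) n lens_operator"
  obtain A \<eta> where A: "0 \<le> A" and \<eta>: "0 < \<eta>" "\<eta> < 1"
    and step: "\<forall>N n::nat. 1 + (2 * N + 1) * N < n \<longrightarrow> ?a n \<le> 2 * (A * \<eta> ^ N)"
    using lens_operator_approx_step[OF \<alpha>] by blast
  define L where "L = - ln \<eta>"
  have L: "0 < L" using \<eta> by (simp add: L_def)
  define b where "b = L / 3"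
  \<comment> \<open>The first summand pays for the rounding down in \<open>N\<close>, the second for
    \<open>n = 1\<close>, where the count of conditions leaves no room, and the last makes
    \<open>C\<close> positive.\<close>
  define C where "C = 2 * A * exp L + \<bar>?a 1\<bar> * exp b + 1"
  have C: "0 < C" using A by (simp add: C_def add_nonneg_pos)
  have "?a n \<le> C * exp (- b * sqrt (real n))" if n: "1 \<le> n" for n
  proof (cases "n = 1")
    case True
    have "?a 1 \<le> (\<bar>?a 1\<bar> * exp b) * exp (- b)"
      by (simp add: mult.assoc exp_add[symmetric])
    also have "\<dots> \<le> C * exp (- b)" using A by (intro mult_right_mono) (auto simp: C_def)
    finally show ?thesis using True by simp
  next
    case False
    then have n2: "2 \<le> n" using n by simp
    \<comment> \<open>The divisor \<open>3\<close> gives \<open>9 * N^2 \<le> n\<close>, which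
      leaves room for the \<open>1 + (2 * N + 1) * N\<close> conditions once
      \<open>n \<ge> 2\<close>; it reappears in \<open>b = L / 3\<close>.\<close>
    define N where "N = nat \<lfloor>sqrt (real n) / 3\<rfloor>"
    have N1: "real N \<le> sqrt (real n) / 3" unfolding N_def by (rule of_nat_floor) simp
    have N2: "sqrt (real n) / 3 - 1 \<le> real N" unfolding N_def by linarith
    have "(real N)\<^sup>2 \<le> (sqrt (real n) / 3)\<^sup>2" using N1 by (intro power_mono) auto
    then have "9 * (real N)\<^sup>2 \<le> real n" by (simp add: power_divide)
    then have "real (9 * (N * N)) \<le> real n" by (simp add: power2_eq_square)
    then have N9: "9 * (N * N) \<le> n" by (simp only: of_nat_le_iff)
    have "1 + (2 * N + 1) * N < n"
    proof (cases "N = 0")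
      case False
      then have "1 \<le> N * N" "N \<le> N * N" by (simp_all add: Suc_leI)
      moreover have "1 + (2 * N + 1) * N = 1 + (2 * (N * N) + N)" by (simp only: distrib_right mult_1 mult.assoc)
      ultimately show ?thesis using N9 by linarith
    qed (use n2 in simp)
    then have "?a n \<le> 2 * (A * \<eta> ^ N)" using step by blast
    also have "\<eta> ^ N = exp (- (L * real N))"
      using \<eta> by (simp add: L_def exp_of_nat2_mult)
    also have "\<dots> \<le> exp (L - b * sqrt (real n))"
      using mult_left_mono[OF N2 less_imp_le[OF L]] by (simp add: b_def algebra_simps)
    also have "\<dots> = exp L * exp (- b * sqrt (real n))" by (simp add: exp_diff exp_minus divide_inverse)
    finally have "?a n \<le> (2 * A * exp L) * exp (- b * sqrt (real n))" using A by (simp add: mult_left_mono mult.assoc)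
    also have "\<dots> \<le> C * exp (- b * sqrt (real n))" by (intro mult_right_mono) (auto simp: C_def)
    finally show ?thesis .
  qed
  then show ?thesis using L C by (intro exI[of _ b] conjI exI[of _ C]) (auto simp: b_def)
qed

text \<open>The extremal subspace is spanned by the exponentials \<open>exp (i k u / sqrt n)\<close> of the strip,
  \<open>1 \<le> k \<le> n\<close>: their growth over the width of the strip and the decay of the weight over one period
  both cost only a factor \<open>exp (O(sqrt n))\<close>.\<close>

definition strip_exponential :: "nat \<Rightarrow> nat \<Rightarrow> complex \<Rightarrow> complex" where
  "strip_exponential n k u = exp (\<i> * of_real (real (Suc k) / sqrt (real n)) * u)"

lemma strip_exponential_sum:
  fixes n :: nat
  defines "f \<equiv> \<lambda>a z. \<Sum>k<n. a k * (if z \<in> ball 0 1 then strip_exponential n k (strip_of_disk z) else 0)"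
    and "d \<equiv> \<lambda>a k. a k * (\<i> * of_real (real (Suc k) / sqrt (real n)))"
  shows "f a holomorphic_on ball 0 1" "\<And>z. z \<notin> ball 0 1 \<Longrightarrow> f a z = 0" "f a 0 = (\<Sum>k<n. a k)"
    "\<And>u. u \<in> strip \<Longrightarrow> strip_deriv (f a) u = (\<Sum>k<n. d a k * strip_exponential n k u)"
proof -
  define F where "F u = (\<Sum>k<n. a k * strip_exponential n k u)" for u
  have F: "F holomorphic_on strip" unfolding F_def strip_exponential_def by (intro holomorphic_intros)
  have f: "f a z = (if z \<in> ball 0 1 then F (strip_of_disk z) else 0)" for z
    by (simp add: f_def F_def)
  note * = strip_deriv_of_strip[OF F f]
  show "f a holomorphic_on ball 0 1" "\<And>z. z \<notin> ball 0 1 \<Longrightarrow> f a z = 0" by (rule *)+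
  show "f a 0 = (\<Sum>k<n. a k)" unfolding *(3) by (simp add: F_def strip_exponential_def)
  fix u assume u: "u \<in> strip"
  have "(F has_field_derivative (\<Sum>k<n. d a k * strip_exponential n k u)) (at u)"
    unfolding F_def strip_exponential_def d_def by (auto intro!: derivative_eq_intros sum.cong)
  then show "strip_deriv (f a) u = (\<Sum>k<n. d a k * strip_exponential n k u)"
    using *(4)[OF u] DERIV_imp_deriv by metis
qed

lemma cmod_strip_exponential_le:
  assumes n: "1 \<le> n" and k: "k < n" and u: "u \<in> strip"
  shows "cmod (strip_exponential n k u) \<le> exp (2 * sqrt (real n))"
proof -
  have "- Im u \<le> 2" using u pi_less_4 by (auto simp: strip_def abs_less_iff)
  then have "real (Suc k) / sqrt (real n) * - Im u \<le> real (Suc k) / sqrt (real n) * 2"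
    by (intro mult_left_mono) auto
  also have "\<dots> \<le> real n / sqrt (real n) * 2"
    using k by (intro mult_right_mono divide_right_mono) auto
  also have "\<dots> = 2 * sqrt (real n)" by (simp add: real_div_sqrt)
  finally show ?thesis by (simp add: strip_exponential_def)
qed

text \<open>The norms before and after composition are both compared with the largest coefficient
  \<open>B\<close> of the derivative. The former is at most a constant times
  \<open>exp (5 * s) * B\<close>. For the latter, the derivative has modulus at least
  \<open>B\<close> at some point of a period, and the local bound at the corresponding point of the
  strip costs only the weight there.\<close>

lemma lens_operator_approx_lower:
  assumes \<alpha>: "0 < \<alpha>"
  shows "\<exists>b>0. \<exists>c>0. \<forall>n\<ge>1.
    c * exp (- b * sqrt (real n)) \<le> approx_number (dirichlet_space \<alpha>) (dirichlet_norm \<alpha>) n lens_operator"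
proof -
  have \<alpha>': "0 \<le> \<alpha>" using \<alpha> by simp
  interpret quadratic_normed_space "dirichlet_space \<alpha>" "dirichlet_norm \<alpha>"
    by (rule dirichlet_quadratic_normed_space[OF \<alpha>'])
  note bdd = lens_operator_bounded_pos[OF \<alpha>]
  define I where "I = (LINT u:strip|lborel. exp (- \<alpha> * \<bar>Re u\<bar>))"
  have i: "set_integrable lborel strip (\<lambda>u. exp (- \<alpha> * \<bar>Re u\<bar>))"
    using \<alpha> by (intro exp_abs_Re_integrable) simp
  have I: "0 \<le> I" unfolding I_def set_lebesgue_integral_def by (intro Bochner_Integration.integral_nonneg) auto
  define L where "L = 1 + (\<alpha> + 1) / pi * (4 powr \<alpha> * I)"
  have L: "1 \<le> L" using I \<alpha> by (simp add: L_def)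
  define c1 where "c1 = (cos 1 * exp (- 1)) powr (\<alpha> / 2)"
  have cos1: "0 < cos (1::real)" using pi_gt3 by (intro cos_gt_zero_pi) auto
  have c1: "0 < c1" using cos1 by (simp add: c1_def)
  \<comment> \<open>Of the \<open>5\<close>, a share of \<open>2\<close> covers the growth of the
    exponentials across the strip and \<open>3\<close> covers polynomial factors in
    \<open>n\<close>. The other term is the square root of the weighted factor at distance up to
    \<open>2 * pi * s / \<theta>\<close>.\<close>
  define b where "b = 5 + \<alpha> * pi / \<theta>"
  define c where "c = \<theta> * c1 / sqrt L"
  have c: "0 < c" using c1 \<theta> L by (simp add: c_def)
  have "c * exp (- b * sqrt (real n)) \<le> approx_number (dirichlet_space \<alpha>) (dirichlet_norm \<alpha>) n lens_operator"
    if n: "1 \<le> n" for n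
  proof -
    define s where "s = sqrt (real n)"
    have s: "1 \<le> s" "s * s = real n" using n by (auto simp: s_def)
    define e where "e k z = (if z \<in> ball 0 1 then strip_exponential n k (strip_of_disk z) else 0)" for k z
    note sum = strip_exponential_sum[where n = n, folded e_def s_def]
    have mem: "(\<lambda>z. \<Sum>k<n. a k * e k z) \<in> dirichlet_space \<alpha> \<and>
        dirichlet_norm \<alpha> (\<lambda>z. \<Sum>k<n. a k * e k z) \<le> sqrt L * exp (5 * s) * B"
      if B: "\<And>k. k < n \<Longrightarrow> cmod (a k * (\<i> * of_real (real (Suc k) / s))) \<le> B" for a B
    proof -
      let ?f = "\<lambda>z. \<Sum>k<n. a k * e k z"
      have B0: "0 \<le> B" using B[of 0] n order_trans[OF norm_ge_zero] by auto
      define M where "M = real n * B * exp (2 * s)"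
      have M0: "0 \<le> M" using B0 by (simp add: M_def)
      have dM: "cmod (strip_deriv ?f u) \<le> M" if u: "u \<in> strip" for u
      proof -
        have "cmod (strip_deriv ?f u) \<le> (\<Sum>k<n. cmod (a k * (\<i> * of_real (real (Suc k) / s)) * strip_exponential n k u))"
          unfolding sum(4)[OF u] by (rule norm_sum)
        also have "\<dots> \<le> (\<Sum>k<n. B * exp (2 * s))"
          unfolding norm_mult[of "_ * (_ * _)"] using B B0 cmod_strip_exponential_le[OF n _ u]
          by (intro sum_mono mult_mono) (auto simp: s_def)
        finally show ?thesis by (simp add: M_def)
      qed
      \<comment> \<open>The shift \<open>Suc k\<close> excludes the frequency zero: all frequencies
        are at least \<open>1 / s\<close>, so the coefficients of the derivative control those of
        the function.\<close>
      have "cmod (a k) \<le> s * B" if k: "k < n" for k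
      proof -
        have "cmod (a k) * 1 \<le> cmod (a k) * real (Suc k)" by (intro mult_left_mono) auto
        also have "\<dots> = s * cmod (a k * (\<i> * of_real (real (Suc k) / s)))"
          unfolding norm_mult norm_ii norm_of_real using s by simp
        also have "\<dots> \<le> s * B" using B[OF k] s by (intro mult_left_mono) auto
        finally show ?thesis by simp
      qed
      then have "cmod (?f 0) \<le> (\<Sum>k<n. s * B)"
        unfolding sum(3) by (intro order_trans[OF norm_sum] sum_mono) auto
      then have f0: "cmod (?f 0) \<le> s * real n * B" by (simp add: mult_ac)
      have se: "s \<le> exp s" using exp_ge_add_one_self[of s] by linarith
      have poly: "s * real n \<le> exp (3 * s)"
      proof -
        have "s * real n = s ^ 3" using s(2) by (simp add: power3_eq_cube)
        also have "\<dots> \<le> exp s ^ 3" using se s by (intro power_mono) auto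
        finally show ?thesis by (simp add: exp_of_nat_mult[symmetric])
      qed
      have E: "exp (5 * s) = exp (3 * s) * exp (2 * s)" unfolding exp_add[symmetric] by simp
      have f0': "cmod (?f 0) \<le> exp (5 * s) * B"
      proof -
        have "s * real n * B \<le> exp (3 * s) * B" using poly B0 by (rule mult_right_mono)
        also have "\<dots> \<le> exp (5 * s) * B" using s B0 by (intro mult_right_mono) auto
        finally show ?thesis using f0 by linarith
      qed
      have ME: "M \<le> exp (5 * s) * B"
      proof -
        have "real n * 1 \<le> real n * s" using s by (intro mult_left_mono) auto
        then have "real n \<le> exp (3 * s)" using poly by (simp add: mult.commute)
        then have "real n * (B * exp (2 * s)) \<le> exp (3 * s) * (B * exp (2 * s))" using B0 by (intro mult_right_mono) auto
        then show ?thesis unfolding M_def E by (simp only: mult_ac)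
      qed
      have dom: "energy_density \<alpha> ?f u \<le> (M\<^sup>2 * 4 powr \<alpha>) * exp (- \<alpha> * \<bar>Re u\<bar>)"
        if u: "u \<in> strip" for u
      proof -
        have "energy_density \<alpha> ?f u \<le> M\<^sup>2 * (4 powr \<alpha> * exp (- \<alpha> * \<bar>Re u\<bar>))"
          using dM[OF u] strip_weight_powr_le[OF \<alpha>' u] by (intro mult_mono power_mono) auto
        then show ?thesis by simp
      qed
      note dn = dirichlet_norm_dominated[OF \<alpha>' sum(1,2) set_integrable_mult_right[OF i] dom]
      have "(dirichlet_norm \<alpha> ?f)\<^sup>2 \<le> (cmod (?f 0))\<^sup>2 + (\<alpha> + 1) / pi * (M\<^sup>2 * 4 powr \<alpha> * I)"
        using dn(2) unfolding I_def set_integral_mult_right .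
      also have "\<dots> \<le> (exp (5 * s) * B)\<^sup>2 + (\<alpha> + 1) / pi * ((exp (5 * s) * B)\<^sup>2 * 4 powr \<alpha> * I)"
        using f0' ME M0 \<alpha> I by (intro add_mono mult_left_mono mult_right_mono power_mono) auto
      also have "\<dots> = (sqrt L * exp (5 * s) * B)\<^sup>2"
        using L by (simp add: power_mult_distrib) (simp add: L_def algebra_simps)
      finally have "dirichlet_norm \<alpha> ?f \<le> sqrt L * exp (5 * s) * B"
        by (rule power2_le_imp_le) (use L B0 in auto)
      then show ?thesis using dn(1) by blast
    qed
    have eH: "e k \<in> dirichlet_space \<alpha>" if k: "k < n" for k
    proof -
      define \<delta> :: "nat \<Rightarrow> complex" where "\<delta> j = (if j = k then 1 else 0)" for j
      have "e k = (\<lambda>z. \<Sum>j<n. \<delta> j * e j z)" using k by (simp add: \<delta>_def if_distrib[where f = "\<lambda>x. x * _"] cong: if_cong)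
      moreover have "(\<lambda>z. \<Sum>j<n. \<delta> j * e j z) \<in> dirichlet_space \<alpha>"
      proof (rule conjunct1[OF mem])
        fix j assume "j < n"
        then have "cmod (\<delta> j) * (1 * (real (Suc j) / s)) \<le> 1 * (1 * (real (Suc n) / s))"
          using s by (intro mult_mono divide_right_mono) (auto simp: \<delta>_def)
        then show "cmod (\<delta> j * (\<i> * of_real (real (Suc j) / s))) \<le> 1 * (1 * (real (Suc n) / s))"
          unfolding norm_mult norm_ii norm_of_real using s by simp
      qed
      ultimately show ?thesis by simp
    qed
    show ?thesis
    proof (rule approx_number_lower[OF bdd n eH])
      fix a :: "nat \<Rightarrow> complex" assume nz: "\<exists>k<n. a k \<noteq> 0"
      let ?f = "\<lambda>z. \<Sum>k<n. a k * e k z"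
      define d where "d k = a k * (\<i> * of_real (real (Suc k) / s))" for k
      define B where "B = Max ((\<lambda>k. cmod (d k)) ` {..<n})"
      have fin: "finite ((\<lambda>k. cmod (d k)) ` {..<n})" "(\<lambda>k. cmod (d k)) ` {..<n} \<noteq> {}" using n by (auto simp: lessThan_empty_iff)
      have dB: "cmod (d k) \<le> B" if "k < n" for k unfolding B_def using that fin(1) by (intro Max_ge) auto
      have "B \<in> (\<lambda>k. cmod (d k)) ` {..<n}" unfolding B_def by (rule Max_in[OF fin])
      then obtain k0 where k0: "k0 < n" "B = cmod (d k0)" by auto
      have B0: "0 < B"
      proof -
        obtain k where k: "k < n" "a k \<noteq> 0" using nz by blast
        then have "0 < cmod (d k)" unfolding d_def norm_mult norm_ii norm_of_real using s by simp
        then show ?thesis using dB[OF k(1)] by linarith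
      qed
      note fB = mem[of a B, folded d_def, OF dB]
      have fH: "?f \<in> dirichlet_space \<alpha>" and fN: "dirichlet_norm \<alpha> ?f \<le> sqrt L * exp (5 * s) * B"
        using fB by blast+
      obtain j where j: "j < n" "B \<le> cmod (\<Sum>k<n. d k * (exp (2 * of_real pi * \<i> * of_nat j / of_nat n)) ^ k)"
        using exists_large_value_at_root_of_unity[OF k0(1), of d] k0(2) by auto
      \<comment> \<open>The sum has period \<open>2 * pi * s\<close>. At the fraction
        \<open>j / n\<close> of it, the exponential with index \<open>k\<close> equals
        \<open>\<omega> ^ Suc k\<close> for the root of unity \<open>\<omega>\<close>, and the
        derivative becomes a polynomial evaluated at \<open>\<omega>\<close>.\<close>
      define x where "x = 2 * pi * real j * s / real n"
      have x: "0 \<le> x" "x \<le> 2 * pi * s"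
      proof -
        show "0 \<le> x" using s by (simp add: x_def)
        have "real j * (2 * pi * s) \<le> real n * (2 * pi * s)" using j(1) s by (intro mult_right_mono) auto
        then show "x \<le> 2 * pi * s" using n by (simp add: x_def divide_le_eq mult_ac)
      qed
      define \<omega> where "\<omega> = exp (2 * of_real pi * \<i> * of_nat j / of_nat n)"
      have expo: "strip_exponential n k (of_real x) = \<omega> * \<omega> ^ k" for k
      proof -
        have "\<i> * of_real (real (Suc k) / s) * of_real x = of_nat (Suc k) * (2 * of_real pi * \<i> * of_nat j / of_nat n)"
        proof -
          have "real (Suc k) / s * x = real (Suc k) * (2 * pi * real j / real n)" using s by (simp add: x_def)
          then have "(of_real (real (Suc k) / s) * of_real x :: complex) = of_real (real (Suc k) * (2 * pi * real j / real n))"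
            by (simp only: of_real_mult[symmetric])
          then show ?thesis
            unfolding mult.assoc[of \<i> "of_real (real (Suc k) / s)"] by (simp only:) (simp add: mult_ac del: of_nat_Suc)
        qed
        then have "strip_exponential n k (of_real x) = \<omega> ^ Suc k"
          unfolding strip_exponential_def s_def[symmetric] \<omega>_def exp_of_nat_mult[symmetric] by simp
        then show ?thesis by simp
      qed
      have xs: "of_real x \<in> strip" by (simp add: strip_def)
      have "strip_deriv ?f (of_real x) = \<omega> * (\<Sum>k<n. d k * \<omega> ^ k)"
        unfolding sum(4)[OF xs] expo by (simp add: d_def sum_distrib_left mult_ac)
      moreover have "cmod \<omega> = 1" by (simp add: \<omega>_def)
      ultimately have large: "B \<le> cmod (strip_deriv ?f (of_real x))"
        using j(2) by (simp add: norm_mult \<omega>_def)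
      define v :: complex where "v = of_real (x / \<theta>)"
      have v: "v \<in> strip" "of_real \<theta> * v = of_real x" using \<theta> by (auto simp: v_def strip_def)
      have sub: "ball v (3 / 2) \<subseteq> strip" unfolding v_def by (rule ball_real_subset_strip)
      define m where "m = (cos 1 * exp (- (2 * pi * s / \<theta>) - 1)) powr \<alpha>"
      have m0: "0 < m" using cos1 by (simp add: m_def)
      have TfH: "lens_operator ?f \<in> dirichlet_space \<alpha>" by (rule bounded_operator_mem[OF bdd fH])
      have loc: "1\<^sup>2 * m * (cmod (strip_deriv (lens_operator ?f) v))\<^sup>2 \<le> (dirichlet_norm \<alpha> (lens_operator ?f))\<^sup>2"
      proof (rule strip_deriv_local_bound[OF \<alpha>' TfH _ _ sub m0])
        fix u assume u: "u \<in> ball v 1"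
        then have us: "u \<in> strip" using sub by auto
        have iu: "\<bar>Im u\<bar> < 1" "\<bar>x / \<theta> - Re u\<bar> < 1"
          using u abs_Im_le_cmod[of "v - u"] abs_Re_le_cmod[of "v - u"] by (auto simp: dist_norm v_def)
        have "x / \<theta> \<le> 2 * pi * s / \<theta>" using x(2) \<theta> by (intro divide_right_mono) auto
        moreover have "0 \<le> x / \<theta>" using x(1) \<theta> by simp
        ultimately have "- (2 * pi * s / \<theta>) - 1 \<le> - \<bar>Re u\<bar>" using iu(2) by linarith
        moreover have "cos 1 \<le> cos (Im u)" using iu(1) pi_gt3 by (intro cos_mono_abs) auto
        ultimately have "cos 1 * exp (- (2 * pi * s / \<theta>) - 1) \<le> cos (Im u) * exp (- \<bar>Re u\<bar>)"
          using cos1 by (intro mult_mono) auto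
        also have "\<dots> \<le> strip_weight u" by (rule strip_weight_ge[OF us])
        finally show "m \<le> strip_weight u powr \<alpha>" unfolding m_def using cos1 \<alpha> by (intro powr_mono2) auto
      qed auto
      \<comment> \<open>The square root of \<open>m\<close>, with the part that depends on
        \<open>n\<close> separated from the constant \<open>c1\<close>.\<close>
      define t where "t = c1 * exp (- (\<alpha> * pi / \<theta>) * s)"
      have t0: "0 < t" using c1 by (simp add: t_def)
      have mt: "m = t\<^sup>2"
      proof -
        have "m = (cos 1 * exp (- 1)) powr \<alpha> * exp (\<alpha> * - (2 * pi * s / \<theta>))"
          unfolding m_def diff_conv_add_uminus exp_add using cos1 by (simp add: powr_mult exp_powr_real mult_ac)
        moreover have "(cos 1 * exp (- 1)) powr \<alpha> = c1\<^sup>2" using cos1 by (simp add: c1_def powr_power)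
        moreover have "exp (\<alpha> * - (2 * pi * s / \<theta>)) = (exp (- (\<alpha> * pi / \<theta>) * s))\<^sup>2"
          by (simp add: exp_double[symmetric] mult_ac)
        ultimately show ?thesis by (simp add: t_def power_mult_distrib)
      qed
      have "strip_deriv (lens_operator ?f) v = of_real \<theta> * strip_deriv ?f (of_real x)"
        using strip_deriv_lens_operator[OF sum(1) v(1)] unfolding v(2) .
      then have "\<theta> * B \<le> cmod (strip_deriv (lens_operator ?f) v)"
        using large \<theta> by (simp add: norm_mult)
      then have "t * (\<theta> * B) \<le> t * cmod (strip_deriv (lens_operator ?f) v)" using t0 by (intro mult_left_mono) auto
      also have "\<dots> \<le> dirichlet_norm \<alpha> (lens_operator ?f)"
      proof -
        have "(t * cmod (strip_deriv (lens_operator ?f) v))\<^sup>2 \<le> (dirichlet_norm \<alpha> (lens_operator ?f))\<^sup>2"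
          using loc by (simp add: mt power_mult_distrib)
        then show ?thesis by (rule power2_le_imp_le) (rule dirichlet_norm_sq(2)[OF \<alpha>'])
      qed
      finally have low: "t * (\<theta> * B) \<le> dirichlet_norm \<alpha> (lens_operator ?f)" .
      \<comment> \<open>The image already has positive norm, and a bounded operator cannot produce
        it from a function of norm zero.\<close>
      have posN: "0 < dirichlet_norm \<alpha> ?f"
      proof -
        obtain K where K: "0 < K" "\<And>f. f \<in> dirichlet_space \<alpha> \<Longrightarrow> dirichlet_norm \<alpha> (lens_operator f) \<le> K * dirichlet_norm \<alpha> f"
          using bounded_operator_bound[OF bdd] by blast
        have "0 < t * (\<theta> * B)" using t0 \<theta> B0 by simp
        then have "0 < K * dirichlet_norm \<alpha> ?f" using low K(2)[OF fH] by linarith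
        then show ?thesis using K(1) by (simp add: zero_less_mult_iff)
      qed
      have "c * exp (- b * sqrt (real n)) * dirichlet_norm \<alpha> ?f \<le> c * exp (- b * s) * (sqrt L * exp (5 * s) * B)"
        unfolding s_def[symmetric] using fN c by (intro mult_left_mono) auto
      also have "\<dots> = (c * sqrt L) * (exp (- b * s) * exp (5 * s)) * B" by simp
      also have "exp (- b * s) * exp (5 * s) = exp (- (\<alpha> * pi / \<theta>) * s)"
        unfolding exp_add[symmetric] by (simp add: b_def algebra_simps)
      also have "c * sqrt L = \<theta> * c1" using L by (simp add: c_def)
      also have "\<theta> * c1 * exp (- (\<alpha> * pi / \<theta>) * s) * B = t * (\<theta> * B)" by (simp add: t_def)
      finally show "0 < dirichlet_norm \<alpha> ?f \<and> c * exp (- b * sqrt (real n)) * dirichlet_norm \<alpha> ?f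
          \<le> dirichlet_norm \<alpha> (lens_operator ?f)"
        using posN low by linarith
    qed
  qed
  moreover have "0 < b" using \<alpha> \<theta> by (simp add: b_def add_pos_nonneg)
  ultimately show ?thesis using c by blast
qed

end

text \<open>With \<open>x = t * sqrt (n + 1)\<close>, the inequality
  \<open>(x / 4)^4 \<le> exp x\<close> bounds the terms by a multiple of
  \<open>1 / (n + 1)^2\<close>.\<close>

lemma summable_exp_minus_sqrt:
  assumes "0 < t"
  shows "summable (\<lambda>n. exp (- t * sqrt (real (Suc n))))"
proof (rule summable_comparison_test')
  have "summable (\<lambda>n. inverse (real n ^ 2))" by (rule inverse_power_summable) simp
  then show "summable (\<lambda>n. (4 / t) ^ 4 * inverse (real (Suc n) ^ 2))"
    by (intro summable_mult) (simp only: summable_Suc_iff[of "\<lambda>n. inverse (real n ^ 2)"])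
  fix n :: nat
  define x where "x = t * sqrt (real (Suc n))"
  have x: "0 < x" using assms by (simp add: x_def)
  have "x / 4 \<le> exp (x / 4)" using exp_ge_add_one_self[of "x / 4"] by linarith
  then have "(x / 4) ^ 4 \<le> exp (x / 4) ^ 4" using x by (intro power_mono) auto
  then have "(x / 4) ^ 4 \<le> exp x" by (simp add: exp_of_nat_mult[symmetric])
  then have "exp (- x) \<le> inverse ((x / 4) ^ 4)" using x by (simp add: exp_minus le_imp_inverse_le)
  also have "\<dots> = (4 / t) ^ 4 * inverse (real (Suc n) ^ 2)"
  proof -
    have "sqrt (real (Suc n)) ^ 4 = (sqrt (real (Suc n)) ^ 2) ^ 2" by (simp only: power_mult[symmetric]) simp
    then have "sqrt (real (Suc n)) ^ 4 = real (Suc n) ^ 2" by simp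
    then show ?thesis unfolding x_def by (simp only: power_divide power_mult_distrib inverse_divide) (simp add: divide_simps)
  qed
  finally show "norm (exp (- t * sqrt (real (Suc n)))) \<le> (4 / t) ^ 4 * inverse (real (Suc n) ^ 2)"
    by (simp add: x_def)
qed

theorem theorem5p10:
  fixes \<theta> :: real
  assumes "0 < \<theta>" and "\<theta> < 1"
  shows "bounded_operator (dirichlet_space 0) (dirichlet_norm 0) (composition_operator (lens_map \<theta>)) \<and>
    \<not> compact_operator (dirichlet_space 0) (dirichlet_norm 0) (composition_operator (lens_map \<theta>)) \<and>
    (\<forall>\<alpha>>0.
      compact_operator (dirichlet_space \<alpha>) (dirichlet_norm \<alpha>) (composition_operator (lens_map \<theta>)) \<and>
      (\<exists>b b' c C. b > b' \<and> b' > 0 \<and> c > 0 \<and> C > 0 \<and>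
        (\<forall>n\<ge>1.
          c * exp (- b * sqrt (real n))
            \<le> approx_number (dirichlet_space \<alpha>) (dirichlet_norm \<alpha>) n (composition_operator (lens_map \<theta>)) \<and>
          approx_number (dirichlet_space \<alpha>) (dirichlet_norm \<alpha>) n (composition_operator (lens_map \<theta>))
            \<le> C * exp (- b' * sqrt (real n)))) \<and>
      (\<forall>p>0. composition_operator (lens_map \<theta>)
        \<in> schatten_class (dirichlet_space \<alpha>) (dirichlet_norm \<alpha>) p))"
proof (intro conjI allI impI)
  show "bounded_operator (dirichlet_space 0) (dirichlet_norm 0) (composition_operator (lens_map \<theta>))"
    by (rule lens_operator_bounded_0[OF assms])
  show "\<not> compact_operator (dirichlet_space 0) (dirichlet_norm 0) (composition_operator (lens_map \<theta>))"
    by (rule lens_operator_not_compact[OF assms])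
  fix \<alpha> :: real assume \<alpha>: "0 < \<alpha>"
  let ?a = "\<lambda>n. approx_number (dirichlet_space \<alpha>) (dirichlet_norm \<alpha>) n (composition_operator (lens_map \<theta>))"
  show compact: "compact_operator (dirichlet_space \<alpha>) (dirichlet_norm \<alpha>) (composition_operator (lens_map \<theta>))"
    by (rule lens_operator_compact[OF assms \<alpha>])
  obtain b' C where b': "0 < b'" and C: "0 < C" and up: "\<forall>n\<ge>1. ?a n \<le> C * exp (- b' * sqrt (real n))"
    using lens_operator_approx_upper[OF assms \<alpha>] by blast
  obtain b0 c where b0: "0 < b0" and c: "0 < c" and low: "\<forall>n\<ge>1. c * exp (- b0 * sqrt (real n)) \<le> ?a n"
    using lens_operator_approx_lower[OF assms \<alpha>] by blast
  \<comment> \<open>Adding \<open>b'\<close> to \<open>b0\<close> weakens the lower estimate and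
    ensures that the two exponents are strictly ordered.\<close>
  have low': "c * exp (- (b0 + b') * sqrt (real n)) \<le> ?a n" if "1 \<le> n" for n
  proof -
    have "c * exp (- (b0 + b') * sqrt (real n)) \<le> c * exp (- b0 * sqrt (real n))"
      using b' c by (intro mult_left_mono) (auto simp: algebra_simps)
    also have "\<dots> \<le> ?a n" using low that by blast
    finally show ?thesis .
  qed
  show "\<exists>b b' c C. b > b' \<and> b' > 0 \<and> c > 0 \<and> C > 0 \<and>
      (\<forall>n\<ge>1. c * exp (- b * sqrt (real n)) \<le> ?a n \<and> ?a n \<le> C * exp (- b' * sqrt (real n)))"
    using b' b0 c C up low' by (intro exI[of _ "b0 + b'"] exI[of _ b'] exI[of _ c] exI[of _ C]) auto
  fix p :: real assume p: "0 < p"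
  interpret quadratic_normed_space "dirichlet_space \<alpha>" "dirichlet_norm \<alpha>"
    by (rule dirichlet_quadratic_normed_space) (use \<alpha> in simp)
  have "summable (\<lambda>n. ?a (Suc n) powr p)"
  proof (rule summable_comparison_test')
    show "summable (\<lambda>n. C powr p * exp (- (b' * p) * sqrt (real (Suc n))))"
      using b' p by (intro summable_mult summable_exp_minus_sqrt) simp
    fix n :: nat
    have "0 \<le> ?a (Suc n)" by (rule approx_number_nonneg[OF lens_operator_bounded_pos[OF assms \<alpha>]]) simp
    moreover have "?a (Suc n) \<le> C * exp (- b' * sqrt (real (Suc n)))" by (rule up[rule_format]) simp
    ultimately have "?a (Suc n) powr p \<le> (C * exp (- b' * sqrt (real (Suc n)))) powr p"
      using p by (intro powr_mono2) auto
    also have "\<dots> = C powr p * exp (- (b' * p) * sqrt (real (Suc n)))"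
      using C by (simp add: powr_mult exp_powr_real mult_ac)
    finally show "norm (?a (Suc n) powr p) \<le> C powr p * exp (- (b' * p) * sqrt (real (Suc n)))" by simp
  qed
  then show "composition_operator (lens_map \<theta>) \<in> schatten_class (dirichlet_space \<alpha>) (dirichlet_norm \<alpha>) p"
    unfolding schatten_class_def using compact by blast
qed

end
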